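(* Let $\alpha,\beta\in\mathbb{N}\cup\{0\}$, $t,r\in[1,\infty)$, and $p_1\in(1,r')$ such that $t\frac{p_1'/r-1}{p_1'-1}>1$. Let $U$ be a sublinear operator which enjoys an $(L(\log L)^\beta,L^r)$-bilinear sparse domination with bound $D$. Then for any weight $u$ and any bounded function $f$ with compact support, $$u(\{x\in\mathbb{R}^d:|Uf(x)|>1\})\lesssim\Big(1+\Big\{Dp_1'^{\,1+\beta}\Big(\frac{p_1'}{r}\Big)'\Big(t\frac{p_1'/r-1}{p_1'-1}\Big)'^{\frac1{p_1'}}\Big\}^{p_1}\Big)\int_{\mathbb{R}^d}|f(y)|\log^\beta(\mathrm{e}+|f(y)|)M_tu(y)\,dy,$$ where the implicit constant depends only on $d$, $\beta$ and the sparseness parameter $\eta$.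
   Context: $s'=s/(s-1)$ denotes the conjugate exponent (with $1'=\infty$). $M$ is the Hardy–Littlewood maximal operator, $M_tu=(M(u^t))^{1/t}$, $u(E)=\int_Eu$. An operator $U$ on $\bigcup_{p\ge1}L^p(\mathbb{R}^d)$ is sublinear if $|U(f_1+f_2)(x)|\le|Uf_1(x)|+|Uf_2(x)|$ and $|\lambda Uf(x)|=|U(\lambda f)(x)|$ for all $\lambda\in\mathbb{R}$. For a cube $Q$, $\langle|g|\rangle_{Q,r}=(\frac1{|Q|}\int_Q|g|^r)^{1/r}$ and $\|f\|_{L(\log L)^\beta,Q}=\inf\{\lambda>0:\frac1{|Q|}\int_Q\frac{|f|}{\lambda}\log^\beta(\mathrm{e}+\frac{|f|}{\lambda})\le1\}$. A family $\mathcal{S}$ of cubes is $\eta$-sparse ($\eta\in(0,1)$ fixed) if each $Q\in\mathcal{S}$ has a measurable $E_Q\subset Q$ with $|E_Q|\ge\eta|Q|$, the $E_Q$ pairwise disjoint. $\mathcal{A}_{\mathcal{S};L(\log L)^\beta,L^r}(f,g)=\sum_{Q\in\mathcal{S}}|Q|\|f\|_{L(\log L)^\beta,Q}\langle|g|\rangle_{Q,r}$. $U$ enjoys an $(L(\log L)^\beta,L^r)$-bilinear sparse domination with bound $D$ if for each bounded compactly supported $f$ there is an $\eta$-sparse family $\mathcal{S}$ such that for all $g\in L^r_{\mathrm{loc}}(\mathbb{R}^d)$, $|\int_{\mathbb{R}^d}g(x)Uf(x)\,dx|\le D\,\mathcal{A}_{\mathcal{S};L(\log L)^\beta,L^r}(f,g)$.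 *)

theory Defs
  imports "HOL-Analysis.Analysis"
begin

text \<open>Conjugate exponent s' = s/(s-1); only used for s > 1 (finite case).\<close>
definition conj_exp :: "real \<Rightarrow> real" where
  "conj_exp s = s / (s - 1)"

definition is_cube :: "'a::euclidean_space set \<Rightarrow> bool" where
  "is_cube Q \<longleftrightarrow> (\<exists>x l. 0 < l \<and> Q = cbox x (x + l *\<^sub>R One))"

definition in_Lp :: "real \<Rightarrow> ('a::euclidean_space \<Rightarrow> real) \<Rightarrow> bool" where
  "in_Lp p f \<longleftrightarrow> f \<in> borel_measurable lebesgue \<and>
     (\<integral>\<^sup>+ x. ennreal (\<bar>f x\<bar> powr p) \<partial>lebesgue) < \<infinity>"

definition in_Lp_loc :: "real \<Rightarrow> ('a::euclidean_space \<Rightarrow> real) \<Rightarrow> bool" where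
  "in_Lp_loc p g \<longleftrightarrow> g \<in> borel_measurable lebesgue \<and>
     (\<forall>K. compact K \<longrightarrow> (\<integral>\<^sup>+ x. ennreal (\<bar>g x\<bar> powr p) * indicator K x \<partial>lebesgue) < \<infinity>)"

definition sublinear_op :: "(('a::euclidean_space \<Rightarrow> real) \<Rightarrow> ('a \<Rightarrow> real)) \<Rightarrow> bool" where
  "sublinear_op U \<longleftrightarrow>
     (\<forall>f. (\<exists>p\<ge>1. in_Lp p f) \<longrightarrow> U f \<in> borel_measurable lebesgue) \<and>
     (\<forall>f1 f2. (\<exists>p\<ge>1. in_Lp p f1) \<longrightarrow> (\<exists>p\<ge>1. in_Lp p f2) \<longrightarrow>
        (\<forall>x. \<bar>U (\<lambda>y. f1 y + f2 y) x\<bar> \<le> \<bar>U f1 x\<bar> + \<bar>U f2 x\<bar>)) \<and>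
     (\<forall>f c. (\<exists>p\<ge>1. in_Lp p f) \<longrightarrow> (\<forall>x. \<bar>c * U f x\<bar> = \<bar>U (\<lambda>y. c * f y) x\<bar>))"

definition weight :: "('a::euclidean_space \<Rightarrow> real) \<Rightarrow> bool" where
  "weight u \<longleftrightarrow> u \<in> borel_measurable lebesgue \<and> (\<forall>x. 0 \<le> u x) \<and>
     (\<forall>K. compact K \<longrightarrow> (\<integral>\<^sup>+ x. ennreal (u x) * indicator K x \<partial>lebesgue) < \<infinity>)"

definition wmeasure :: "('a::euclidean_space \<Rightarrow> real) \<Rightarrow> 'a set \<Rightarrow> ennreal" where
  "wmeasure u E = (\<integral>\<^sup>+ x. ennreal (u x) * indicator E x \<partial>lebesgue)"

definition maxop :: "('a::euclidean_space \<Rightarrow> real) \<Rightarrow> 'a \<Rightarrow> ennreal" where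
  "maxop g x = (SUP Q \<in> {Q. is_cube Q \<and> x \<in> Q}.
      (\<integral>\<^sup>+ y. ennreal \<bar>g y\<bar> * indicator Q y \<partial>lebesgue) / ennreal (measure lebesgue Q))"

definition maxop_t :: "real \<Rightarrow> ('a::euclidean_space \<Rightarrow> real) \<Rightarrow> 'a \<Rightarrow> ennreal" where
  "maxop_t t u x = (let m = maxop (\<lambda>y. \<bar>u y\<bar> powr t) x in
      if m = \<infinity> then \<infinity> else ennreal (enn2real m powr (1 / t)))"

definition LlogL_norm :: "nat \<Rightarrow> ('a::euclidean_space \<Rightarrow> real) \<Rightarrow> 'a set \<Rightarrow> real" where
  "LlogL_norm \<beta> f Q = Inf {lam::real. 0 < lam \<and>
      (\<integral>\<^sup>+ x. ennreal (\<bar>f x\<bar> / lam * (ln (exp 1 + \<bar>f x\<bar> / lam)) ^ \<beta>) * indicator Q x \<partial>lebesgue)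
        \<le> ennreal (measure lebesgue Q)}"

definition avg_r :: "real \<Rightarrow> ('a::euclidean_space \<Rightarrow> real) \<Rightarrow> 'a set \<Rightarrow> real" where
  "avg_r r g Q = (enn2real (\<integral>\<^sup>+ x. ennreal (\<bar>g x\<bar> powr r) * indicator Q x \<partial>lebesgue)
                    / measure lebesgue Q) powr (1 / r)"

definition sparse :: "real \<Rightarrow> 'a::euclidean_space set set \<Rightarrow> bool" where
  "sparse \<eta> S \<longleftrightarrow> (\<forall>Q\<in>S. is_cube Q) \<and>
     (\<exists>E. (\<forall>Q\<in>S. E Q \<in> sets lebesgue \<and> E Q \<subseteq> Q \<and> measure lebesgue (E Q) \<ge> \<eta> * measure lebesgue Q)
          \<and> disjoint_family_on E S)"

definition sparse_form :: "'a::euclidean_space set set \<Rightarrow> nat \<Rightarrow> real \<Rightarrow> ('a \<Rightarrow> real) \<Rightarrow> ('a \<Rightarrow> real) \<Rightarrow> ennreal" where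
  "sparse_form S \<beta> r f g =
     (\<Sum>\<^sub>\<infinity>Q\<in>S. ennreal (measure lebesgue Q * LlogL_norm \<beta> f Q * avg_r r g Q))"

definition bdd_cpt_supp :: "('a::euclidean_space \<Rightarrow> real) \<Rightarrow> bool" where
  "bdd_cpt_supp f \<longleftrightarrow> f \<in> borel_measurable lebesgue \<and> bounded (range f) \<and>
     (\<exists>K. compact K \<and> (\<forall>x. x \<notin> K \<longrightarrow> f x = 0))"

text \<open>(L(log L)^beta, L^r)-bilinear sparse domination with bound D and sparseness eta.
  The inequality |int g Uf| <= D A(f,g) is read as including the existence of the integral
  whenever the right-hand side is finite.\<close>
definition sparse_dom :: "real \<Rightarrow> nat \<Rightarrow> real \<Rightarrow> real \<Rightarrow> (('a::euclidean_space \<Rightarrow> real) \<Rightarrow> ('a \<Rightarrow> real)) \<Rightarrow> bool" where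
  "sparse_dom \<eta> \<beta> r D U \<longleftrightarrow>
     (\<forall>f. bdd_cpt_supp f \<longrightarrow> (\<exists>S. sparse \<eta> S \<and>
        (\<forall>g. in_Lp_loc r g \<longrightarrow> sparse_form S \<beta> r f g < \<infinity> \<longrightarrow>
            integrable lebesgue (\<lambda>x. g x * U f x) \<and>
            \<bar>\<integral>x. g x * U f x \<partial>lebesgue\<bar> \<le> D * enn2real (sparse_form S \<beta> r f g))))"

end

theory Submission
  imports Defs
begin

text \<open>
  The function \<open>\<Phi>(|f|)\<close>, where \<open>\<Phi>(x) = x log\<^sup>\<beta>(e + x)\<close>, is stopped at height 1 on dyadic
  cubes \<open>Q\<^sub>j\<close>. The tripled cubes carry little \<open>u\<close>-mass. A cube of the sparse family that is
  not inside their union contains, after tripling, every \<open>Q\<^sub>j\<close> that it meets; on such cubes the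
  Orlicz norm of \<open>f\<close> is controlled by the one of a function \<open>h \<le> 1\<close> which is 1 on the \<open>Q\<^sub>j\<close>, and then
  by an \<open>L\<^sup>s\<close> average with \<open>s = (1 + p) / 2\<close>. The sparse domination
  is applied to \<open>f\<close> itself, without splitting \<open>f\<close>, and tested on \<open>g = sgn(U f) w\<close>, with \<open>w\<close> the restriction of \<open>u\<close> to
  \<open>{|U f| > 1}\<close> outside the tripled cubes.

  Interpolating \<open>L\<^sup>r\<close> between \<open>L\<^sup>t\<close> and \<open>L\<^sup>\<kappa>\<close>, \<open>\<kappa> < 1\<close>, splits the average of \<open>w\<close> into a factor which is
  at most \<open>v\<^sup>1\<^sup>/\<^sup>p\<close>, \<open>v = M\<^sub>t w\<close>, pointwise on the cube and so moves inside the average of \<open>h\<close>, and a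
  factor with a bounded maximal function. Young's inequality absorbs the second factor into
  \<open>\<integral>w\<close>, and \<open>v\<close> is essentially constant on each \<open>Q\<^sub>j\<close>, which brings back \<open>\<integral>\<Phi>(|f|) v\<close>.
  Constants of the form \<open>C\<^sup>p\<close> are harmless because one can lower \<open>p\<close> to at most 2 beforehand.
\<close>

section \<open>Averages over cubes and the maximal operator\<close>

text \<open>The constants of the statement have separate sources. \<open>p'^\<beta>\<close> is the
  price of replacing \<open>x log^\<beta>(e + x)\<close> by a power \<open>x^s\<close>, with
  \<open>s\<close> strictly between 1 and \<open>p\<close>; one further \<open>p'\<close> comes from
  the maximal theorem at exponent \<open>p / s\<close>. The other two factors bound
  \<open>k'\<close>, the constant of the maximal theorem for \<open>w^(1/k)\<close> in
  \<open>L^k\<close>. Optimising Young's inequality leaves it to the power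
  \<open>p - 1 = p / p'\<close>, whence the exponent \<open>1 / p'\<close> inside the braces. The
  interpolation forces \<open>k = p' (1/r - 1/(p t))\<close>, and the hypothesis on \<open>t\<close>
  says precisely that \<open>k > 1\<close>. Absorbing the integral of \<open>w\<close> requires it
  to be finite, so the weight is truncated in height and in space, and monotone convergence removes
  the truncation at the end. This is why bounded nonnegative functions are the working class: it is
  stable under products, nonnegative powers and the maximal operator, and averages in it are real
  numbers. Since \<open>w\<close> vanishes on the tripled cubes, a cube that meets a stopped cube
  and sees \<open>w\<close> is at least as large as the stopped one; hence \<open>v\<close> barely
  varies there.\<close>

definition bdd_nonneg :: "('a::euclidean_space \<Rightarrow> real) \<Rightarrow> bool" where
  "bdd_nonneg g \<longleftrightarrow> g \<in> borel_measurable lebesgue \<and> (\<forall>x. 0 \<le> g x) \<and> (\<exists>B. \<forall>x. g x \<le> B)"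

definition ocube :: "'a::euclidean_space \<Rightarrow> real \<Rightarrow> 'a set" where
  "ocube c l = box c (c + l *\<^sub>R One)"

definition avg :: "('a::euclidean_space \<Rightarrow> real) \<Rightarrow> 'a \<Rightarrow> real \<Rightarrow> real" where
  "avg g c l = (\<integral>y. g y * indicator (ocube c l) y \<partial>lebesgue) / l ^ DIM('a)"

text \<open>Open cubes make the level sets of the maximal function open, hence measurable. The function
  never exceeds \<^const>\<open>maxop\<close>, which is all that the right-hand side of the theorem needs.\<close>

definition mx :: "('a::euclidean_space \<Rightarrow> real) \<Rightarrow> 'a \<Rightarrow> real" where
  "mx g x = (SUP (c, l) \<in> {(c, l). 0 < l \<and> x \<in> ocube c l}. avg g c l)"

lemma mem_ocube: "x \<in> ocube c l \<longleftrightarrow> (\<forall>i\<in>Basis. c \<bullet> i < x \<bullet> i \<and> x \<bullet> i < c \<bullet> i + l)"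
  by (auto simp: ocube_def mem_box inner_simps)

lemma ocube_ne:
  assumes "0 < l"
  shows "ocube c l \<noteq> {}"
proof -
  have "c + (l / 2) *\<^sub>R One \<in> ocube c l" using assms by (auto simp: mem_ocube inner_simps)
  then show ?thesis by blast
qed

lemma sets_ocube [measurable]: "ocube c l \<in> sets lebesgue"
  unfolding ocube_def using lmeasurable_box fmeasurableD by blast

lemma open_ocube: "open (ocube c l)"
  by (simp add: ocube_def open_box)

lemma emeasure_ocube: "0 \<le> l \<Longrightarrow> emeasure lebesgue (ocube (c::'a::euclidean_space) l) = ennreal (l ^ DIM('a))"
  by (simp add: ocube_def emeasure_lborel_box_eq inner_simps)

lemma measure_ocube: "0 \<le> l \<Longrightarrow> measure lebesgue (ocube (c::'a::euclidean_space) l) = l ^ DIM('a)"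
  unfolding measure_def by (subst emeasure_ocube) auto

lemma emeasure_cube: "0 \<le> l \<Longrightarrow>
    emeasure lebesgue (cbox c (c + l *\<^sub>R One) :: 'a::euclidean_space set) = ennreal (l ^ DIM('a))"
  by (simp add: emeasure_lborel_cbox_eq inner_simps)

lemma measure_cube: "0 \<le> l \<Longrightarrow>
    measure lebesgue (cbox c (c + l *\<^sub>R One) :: 'a::euclidean_space set) = l ^ DIM('a)"
  unfolding measure_def by (subst emeasure_cube) auto

lemma cube_diff_ocube_null: "cbox c (c + l *\<^sub>R One) - ocube c l \<in> null_sets lebesgue"
proof -
  have "negligible (cbox c (c + l *\<^sub>R One) - ocube c l)"
    unfolding ocube_def using negligible_frontier_interval by blast
  then show ?thesis
    by (simp add: negligible_iff_null_sets)
qed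

lemma bdd_nonneg_measurable: "bdd_nonneg g \<Longrightarrow> g \<in> borel_measurable lebesgue"
  by (simp add: bdd_nonneg_def)

lemma bdd_nonneg_ge0: "bdd_nonneg g \<Longrightarrow> 0 \<le> g x"
  by (simp add: bdd_nonneg_def)

lemma bdd_nonneg_powr:
  assumes "bdd_nonneg g" "0 \<le> s"
  shows "bdd_nonneg (\<lambda>x. g x powr s)"
proof -
  have [measurable]: "g \<in> borel_measurable lebesgue" using assms by (simp add: bdd_nonneg_def)
  obtain B where B: "\<And>x. g x \<le> B" using assms(1) by (auto simp: bdd_nonneg_def)
  have "\<forall>x. g x powr s \<le> B powr s"
    using assms B by (auto intro!: powr_mono2 simp: bdd_nonneg_def)
  then show ?thesis by (auto simp: bdd_nonneg_def)
qed

lemma bdd_nonneg_mult: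
  assumes "bdd_nonneg f" "bdd_nonneg g"
  shows "bdd_nonneg (\<lambda>x. f x * g x)"
proof -
  have [measurable]: "f \<in> borel_measurable lebesgue" "g \<in> borel_measurable lebesgue"
    using assms by (auto simp: bdd_nonneg_def)
  obtain A B where A: "\<And>x. f x \<le> A" and B: "\<And>x. g x \<le> B" using assms by (auto simp: bdd_nonneg_def)
  have "f x * g x \<le> A * B" for x
    using A[of x] B[of x] assms by (intro mult_mono) (auto simp: bdd_nonneg_def intro: order_trans)
  then show ?thesis using assms by (auto simp: bdd_nonneg_def)
qed

lemma bdd_nonneg_indicator: "A \<in> sets lebesgue \<Longrightarrow> bdd_nonneg (indicator A)"
  by (auto simp: bdd_nonneg_def indicator_le_1)

lemma integrable_on_fmeasurable:
  assumes "bdd_nonneg g" "A \<in> sets lebesgue" "emeasure lebesgue A < \<infinity>"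
  shows "integrable lebesgue (\<lambda>y. g y * indicator A y)"
proof -
  obtain B where B: "\<And>x. g x \<le> B" using assms(1) by (auto simp: bdd_nonneg_def)
  have "integrable lebesgue (\<lambda>y. B * indicator A y :: real)"
    using assms by (intro integrable_mult_right) (simp add: integrable_indicator_iff)
  moreover have "(\<lambda>y. g y * indicator A y) \<in> borel_measurable lebesgue"
    using assms by (auto simp: bdd_nonneg_def)
  ultimately show ?thesis
    by (rule Bochner_Integration.integrable_bound)
       (use B assms in \<open>auto intro!: AE_I2 intro: order_trans[OF _ abs_ge_self]
         simp: indicator_def bdd_nonneg_def abs_of_nonneg\<close>)
qed

lemma integrable_on_ocube:
  assumes "bdd_nonneg g" "0 \<le> l"
  shows "integrable lebesgue (\<lambda>y. g y * indicator (ocube c l) y)"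
  using assms by (intro integrable_on_fmeasurable) (auto simp: emeasure_ocube simp del: emeasure_completion)

lemma avg_mono:
  assumes "bdd_nonneg f" "bdd_nonneg g" "0 < l" "\<And>x. x \<in> ocube c l \<Longrightarrow> f x \<le> g x"
  shows "avg f c l \<le> avg g c l"
  unfolding avg_def using assms
  by (intro divide_right_mono integral_mono integrable_on_ocube) (auto simp: indicator_def)

lemma avg_nonneg: "bdd_nonneg g \<Longrightarrow> 0 < l \<Longrightarrow> 0 \<le> avg g c l"
  unfolding avg_def by (auto intro!: divide_nonneg_nonneg integral_nonneg_AE simp: bdd_nonneg_def)

lemma avg_le_const:
  assumes "bdd_nonneg g" "\<And>x. g x \<le> B" "0 < l"
  shows "avg g (c::'a::euclidean_space) l \<le> B"
proof -
  have "(\<integral>y. g y * indicator (ocube c l) y \<partial>lebesgue) \<le> (\<integral>y. B * indicator (ocube c l) y \<partial>lebesgue)"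
    using assms by (intro integral_mono integrable_on_ocube)
       (auto simp: indicator_def bdd_nonneg_def intro: order_trans)
  also have "\<dots> = B * l ^ DIM('a)"
    using assms by (simp add: measure_ocube)
  finally show ?thesis using assms by (simp add: avg_def divide_simps)
qed

lemma avg_le_dilate:
  fixes c :: "'a::euclidean_space"
  assumes "bdd_nonneg g" "0 < l" "ocube c l \<subseteq> ocube c' (3 * l)"
  shows "avg g c l \<le> 3 ^ DIM('a) * avg g c' (3 * l)"
proof -
  have "(\<integral>y. g y * indicator (ocube c l) y \<partial>lebesgue)
      \<le> (\<integral>y. g y * indicator (ocube c' (3 * l)) y \<partial>lebesgue)"
    using assms by (intro integral_mono integrable_on_ocube) (auto simp: indicator_def bdd_nonneg_def)
  then show ?thesis
    using assms(2) by (simp add: avg_def power_mult_distrib divide_right_mono)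
qed

lemma ocube_subset_triple: "ocube c l \<subseteq> ocube (c - l *\<^sub>R One) (3 * l)" if "0 < l"
  using that by (fastforce simp: mem_ocube inner_simps)

lemma cube_subset_triple: "cbox c (c + l *\<^sub>R One) \<subseteq> ocube (c - l *\<^sub>R One) (3 * l)" if "0 < l"
  using that by (fastforce simp: mem_ocube mem_box inner_simps)

lemma meeting_ocube_subset_triple:
  assumes "ocube c l \<inter> ocube c' l' \<noteq> {}" "l \<le> l'"
  shows "ocube c l \<subseteq> ocube (c' - l' *\<^sub>R One) (3 * l')"
  using assms by (fastforce simp: mem_ocube inner_simps)

lemma ex_ocube: "\<exists>c l. 0 < l \<and> x \<in> ocube c l"
  by (rule exI[of _ "x - One"], rule exI[of _ 2]) (auto simp: mem_ocube inner_simps)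

lemma bdd_above_avg:
  assumes "bdd_nonneg g"
  shows "bdd_above ((\<lambda>(c, l). avg g c l) ` {(c, l). 0 < l \<and> x \<in> ocube c l})"
proof -
  obtain B where B: "\<And>x. g x \<le> B" using assms(1) by (auto simp: bdd_nonneg_def)
  show ?thesis
    by (rule bdd_aboveI[of _ B]) (auto intro!: avg_le_const assms B)
qed

lemma avg_le_mx:
  assumes "bdd_nonneg g" "0 < l" "x \<in> ocube c l"
  shows "avg g c l \<le> mx g x"
proof -
  have "(case (c, l) of (c, l) \<Rightarrow> avg g c l) \<le> mx g x"
    unfolding mx_def using assms by (intro cSUP_upper bdd_above_avg) auto
  then show ?thesis by simp
qed

lemma mx_le:
  assumes "\<And>c l. 0 < l \<Longrightarrow> x \<in> ocube c l \<Longrightarrow> avg g c l \<le> y"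
  shows "mx g x \<le> y"
  unfolding mx_def using ex_ocube[of x] assms by (intro cSUP_least) auto

lemma less_mx_iff:
  assumes "bdd_nonneg g"
  shows "y < mx g x \<longleftrightarrow> (\<exists>c l. 0 < l \<and> x \<in> ocube c l \<and> y < avg g c l)"
  by (meson assms avg_le_mx leD le_less_linear less_le_trans mx_le)

lemma mx_nonneg: "bdd_nonneg g \<Longrightarrow> 0 \<le> mx g x"
  using ex_ocube[of x] avg_le_mx avg_nonneg by (meson order_trans)

lemma open_mx_gt:
  assumes "bdd_nonneg g"
  shows "open {x. y < mx g x}"
proof -
  have "{x. y < mx g x} = (\<Union>(c, l)\<in>{(c, l). 0 < l \<and> y < avg g c l}. ocube c l)"
    by (auto simp: less_mx_iff[OF assms])
  then show ?thesis by (auto intro!: open_UN open_ocube)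
qed

lemma mx_borel_measurable:
  assumes "bdd_nonneg g"
  shows "mx g \<in> borel_measurable borel"
  using open_mx_gt[OF assms] by (intro borel_measurableI_greater) (auto intro: borel_open)

lemma bdd_nonneg_mx:
  assumes "bdd_nonneg g"
  shows "bdd_nonneg (mx g)"
proof -
  obtain B where B: "\<And>x. g x \<le> B" using assms(1) by (auto simp: bdd_nonneg_def)
  have "mx g x \<le> B" for x
    by (rule mx_le) (auto intro: avg_le_const assms B)
  moreover have "mx g \<in> borel_measurable lebesgue"
    using mx_borel_measurable[OF assms] by (simp add: measurable_completion)
  ultimately show ?thesis
    using mx_nonneg[OF assms] by (auto simp: bdd_nonneg_def)
qed

section \<open>Covering argument, weak and strong type bounds for the maximal operator\<close>

lemma finite_Vitali:
  fixes F :: "('a::euclidean_space \<times> real) set"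
  assumes "finite F" "\<And>c l. (c, l) \<in> F \<Longrightarrow> 0 < l"
  shows "\<exists>G\<subseteq>F. disjoint_family_on (\<lambda>(c, l). ocube c l) G \<and>
    (\<Union>(c, l)\<in>F. ocube c l) \<subseteq> (\<Union>(c, l)\<in>G. ocube (c - l *\<^sub>R One) (3 * l))"
  using assms
proof (induction "card F" arbitrary: F rule: less_induct)
  case less
  show ?case
  proof (cases "F = {}")
    case False
    \<comment> \<open>Greedy choice: a cube of largest side swallows, after tripling, every cube
      that it meets, and the induction takes care of the cubes disjoint from it.\<close>
    obtain c0 l0 where m: "(c0, l0) \<in> F" "\<And>c l. (c, l) \<in> F \<Longrightarrow> l \<le> l0"
    proof -
      have "Max (snd ` F) \<in> snd ` F" using less.prems False by (intro Max_in) auto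
      then obtain c0 l0 where "(c0, l0) \<in> F" "l0 = Max (snd ` F)" by force
      moreover have "l \<le> Max (snd ` F)" if "(c, l) \<in> F" for c l
        using that less.prems by (intro Max_ge) force+
      ultimately show ?thesis using that by blast
    qed
    define F' where "F' = {(c, l) \<in> F. ocube c l \<inter> ocube c0 l0 = {}}"
    have ne: "ocube c0 l0 \<noteq> {}"
      using less.prems(2)[OF m(1)] by (rule ocube_ne)
    have F': "F' \<subseteq> F" "(c0, l0) \<notin> F'" using ne by (auto simp: F'_def)
    then have "card F' < card F" using m(1) less.prems(1) by (intro psubset_card_mono) auto
    from less.hyps[OF this] F' less.prems obtain G where G: "G \<subseteq> F'"
      "disjoint_family_on (\<lambda>(c, l). ocube c l) G"
      "(\<Union>(c, l)\<in>F'. ocube c l) \<subseteq> (\<Union>(c, l)\<in>G. ocube (c - l *\<^sub>R One) (3 * l))"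
      by (meson finite_subset subsetD)
    show ?thesis
    proof (intro exI[of _ "insert (c0, l0) G"] conjI)
      show "insert (c0, l0) G \<subseteq> F" using G F' m by auto
      show "disjoint_family_on (\<lambda>(c, l). ocube c l) (insert (c0, l0) G)"
        using G(1,2) unfolding disjoint_family_on_def F'_def by fastforce
      show "(\<Union>(c, l)\<in>F. ocube c l) \<subseteq> (\<Union>(c, l)\<in>insert (c0, l0) G. ocube (c - l *\<^sub>R One) (3 * l))"
      proof safe
        fix x c l assume *: "(c, l) \<in> F" "x \<in> ocube c l"
        show "x \<in> (\<Union>(c, l)\<in>insert (c0, l0) G. ocube (c - l *\<^sub>R One) (3 * l))"
        proof (cases "(c, l) \<in> F'")
          case True
          then show ?thesis using * G(3) by fastforce
        next
          case False
          then have "ocube c l \<subseteq> ocube (c0 - l0 *\<^sub>R One) (3 * l0)"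
            using * m by (intro meeting_ocube_subset_triple) (auto simp: F'_def)
          then show ?thesis using * by auto
        qed
      qed
    qed
  qed (auto simp: disjoint_family_on_def)
qed

text \<open>Inner regularity along a compact exhaustion. It is what allows a covering lemma for
  finite families to bound the measure of a whole open level set.\<close>

lemma emeasure_open_le:
  fixes V :: "'a::euclidean_space set"
  assumes "open V" "\<And>K. compact K \<Longrightarrow> K \<subseteq> V \<Longrightarrow> emeasure lebesgue K \<le> m"
  shows "emeasure lebesgue V \<le> m"
proof -
  obtain C :: "nat \<Rightarrow> 'a set" where C: "\<And>n. compact (C n)" "\<And>n. C n \<subseteq> V"
    "\<And>n. C n \<subseteq> interior (C (Suc n))" "\<Union>(range C) = V"
    using open_Union_compact_subsets[OF assms(1)] by metis
  have "incseq C" using C(3) interior_subset by (intro incseq_SucI) blast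
  moreover have "range C \<subseteq> sets lebesgue"
    using C(1) by (metis compact_imp_closed borel_closed image_subsetI sets_completionI_sets sets_lborel)
  ultimately have "(SUP n. emeasure lebesgue (C n)) = emeasure lebesgue V"
    using C(4) SUP_emeasure_incseq by metis
  then show ?thesis
    using assms(2) C by (metis SUP_least)
qed

text \<open>A compact part of the level set is covered by finitely many cubes with mean above
  \<open>y\<close>. After the selection, each tripled cube costs \<open>3 ^ DIM('a) / y\<close>
  times the integral of \<open>g\<close> over the cube itself, and disjointness bounds the sum of
  these by the whole integral.\<close>

lemma weak_type_mx:
  fixes g :: "'a::euclidean_space \<Rightarrow> real"
  assumes "bdd_nonneg g" "0 < y"
  shows "ennreal y * emeasure lebesgue {x. y < mx g x} \<le> 3 ^ DIM('a) * (\<integral>\<^sup>+x. ennreal (g x) \<partial>lebesgue)"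
proof -
  note [measurable] = bdd_nonneg_measurable[OF assms(1)]
  let ?I = "\<integral>\<^sup>+x. ennreal (g x) \<partial>lebesgue"
  have "emeasure lebesgue {x. y < mx g x} \<le> 3 ^ DIM('a) * ?I / ennreal y"
  proof (rule emeasure_open_le[OF open_mx_gt[OF assms(1)]])
    fix K assume K: "compact K" "K \<subseteq> {x. y < mx g x}"
    define P where "P = {(c::'a, l). 0 < l \<and> y < avg g c l}"
    have KP: "K \<subseteq> (\<Union>p\<in>P. case p of (c, l) \<Rightarrow> ocube c l)"
      using K by (auto simp: less_mx_iff[OF assms(1)] P_def)
    then obtain F where F: "F \<subseteq> P" "finite F" "K \<subseteq> (\<Union>p\<in>F. case p of (c, l) \<Rightarrow> ocube c l)"
    proof -
      have "open (case p of (c, l) \<Rightarrow> ocube c l)" for p :: "'a \<times> real"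
        by (cases p) (simp add: open_ocube)
      then show ?thesis
        using compactE_image[OF K(1), of P "\<lambda>p. case p of (c, l) \<Rightarrow> ocube c l"] KP that by metis
    qed
    obtain G where G: "G \<subseteq> F" "disjoint_family_on (\<lambda>(c, l). ocube c l) G"
      "(\<Union>(c, l)\<in>F. ocube c l) \<subseteq> (\<Union>(c, l)\<in>G. ocube (c - l *\<^sub>R One) (3 * l))"
      using finite_Vitali[OF F(2)] F(1) by (auto simp: P_def)
    have fG: "finite G" using G F finite_subset by blast
    have "emeasure lebesgue K \<le> emeasure lebesgue (\<Union>(c, l)\<in>G. ocube (c - l *\<^sub>R One) (3 * l))"
      using F G fG by (intro emeasure_mono) (auto split: prod.splits)
    also have "\<dots> \<le> (\<Sum>p\<in>G. emeasure lebesgue (case p of (c, l) \<Rightarrow> ocube (c - l *\<^sub>R One) (3 * l)))"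
      using fG by (intro emeasure_subadditive_finite) auto
    also have "\<dots> \<le> (\<Sum>p\<in>G. 3 ^ DIM('a) / ennreal y *
        (\<integral>\<^sup>+x. ennreal (g x) * indicator (case p of (c, l) \<Rightarrow> ocube c l) x \<partial>lebesgue))"
    proof (rule sum_mono)
      fix p assume "p \<in> G"
      then obtain c l where p: "p = (c, l)" "0 < l" "y < avg g c l"
        using G F by (auto simp: P_def)
      have "(\<integral>\<^sup>+x. ennreal (g x) * indicator (ocube c l) x \<partial>lebesgue)
          = (\<integral>\<^sup>+x. ennreal (g x * indicator (ocube c l) x) \<partial>lebesgue)"
        by (intro nn_integral_cong) (auto simp: indicator_def)
      also have "\<dots> = ennreal (\<integral>x. g x * indicator (ocube c l) x \<partial>lebesgue)"
        using assms p by (intro nn_integral_eq_integral integrable_on_ocube) (auto simp: bdd_nonneg_def)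
      finally have 1: "(\<integral>\<^sup>+x. ennreal (g x) * indicator (ocube c l) x \<partial>lebesgue)
        = ennreal (\<integral>x. g x * indicator (ocube c l) x \<partial>lebesgue)" .
      have "y * l ^ DIM('a) \<le> (\<integral>x. g x * indicator (ocube c l) x \<partial>lebesgue)"
        using p by (simp add: avg_def field_simps)
      then have "(3 * l) ^ DIM('a) \<le> 3 ^ DIM('a) / y * (\<integral>x. g x * indicator (ocube c l) x \<partial>lebesgue)"
        using assms(2) by (simp add: power_mult_distrib field_simps)
      moreover have "3 ^ DIM('a) / ennreal y = ennreal (3 ^ DIM('a) / y)"
        using assms(2) by (simp add: divide_ennreal[symmetric] ennreal_power[symmetric])
      ultimately show "emeasure lebesgue (case p of (c, l) \<Rightarrow> ocube (c - l *\<^sub>R One) (3 * l))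
        \<le> 3 ^ DIM('a) / ennreal y * (\<integral>\<^sup>+x. ennreal (g x) * indicator (case p of (c, l) \<Rightarrow> ocube c l) x \<partial>lebesgue)"
        using p assms(2) by (simp add: 1 emeasure_ocube ennreal_mult'[symmetric] ennreal_leI del: emeasure_completion)
    qed
    also have "\<dots> = 3 ^ DIM('a) / ennreal y *
        (\<integral>\<^sup>+x. (\<Sum>p\<in>G. ennreal (g x) * indicator (case p of (c, l) \<Rightarrow> ocube c l) x) \<partial>lebesgue)"
      by (subst nn_integral_sum) (auto simp: sum_distrib_left split: prod.splits)
    also have "\<dots> \<le> 3 ^ DIM('a) / ennreal y * ?I"
    proof (intro mult_left_mono nn_integral_mono)
      fix x
      have "(\<Sum>p\<in>G. indicator (case p of (c, l) \<Rightarrow> ocube c l) x :: ennreal) = indicator (\<Union>p\<in>G. case p of (c, l) \<Rightarrow> ocube c l) x"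
        using indicator_UN_disjoint[OF fG G(2)] by metis
      then have "(\<Sum>p\<in>G. ennreal (g x) * indicator (case p of (c, l) \<Rightarrow> ocube c l) x)
         = ennreal (g x) * indicator (\<Union>p\<in>G. case p of (c, l) \<Rightarrow> ocube c l) x"
        by (metis sum_distrib_left)
      also have "\<dots> \<le> ennreal (g x)" by (auto simp: indicator_def)
      finally show "(\<Sum>p\<in>G. ennreal (g x) * indicator (case p of (c, l) \<Rightarrow> ocube c l) x) \<le> ennreal (g x)" .
    qed auto
    finally show "emeasure lebesgue K \<le> 3 ^ DIM('a) * ?I / ennreal y"
      by (simp add: ennreal_times_divide mult.commute)
  qed
  then have "ennreal y * emeasure lebesgue {x. y < mx g x} \<le> ennreal y * (3 ^ DIM('a) * ?I / ennreal y)"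
    by (rule mult_left_mono) auto
  also have "\<dots> = 3 ^ DIM('a) * ?I"
    using assms(2) by (metis ennreal_times_divide ennreal_mult_divide_eq ennreal_eq_0_iff ennreal_neq_top leD mult.commute)
  finally show ?thesis .
qed

lemma nn_integral_powr_Ioo:
  fixes a m :: real
  assumes "-1 < a" "0 \<le> m"
  shows "(\<integral>\<^sup>+y. ennreal (y powr a) * indicator {0<..<m} y \<partial>lborel) = ennreal (m powr (a + 1) / (a + 1))"
proof -
  have "((\<lambda>y. y powr a) has_integral (m powr (a + 1) / (a + 1))) {0<..<m}"
    using has_integral_powr_from_0[OF assms] by (simp add: has_integral_Icc_iff_Ioo)
  then show ?thesis
    by (intro nn_integral_has_integral_lebesgue') auto
qed

text \<open>Tonelli's theorem is applied below to the completed measure, because the functions are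
  only Lebesgue measurable.\<close>

lemma sigma_finite_lebesgue: "sigma_finite_measure (lebesgue :: 'a::euclidean_space measure)"
proof
  show "\<exists>A::'a set set. countable A \<and> A \<subseteq> sets lebesgue \<and> \<Union> A = space lebesgue
        \<and> (\<forall>a\<in>A. emeasure lebesgue a \<noteq> \<infinity>)"
  proof (intro exI[of _ "range (\<lambda>n::nat. ball 0 (real n))"] conjI ballI)
    show "\<Union> (range (\<lambda>n::nat. ball 0 (real n))) = space (lebesgue :: 'a measure)"
      by (auto simp: reals_Archimedean2)
    fix a :: "'a set" assume "a \<in> range (\<lambda>n::nat. ball 0 (real n))"
    then show "emeasure lebesgue a \<noteq> \<infinity>"
      using emeasure_lborel_ball_finite[of "0::'a"] by (auto simp: less_top)
  qed auto
qed

text \<open>The part of \<open>g\<close> at or below \<open>y / 2\<close> contributes at most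
  \<open>y / 2\<close> to any average, so the rest must supply more than \<open>y / 2\<close>. This
  is the truncation in Marcinkiewicz interpolation.\<close>

lemma mx_le_truncated:
  assumes "bdd_nonneg g" "0 < y" "y < mx g x"
  shows "y / 2 < mx (\<lambda>z. g z * indicator {z. y / 2 < g z} z) x"
proof -
  note [measurable] = bdd_nonneg_measurable[OF assms(1)]
  let ?h = "\<lambda>z. g z * indicator {z. y / 2 < g z} z"
  have "{z \<in> space lebesgue. y / 2 < g z} \<in> sets lebesgue" by measurable
  then have S: "{z. y / 2 < g z} \<in> sets lebesgue" by simp
  have h: "bdd_nonneg ?h"
    using assms by (intro bdd_nonneg_mult bdd_nonneg_indicator S) auto
  have const: "bdd_nonneg (\<lambda>z::'a. y / 2)"
    using assms by (auto simp: bdd_nonneg_def intro: exI[of _ y])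
  obtain c l where *: "0 < l" "x \<in> ocube c l" "y < avg g c l"
    using assms less_mx_iff by blast
  have "(\<integral>z. g z * indicator (ocube c l) z \<partial>lebesgue)
    \<le> (\<integral>z. ?h z * indicator (ocube c l) z + (y / 2) * indicator (ocube c l) z \<partial>lebesgue)"
  proof (rule integral_mono)
    show "integrable lebesgue (\<lambda>z. ?h z * indicator (ocube c l) z + (y / 2) * indicator (ocube c l) z)"
      using h * const by (intro Bochner_Integration.integrable_add integrable_on_ocube) auto
    show "integrable lebesgue (\<lambda>z. g z * indicator (ocube c l) z)"
      using assms * by (simp add: integrable_on_ocube)
  qed (use assms in \<open>auto simp: indicator_def\<close>)
  also have "\<dots> = (\<integral>z. ?h z * indicator (ocube c l) z \<partial>lebesgue) + (y / 2) * l ^ DIM('a)"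
    using h * integrable_on_ocube[OF const, of l c]
    by (subst Bochner_Integration.integral_add)
       (simp_all add: integrable_on_ocube measure_ocube)
  finally have "avg g c l \<le> avg ?h c l + y / 2"
    using * by (simp add: avg_def field_simps)
  then have "y / 2 < avg ?h c l" using * by linarith
  also have "\<dots> \<le> mx ?h x" using h * by (intro avg_le_mx)
  finally show ?thesis .
qed

text \<open>Layer-cake formula, with the weak type bound applied at each height to the truncated
  function. After Tonelli, integrating \<open>y powr (q - 2)\<close> over \<open>y < 2 * g x\<close>
  yields the factor \<open>1 / (q - 1)\<close>. The explicit dependence on \<open>q\<close> is
  essential, since it enters the final constant.\<close>

lemma strong_type_mx:
  fixes g :: "'a::euclidean_space \<Rightarrow> real"
  assumes g: "bdd_nonneg g" and q: "1 < q"
  shows "(\<integral>\<^sup>+x. ennreal (mx g x powr q) \<partial>lebesgue)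
    \<le> ennreal (3 ^ DIM('a) * 2 powr q * conj_exp q) * (\<integral>\<^sup>+x. ennreal (g x powr q) \<partial>lebesgue)"
proof -
  interpret lebesgue: sigma_finite_measure "lebesgue :: 'a measure" by (rule sigma_finite_lebesgue)
  interpret pair_sigma_finite "lebesgue :: 'a measure" "lborel :: real measure" ..
  note [measurable] = bdd_nonneg_measurable[OF g] bdd_nonneg_measurable[OF bdd_nonneg_mx[OF g]]
  \<comment> \<open>\<open>q\<close> comes from the layer-cake formula, the power of 3 from the weak
    type bound, and 2 from using that bound at height \<open>y / 2\<close>.\<close>
  define K :: real where "K = 3 ^ DIM('a) * 2 * q"
  have "(\<integral>\<^sup>+x. ennreal (mx g x powr q) \<partial>lebesgue)
     = (\<integral>\<^sup>+x. \<integral>\<^sup>+y. ennreal (q * y powr (q - 1)) * indicator {y. 0 < y \<and> y < mx g x} y \<partial>lborel \<partial>lebesgue)"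
  proof (rule nn_integral_cong)
    fix x
    have "(\<integral>\<^sup>+y. ennreal (q * y powr (q - 1)) * indicator {y. 0 < y \<and> y < mx g x} y \<partial>lborel)
      = (\<integral>\<^sup>+y. ennreal q * (ennreal (y powr (q - 1)) * indicator {0<..<mx g x} y) \<partial>lborel)"
      using q by (intro nn_integral_cong) (auto simp: indicator_def ennreal_mult')
    also have "\<dots> = ennreal q * ennreal (mx g x powr (q - 1 + 1) / (q - 1 + 1))"
      using q mx_nonneg[OF g] by (subst nn_integral_cmult) (auto simp: nn_integral_powr_Ioo)
    also have "\<dots> = ennreal (mx g x powr q)"
      using q by (simp add: ennreal_mult'[symmetric])
    finally show "ennreal (mx g x powr q)
      = (\<integral>\<^sup>+y. ennreal (q * y powr (q - 1)) * indicator {y. 0 < y \<and> y < mx g x} y \<partial>lborel)" by simp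
  qed
  also have "\<dots> = (\<integral>\<^sup>+y. \<integral>\<^sup>+x. ennreal (q * y powr (q - 1)) * indicator {y. 0 < y \<and> y < mx g x} y \<partial>lebesgue \<partial>lborel)"
    by (rule Fubini'[symmetric]) measurable
  also have "\<dots> \<le> (\<integral>\<^sup>+y. \<integral>\<^sup>+x. ennreal (K * y powr (q - 2) * g x) * indicator {y. 0 < y \<and> y < 2 * g x} y \<partial>lebesgue \<partial>lborel)"
  proof (rule nn_integral_mono)
    fix y :: real
    show "(\<integral>\<^sup>+x. ennreal (q * y powr (q - 1)) * indicator {y. 0 < y \<and> y < mx g x} y \<partial>lebesgue)
      \<le> (\<integral>\<^sup>+x. ennreal (K * y powr (q - 2) * g x) * indicator {y. 0 < y \<and> y < 2 * g x} y \<partial>lebesgue)"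
    proof (cases "0 < y")
      case True
      let ?h = "\<lambda>z. g z * indicator {z. y / 2 < g z} z"
      have "{z \<in> space lebesgue. y / 2 < g z} \<in> sets lebesgue" by measurable
  then have S: "{z. y / 2 < g z} \<in> sets lebesgue" by simp
      have h: "bdd_nonneg ?h"
        using g by (intro bdd_nonneg_mult bdd_nonneg_indicator S) auto
      note [measurable] = bdd_nonneg_measurable[OF bdd_nonneg_mx[OF h]]
      have "(\<integral>\<^sup>+x. ennreal (q * y powr (q - 1)) * indicator {y. 0 < y \<and> y < mx g x} y \<partial>lebesgue)
         = (\<integral>\<^sup>+x. ennreal (q * y powr (q - 1)) * indicator {x. y < mx g x} x \<partial>lebesgue)"
        using True by (intro nn_integral_cong) (auto simp: indicator_def)
      also have "\<dots> = ennreal (q * y powr (q - 1)) * emeasure lebesgue {x. y < mx g x}"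
        using open_mx_gt[OF g] by (intro nn_integral_cmult_indicator) (simp add: borel_open)
      also have "\<dots> \<le> ennreal (q * y powr (q - 1)) * emeasure lebesgue {x. y / 2 < mx ?h x}"
      proof (intro mult_left_mono emeasure_mono)
        show "{x. y / 2 < mx ?h x} \<in> sets lebesgue"
          using open_mx_gt[OF h] by (metis borel_open sets_completionI_sets sets_lborel)
      qed (use mx_le_truncated[OF g True] in auto)
      \<comment> \<open>Splits off the factor \<open>y / 2\<close> that the weak type bound at this
        height consumes.\<close>
      also have "\<dots> = ennreal (2 * q * y powr (q - 2)) * (ennreal (y / 2) * emeasure lebesgue {x. y / 2 < mx ?h x})"
      proof -
        have "y powr (q - 1) = y powr (q - 2) * y"
          using True by (simp add: powr_mult_base' mult.commute powr_mult_base)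
        have "q * y powr (q - 1) = (2 * q * y powr (q - 2)) * (y / 2)"
          using \<open>y powr (q - 1) = _\<close> by simp
        also have "ennreal \<dots> = ennreal (2 * q * y powr (q - 2)) * ennreal (y / 2)"
          using True q by (intro ennreal_mult) auto
        finally show ?thesis by (simp only: mult.assoc)
      qed
      also have "\<dots> \<le> ennreal (2 * q * y powr (q - 2)) * (3 ^ DIM('a) * (\<integral>\<^sup>+x. ennreal (?h x) \<partial>lebesgue))"
        using weak_type_mx[OF h, of "y / 2"] True by (intro mult_left_mono) auto
      also have "\<dots> = ennreal (K * y powr (q - 2)) * (\<integral>\<^sup>+x. ennreal (?h x) \<partial>lebesgue)"
        unfolding mult.assoc[symmetric]
        using q by (intro arg_cong2[of _ _ _ _ "(*)"]) (simp_all add: K_def ennreal_mult ennreal_power[symmetric] mult_ac)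
      also have "\<dots> = (\<integral>\<^sup>+x. ennreal (K * y powr (q - 2)) * ennreal (?h x) \<partial>lebesgue)"
        by (rule nn_integral_cmult[symmetric]) measurable
      also have "\<dots> = (\<integral>\<^sup>+x. ennreal (K * y powr (q - 2) * g x) * indicator {y. 0 < y \<and> y < 2 * g x} y \<partial>lebesgue)"
        using True q bdd_nonneg_ge0[OF g] by (intro nn_integral_cong) (auto simp: indicator_def ennreal_mult'' K_def)
      finally show ?thesis .
    qed auto
  qed
  also have "\<dots> = (\<integral>\<^sup>+x. \<integral>\<^sup>+y. ennreal (K * y powr (q - 2) * g x) * indicator {y. 0 < y \<and> y < 2 * g x} y \<partial>lborel \<partial>lebesgue)"
    by (rule Fubini') measurable
  also have "\<dots> = (\<integral>\<^sup>+x. ennreal (3 ^ DIM('a) * 2 powr q * conj_exp q) * ennreal (g x powr q) \<partial>lebesgue)"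
  proof (rule nn_integral_cong)
    fix x
    have gx: "0 \<le> g x" using g by (simp add: bdd_nonneg_def)
    have "(\<integral>\<^sup>+y. ennreal (K * y powr (q - 2) * g x) * indicator {y. 0 < y \<and> y < 2 * g x} y \<partial>lborel)
      = (\<integral>\<^sup>+y. ennreal (K * g x) * (ennreal (y powr (q - 2)) * indicator {0<..<2 * g x} y) \<partial>lborel)"
      using q gx by (intro nn_integral_cong) (auto simp: indicator_def ennreal_mult'[symmetric] K_def mult_ac)
    also have "\<dots> = ennreal (K * g x) * ennreal ((2 * g x) powr (q - 2 + 1) / (q - 2 + 1))"
      using q gx by (subst nn_integral_cmult) (auto simp: nn_integral_powr_Ioo)
    also have "\<dots> = ennreal (K * g x * ((2 * g x) powr (q - 1) / (q - 1)))"
      using q gx by (subst ennreal_mult[symmetric]) (simp_all add: K_def)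
    also have "K * g x * ((2 * g x) powr (q - 1) / (q - 1)) = 3 ^ DIM('a) * 2 powr q * conj_exp q * g x powr q"
    proof -
      have "g x powr q = g x * g x powr (q - 1)" "2 powr q = 2 * (2::real) powr (q - 1)"
        using gx by (simp_all add: powr_mult_base)
      then show ?thesis by (simp add: K_def conj_exp_def powr_mult)
    qed
    finally show "(\<integral>\<^sup>+y. ennreal (K * y powr (q - 2) * g x) * indicator {y. 0 < y \<and> y < 2 * g x} y \<partial>lborel)
      = ennreal (3 ^ DIM('a) * 2 powr q * conj_exp q) * ennreal (g x powr q)"
      by (simp add: ennreal_mult'')
  qed
  also have "\<dots> = ennreal (3 ^ DIM('a) * 2 powr q * conj_exp q) * (\<integral>\<^sup>+x. ennreal (g x powr q) \<partial>lebesgue)"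
    by (rule nn_integral_cmult) measurable
  finally show ?thesis .
qed

section \<open>Hoelder and Jensen inequalities for averages\<close>

lemma avg_cmult: "avg (\<lambda>x. k * f x) c l = k * avg f c l"
  by (simp add: avg_def mult.assoc)

lemma avg_add:
  assumes "bdd_nonneg f" "bdd_nonneg g" "0 < l"
  shows "avg (\<lambda>x. f x + g x) c l = avg f c l + avg g c l"
  using assms by (simp add: avg_def distrib_right integrable_on_ocube add_divide_distrib)

lemma avg_const: "0 < l \<Longrightarrow> avg (\<lambda>x. k) c l = k"
  by (simp add: avg_def measure_ocube)

lemma bdd_nonneg_cmult: "bdd_nonneg f \<Longrightarrow> 0 \<le> k \<Longrightarrow> bdd_nonneg (\<lambda>x. k * f x)"
  by (rule bdd_nonneg_mult) (auto simp: bdd_nonneg_def)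

lemma bdd_nonneg_add:
  assumes "bdd_nonneg f" "bdd_nonneg g"
  shows "bdd_nonneg (\<lambda>x. f x + g x)"
proof -
  have [measurable]: "f \<in> borel_measurable lebesgue" "g \<in> borel_measurable lebesgue"
    using assms by (auto simp: bdd_nonneg_def)
  obtain A B where A: "\<And>x. f x \<le> A" and B: "\<And>x. g x \<le> B" using assms by (auto simp: bdd_nonneg_def)
  have "f x + g x \<le> A + B" for x
    using A[of x] B[of x] by simp
  then show ?thesis using assms by (auto simp: bdd_nonneg_def)
qed

text \<open>Pointwise weighted Young inequality for \<open>f\<close> and \<open>g\<close>, each
  divided by its average: taking averages turns the right-hand side into
  \<open>\<theta> + (1 - \<theta>) = 1\<close>.\<close>

lemma avg_Holder:
  assumes f: "bdd_nonneg f" and g: "bdd_nonneg g" and "0 < l" and th: "0 < \<theta>" "\<theta> < 1"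
  shows "avg (\<lambda>x. f x powr \<theta> * g x powr (1 - \<theta>)) c l \<le> avg f c l powr \<theta> * avg g c l powr (1 - \<theta>)"
proof -
  let ?A = "avg f c l" and ?B = "avg g c l"
  have nn: "0 \<le> ?A" "0 \<le> ?B" using assms by (auto intro: avg_nonneg)
  \<comment> \<open>The perturbation by \<open>e\<close> covers the case of a vanishing average.\<close>
  have *: "avg (\<lambda>x. f x powr \<theta> * g x powr (1 - \<theta>)) c l \<le> (?A + e) powr \<theta> * (?B + e) powr (1 - \<theta>)"
    if e: "0 < e" for e
  proof -
    define T K where "T = ?A + e" and "K = ?B + e"
    have pos: "0 < T" "0 < K" using nn e by (auto simp: T_def K_def)
    have 1: "f x powr \<theta> * g x powr (1 - \<theta>)
        \<le> (T powr \<theta> * K powr (1 - \<theta>)) * ((\<theta> / T) * f x + ((1 - \<theta>) / K) * g x)" for x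
    proof -
      have "(f x / T) powr \<theta> * (g x / K) powr (1 - \<theta>) \<le> \<theta> * (f x / T) + (1 - \<theta>) * (g x / K)"
      proof (cases "f x = 0 \<or> g x = 0")
        case True
        then show ?thesis
          using th pos bdd_nonneg_ge0[OF f] bdd_nonneg_ge0[OF g] by auto
      next
        case False
        then show ?thesis
          using th pos bdd_nonneg_ge0[OF f, of x] bdd_nonneg_ge0[OF g, of x]
          by (intro Youngs_inequality_0) auto
      qed
      then have "(T powr \<theta> * K powr (1 - \<theta>)) * ((f x / T) powr \<theta> * (g x / K) powr (1 - \<theta>))
        \<le> (T powr \<theta> * K powr (1 - \<theta>)) * (\<theta> * (f x / T) + (1 - \<theta>) * (g x / K))"
        using pos by (intro mult_left_mono) auto
      then show ?thesis using pos by (simp add: powr_divide)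
    qed
    have bn: "bdd_nonneg (\<lambda>x. (\<theta> / T) * f x)" "bdd_nonneg (\<lambda>x. ((1 - \<theta>) / K) * g x)"
      using f g th pos by (intro bdd_nonneg_cmult; simp)+
    have "avg (\<lambda>x. f x powr \<theta> * g x powr (1 - \<theta>)) c l
      \<le> avg (\<lambda>x. (T powr \<theta> * K powr (1 - \<theta>)) * ((\<theta> / T) * f x + ((1 - \<theta>) / K) * g x)) c l"
      using 1 assms bn pos by (intro avg_mono bdd_nonneg_mult[OF bdd_nonneg_powr bdd_nonneg_powr]
          bdd_nonneg_cmult bdd_nonneg_add) auto
    also have "\<dots> = (T powr \<theta> * K powr (1 - \<theta>)) * ((\<theta> / T) * ?A + ((1 - \<theta>) / K) * ?B)"
      using bn \<open>0 < l\<close> by (simp only: avg_cmult avg_add)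
    also have "\<dots> \<le> (T powr \<theta> * K powr (1 - \<theta>)) * 1"
    proof (rule mult_left_mono)
      have "(\<theta> / T) * ?A \<le> \<theta>" "((1 - \<theta>) / K) * ?B \<le> 1 - \<theta>"
        using th pos e nn by (auto simp: field_simps T_def K_def)
      then show "(\<theta> / T) * ?A + ((1 - \<theta>) / K) * ?B \<le> 1" by linarith
    qed auto
    finally show ?thesis by (simp add: T_def K_def)
  qed
  have "((\<lambda>e. (?A + e) powr \<theta> * (?B + e) powr (1 - \<theta>)) \<longlongrightarrow> (?A + 0) powr \<theta> * (?B + 0) powr (1 - \<theta>)) (at_right 0)"
    using nn th
    by (intro tendsto_intros tendsto_powr') (auto simp: eventually_at_filter intro!: always_eventually)
  then have "avg (\<lambda>x. f x powr \<theta> * g x powr (1 - \<theta>)) c l \<le> (?A + 0) powr \<theta> * (?B + 0) powr (1 - \<theta>)"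
    by (rule tendsto_lowerbound) (use * in \<open>auto simp: eventually_at_right_less eventually_at_filter\<close>)
  then show ?thesis by simp
qed

text \<open>Hoelder against the constant 1 with exponent \<open>1 / t\<close>; the endpoint
  \<open>t = 1\<close> is separate because \<open>avg_Holder\<close> wants an exponent below
  1.\<close>

lemma avg_Jensen:
  assumes w: "bdd_nonneg w" and "0 < l" "1 \<le> t"
  shows "avg w c l \<le> avg (\<lambda>x. w x powr t) c l powr (1 / t)"
proof (cases "t = 1")
  case True
  then show ?thesis using assms avg_nonneg[OF w \<open>0 < l\<close>] by (simp add: bdd_nonneg_ge0)
next
  case False
  with assms have t: "1 < t" by simp
  have "avg (\<lambda>x. (w x powr t) powr (1 / t) * 1 powr (1 - 1 / t)) c l
    \<le> avg (\<lambda>x. w x powr t) c l powr (1 / t) * avg (\<lambda>x. 1) c l powr (1 - 1 / t)"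
    using assms t by (intro avg_Holder bdd_nonneg_powr) (auto simp: bdd_nonneg_def)
  then show ?thesis
    using t assms by (simp add: powr_powr avg_const bdd_nonneg_ge0)
qed

section \<open>Stopping cubes\<close>

text \<open>Half-open, so that the dyadic cubes of one generation partition the space exactly,
  without exceptional boundaries.\<close>

definition hcube :: "'a::euclidean_space \<Rightarrow> real \<Rightarrow> 'a set" where
  "hcube c l = {y. \<forall>i\<in>Basis. c \<bullet> i \<le> y \<bullet> i \<and> y \<bullet> i < c \<bullet> i + l}"

lemma ocube_subset_hcube: "ocube c l \<subseteq> hcube c l"
  by (auto simp: mem_ocube hcube_def less_imp_le)

lemma hcube_subset_cube: "hcube c l \<subseteq> cbox c (c + l *\<^sub>R One)"
  by (auto simp: hcube_def mem_box inner_simps less_imp_le)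

lemma hcube_subset_triple: "0 < l \<Longrightarrow> hcube c l \<subseteq> ocube (c - l *\<^sub>R One) (3 * l)"
  using hcube_subset_cube cube_subset_triple by blast

lemma borel_hcube: "hcube c l \<in> sets borel"
proof -
  have "hcube c l = (\<Inter>i\<in>Basis. {y. c \<bullet> i \<le> y \<bullet> i} \<inter> {y. y \<bullet> i < c \<bullet> i + l})"
    by (auto simp: hcube_def)
  moreover have "{y. c \<bullet> i \<le> y \<bullet> i} \<in> sets borel" "{y. y \<bullet> i < c \<bullet> i + l} \<in> sets borel" for i
    by measurable
  ultimately show ?thesis by (auto intro!: sets.finite_INT)
qed

lemma sets_hcube [measurable]: "hcube c l \<in> sets lebesgue"
  by (metis borel_hcube sets_completionI_sets sets_lborel)

lemma emeasure_hcube: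
  assumes "0 \<le> l"
  shows "emeasure lebesgue (hcube (c::'a::euclidean_space) l) = ennreal (l ^ DIM('a))"
proof (rule antisym)
  have "emeasure lebesgue (hcube c l) \<le> emeasure lebesgue (cbox c (c + l *\<^sub>R One))"
    by (intro emeasure_mono hcube_subset_cube) auto
  then show "emeasure lebesgue (hcube c l) \<le> ennreal (l ^ DIM('a))"
    using emeasure_cube[OF assms] by metis
  have "emeasure lebesgue (ocube c l) \<le> emeasure lebesgue (hcube c l)"
    by (intro emeasure_mono ocube_subset_hcube) auto
  then show "ennreal (l ^ DIM('a)) \<le> emeasure lebesgue (hcube c l)"
    using emeasure_ocube[OF assms] by metis
qed

text \<open>The dyadic cube of side \<open>L / 2 ^ k\<close> around \<open>x\<close>, indexed by a
  point instead of a lattice vector. Being in the same cell is equality of floors, hence an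
  equivalence relation, which makes disjointness and nesting immediate.\<close>

definition cell :: "real \<Rightarrow> nat \<Rightarrow> 'a::euclidean_space \<Rightarrow> 'a set" where
  "cell L k x = {y. \<forall>i\<in>Basis. \<lfloor>2 ^ k * (y \<bullet> i) / L\<rfloor> = \<lfloor>2 ^ k * (x \<bullet> i) / L\<rfloor>}"

definition corner :: "real \<Rightarrow> nat \<Rightarrow> 'a::euclidean_space \<Rightarrow> 'a" where
  "corner L k x = (\<Sum>i\<in>Basis. (L / 2 ^ k * of_int \<lfloor>2 ^ k * (x \<bullet> i) / L\<rfloor>) *\<^sub>R i)"

lemma cell_eq_hcube:
  assumes "0 < L"
  shows "cell L k x = hcube (corner L k x) (L / 2 ^ k)"
proof -
  have "\<lfloor>2 ^ k * b / L\<rfloor> = m \<longleftrightarrow> L / 2 ^ k * of_int m \<le> b \<and> b < L / 2 ^ k * of_int m + L / 2 ^ k" for b m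
    using assms by (simp add: floor_eq_iff field_simps)
  then show ?thesis
    by (simp add: cell_def hcube_def corner_def)
qed

lemma cell_refl: "x \<in> cell L k x"
  by (simp add: cell_def)

lemma cell_eq: "y \<in> cell L k x \<Longrightarrow> cell L k y = cell L k x"
  by (auto simp: cell_def)

lemma corner_eq: "y \<in> cell L k x \<Longrightarrow> corner L k y = corner L k x"
  by (simp add: cell_def corner_def)

text \<open>The floor of \<open>2 * a\<close> is twice the floor of \<open>a\<close>, or one more;
  so it determines the floor of \<open>a\<close>.\<close>

lemma cell_Suc_subset: "cell L (Suc k) x \<subseteq> cell L k x"
proof -
  have "2 * \<lfloor>a\<rfloor> \<le> \<lfloor>2 * a\<rfloor> \<and> \<lfloor>2 * a\<rfloor> < 2 * \<lfloor>a\<rfloor> + 2" for a :: real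
    using floor_correct[of a] by (simp add: le_floor_iff floor_less_iff) linarith
  then have half: "\<lfloor>a\<rfloor> = \<lfloor>b\<rfloor>" if "\<lfloor>2 * a\<rfloor> = \<lfloor>2 * b\<rfloor>" for a b :: real
    using that by smt
  have "\<lfloor>2 ^ k * (y \<bullet> i) / L\<rfloor> = \<lfloor>2 ^ k * (x \<bullet> i) / L\<rfloor>"
    if "\<lfloor>2 ^ Suc k * (y \<bullet> i) / L\<rfloor> = \<lfloor>2 ^ Suc k * (x \<bullet> i) / L\<rfloor>" for y i
    by (rule half) (use that in \<open>simp add: mult.assoc\<close>)
  then show ?thesis unfolding cell_def by blast
qed

lemma cell_antimono: "j \<le> k \<Longrightarrow> cell L k x \<subseteq> cell L j x"
  by (induction k rule: dec_induct) (use cell_Suc_subset in blast)+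

lemma small_cell_subset:
  assumes "0 < L" "open V" "x \<in> V"
  shows "\<exists>k. cell L k x \<subseteq> V"
proof -
  obtain e where e: "0 < e" "ball x e \<subseteq> V" using assms open_contains_ball by blast
  obtain k where k: "(1/2) ^ k < e / (L * DIM('a))"
    using real_arch_pow_inv[of "e / (L * DIM('a))" "1/2"] e assms by auto
  have "cell L k x \<subseteq> ball x e"
  proof
    fix y assume y: "y \<in> cell L k x"
    have "\<bar>(x - y) \<bullet> i\<bar> \<le> L / 2 ^ k" if "i \<in> Basis" for i
    proof -
      have "x \<in> hcube (corner L k x) (L / 2 ^ k)" "y \<in> hcube (corner L k x) (L / 2 ^ k)"
        using y cell_refl[of x L k] by (simp_all add: cell_eq_hcube[OF assms(1)])
      then have "corner L k x \<bullet> i \<le> x \<bullet> i" "x \<bullet> i < corner L k x \<bullet> i + L / 2 ^ k"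
        "corner L k x \<bullet> i \<le> y \<bullet> i" "y \<bullet> i < corner L k x \<bullet> i + L / 2 ^ k"
        using that unfolding hcube_def by blast+
      then show ?thesis unfolding inner_diff_left by linarith
    qed
    then have "(\<Sum>i\<in>Basis. \<bar>(x - y) \<bullet> i\<bar>) \<le> DIM('a) * (L / 2 ^ k)"
      by (intro sum_bounded_above) auto
    moreover have "DIM('a) * (L / 2 ^ k) < e"
      using k assms by (simp add: field_simps power_one_over)
    ultimately show "y \<in> ball x e"
      using norm_le_l1[of "x - y"] by (simp add: dist_norm)
  qed
  then show ?thesis using e by blast
qed

text \<open>Each point that satisfies \<open>Pr\<close> at some level is assigned its cell at the
  first such level. Nesting makes two such cells equal or disjoint. The predicate is arbitrary
  because the selection serves twice: for cubes with large mean, and for tiling an open set by small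
  cells.\<close>

lemma stopping_cells:
  fixes Pr :: "nat \<Rightarrow> 'a::euclidean_space \<Rightarrow> bool"
  assumes "0 < L" and Pr_cong: "\<forall>k x y. y \<in> cell L k x \<longrightarrow> Pr k x \<longrightarrow> Pr k y"
  shows "\<exists>T. countable T \<and> disjoint_family_on (\<lambda>(c, l). hcube c l) T \<and>
    {x. \<exists>k. Pr k x} = (\<Union>(c, l)\<in>T. hcube c l) \<and>
    (\<forall>c l. (c, l) \<in> T \<longrightarrow> (\<exists>k x. Pr k x \<and> (\<forall>j<k. \<not> Pr j x) \<and> c = corner L k x \<and> l = L / 2 ^ k))"
proof -
  have Pr: "Pr k y" if "y \<in> cell L k x" "Pr k x" for k x y
    using Pr_cong that by blast
  define A where "A = {x. \<exists>k. Pr k x}"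
  define n where "n x = (LEAST k. Pr k x)" for x
  define f where "f x = (corner L (n x) x, L / 2 ^ n x)" for x
  have n: "Pr (n x) x" if "x \<in> A" for x
    using that LeastI_ex[of "\<lambda>k. Pr k x"] by (simp add: A_def n_def)
  have nlt: "\<not> Pr j x" if "j < n x" for x j
    using that not_less_Least by (auto simp: n_def)
  \<comment> \<open>If the finer of two selected cells meets the coarser one, it lies inside it. So
    \<open>x'\<close> shares the cell of \<open>x\<close>, on which \<open>Pr\<close> already holds,
    and cannot stop later than \<open>x\<close>.\<close>
  have key: "n x' \<le> n x \<and> x' \<in> cell L (n x) x"
    if "x \<in> A" "z \<in> cell L (n x) x" "z \<in> cell L (n x') x'" "n x \<le> n x'" for x x' z
  proof -
    have "x' \<in> cell L (n x') z" using that cell_eq cell_refl by metis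
    then have "x' \<in> cell L (n x) z" using that(4) cell_antimono by blast
    then have *: "x' \<in> cell L (n x) x" using that cell_eq by metis
    then have "Pr (n x) x'" using Pr n that by blast
    then show ?thesis using * by (simp add: n_def Least_le)
  qed
  have key2: "f x = f x'"
    if "x \<in> A" "x' \<in> A" "z \<in> cell L (n x) x" "z \<in> cell L (n x') x'" for x x' z
  proof (cases "n x \<le> n x'")
    case True
    then show ?thesis using key[OF that(1,3,4)] corner_eq by (fastforce simp: f_def)
  next
    case False
    then show ?thesis using key[OF that(2,4,3)] by simp
  qed
  have hc: "(case f x of (c, l) \<Rightarrow> hcube c l) = cell L (n x) x" for x
    by (simp add: f_def cell_eq_hcube[OF assms(1)])
  have dis: "disjoint_family_on (\<lambda>(c, l). hcube c l) (f ` A)"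
    unfolding disjoint_family_on_def
  proof (intro ballI impI)
    fix p p' assume p: "p \<in> f ` A" "p' \<in> f ` A" "p \<noteq> p'"
    obtain x where x: "x \<in> A" "p = f x" using p(1) by blast
    obtain x' where x': "x' \<in> A" "p' = f x'" using p(2) by blast
    have "z \<notin> cell L (n x') x'" if "z \<in> cell L (n x) x" for z
      using key2[OF x(1) x'(1) that] p(3) unfolding x(2) x'(2) by blast
    then have "cell L (n x) x \<inter> cell L (n x') x' = {}" by blast
    then show "(case p of (c, l) \<Rightarrow> hcube c l) \<inter> (case p' of (c, l) \<Rightarrow> hcube c l) = {}"
      unfolding x(2) x'(2) hc .
  qed
  have ne: "ocube c l \<noteq> {}" if "(c, l) \<in> f ` A" for c l
    using that assms(1) by (auto simp: f_def intro!: ocube_ne)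
  have sub: "(case p of (c, l) \<Rightarrow> ocube c l) \<subseteq> (case p of (c, l) \<Rightarrow> hcube c l)" for p :: "'a \<times> real"
    using ocube_subset_hcube by (cases p) auto
  have disj': "(case p of (c, l) \<Rightarrow> ocube c l) \<inter> (case p' of (c, l) \<Rightarrow> ocube c l) = {}"
    if "p \<in> f ` A" "p' \<in> f ` A" "p \<noteq> p'" for p p'
    using Int_mono[OF sub[of p] sub[of p']] disjoint_family_onD[OF dis that] by (metis subset_empty)
  \<comment> \<open>Countability is read off the interiors: they are nonempty, open and pairwise
    disjoint in a second countable space.\<close>
  have "countable ((\<lambda>(c, l). ocube c l) ` (f ` A))"
  proof (rule countable_disjoint_open_subsets)
    show "pairwise disjnt ((\<lambda>(c, l). ocube c l) ` (f ` A))"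
    proof (rule pairwiseI)
      fix S S' assume *: "S \<in> (\<lambda>(c, l). ocube c l) ` (f ` A)" "S' \<in> (\<lambda>(c, l). ocube c l) ` (f ` A)" "S \<noteq> S'"
      obtain p where p: "p \<in> f ` A" "S = (case p of (c, l) \<Rightarrow> ocube c l)" using *(1) by (rule imageE)
      obtain p' where p': "p' \<in> f ` A" "S' = (case p' of (c, l) \<Rightarrow> ocube c l)" using *(2) by (rule imageE)
      have "p \<noteq> p'" using *(3) p(2) p'(2) by metis
      then show "disjnt S S'"
        unfolding disjnt_def p(2) p'(2) by (intro disj' p(1) p'(1))
    qed
    fix S assume "S \<in> (\<lambda>(c, l). ocube c l) ` (f ` A)"
    then obtain p where "S = (case p of (c, l) \<Rightarrow> ocube c l)" by (rule imageE)
    then show "open S" by (cases p) (simp add: open_ocube)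
  qed
  moreover have "inj_on (\<lambda>(c, l). ocube c l) (f ` A)"
  proof (rule inj_onI, rule ccontr)
    fix p p' assume *: "p \<in> f ` A" "p' \<in> f ` A" "p \<noteq> p'"
      "(case p of (c, l) \<Rightarrow> ocube c l) = (case p' of (c, l) \<Rightarrow> ocube c l)"
    have "(case p of (c, l) \<Rightarrow> ocube c l) = {}"
      using disj'[OF *(1-3)] *(4) by simp
    then show False using ne *(1) by (cases p) auto
  qed
  ultimately have "countable (f ` A)" using countable_image_inj_on by blast
  moreover have "{x. \<exists>k. Pr k x} = (\<Union>(c, l)\<in>f ` A. hcube c l)"
  proof (rule set_eqI, rule iffI)
    fix x assume "x \<in> {x. \<exists>k. Pr k x}"
    then have "x \<in> A" by (simp add: A_def)
    moreover have "x \<in> (case f x of (c, l) \<Rightarrow> hcube c l)"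
      unfolding hc by (rule cell_refl)
    ultimately show "x \<in> (\<Union>(c, l)\<in>f ` A. hcube c l)" by (meson UN_I imageI)
  next
    fix x assume "x \<in> (\<Union>(c, l)\<in>f ` A. hcube c l)"
    then obtain a where a: "a \<in> A" "x \<in> (case f a of (c, l) \<Rightarrow> hcube c l)" by (elim UN_E imageE) simp
    then have "Pr (n a) x" unfolding hc by (intro Pr[OF _ n])
    then show "x \<in> {x. \<exists>k. Pr k x}" by blast
  qed
  moreover have "\<exists>k x. Pr k x \<and> (\<forall>j<k. \<not> Pr j x) \<and> c = corner L k x \<and> l = L / 2 ^ k"
    if cl: "(c, l) \<in> f ` A" for c l
  proof -
    obtain x where "x \<in> A" "(c, l) = f x" using cl by blast
    then show ?thesis using n[of x] nlt[of _ x] by (auto simp: f_def)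
  qed
  ultimately show ?thesis using dis by (intro exI[of _ "f ` A"] conjI allI impI)
qed

section \<open>Calderon-Zygmund decomposition\<close>

lemma nn_integral_UN_countable:
  assumes "countable T" "disjoint_family_on X T" "\<And>i. i \<in> T \<Longrightarrow> X i \<in> sets M" "f \<in> borel_measurable M"
  shows "(\<integral>\<^sup>+x. f x * indicator (\<Union>i\<in>T. X i) x \<partial>M) = (\<integral>\<^sup>+i. (\<integral>\<^sup>+x. f x * indicator (X i) x \<partial>M) \<partial>count_space T)"
proof -
  have "emeasure (density M f) (\<Union>i\<in>T. X i) = (\<integral>\<^sup>+i. emeasure (density M f) (X i) \<partial>count_space T)"
    using assms by (intro emeasure_UN_countable) auto
  moreover have "(\<Union>i\<in>T. X i) \<in> sets M" using assms by (intro sets.countable_UN') auto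
  ultimately show ?thesis
    using assms by (simp add: emeasure_density cong: nn_integral_cong_simp)
qed

lemma nn_integral_UN_mono:
  assumes "countable T" "disjoint_family_on X T" "\<And>i. i \<in> T \<Longrightarrow> X i \<in> sets M"
    "f \<in> borel_measurable M" "g \<in> borel_measurable M"
    "\<And>i. i \<in> T \<Longrightarrow> (\<integral>\<^sup>+x. f x * indicator (X i) x \<partial>M) \<le> (\<integral>\<^sup>+x. g x * indicator (X i) x \<partial>M)"
  shows "(\<integral>\<^sup>+x. f x * indicator (\<Union>i\<in>T. X i) x \<partial>M) \<le> (\<integral>\<^sup>+x. g x * indicator (\<Union>i\<in>T. X i) x \<partial>M)"
proof -
  have "(\<integral>\<^sup>+x. f x * indicator (\<Union>i\<in>T. X i) x \<partial>M) = (\<integral>\<^sup>+i. (\<integral>\<^sup>+x. f x * indicator (X i) x \<partial>M) \<partial>count_space T)"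
    by (rule nn_integral_UN_countable[OF assms(1-4)])
  also have "\<dots> \<le> (\<integral>\<^sup>+i. (\<integral>\<^sup>+x. g x * indicator (X i) x \<partial>M) \<partial>count_space T)"
    by (rule nn_integral_mono) (use assms(6) in simp)
  also have "\<dots> = (\<integral>\<^sup>+x. g x * indicator (\<Union>i\<in>T. X i) x \<partial>M)"
    by (rule nn_integral_UN_countable[OF assms(1-3,5), symmetric])
  finally show ?thesis .
qed

text \<open>Cells are stopped at the first generation where the mean exceeds 1. A stopped cell has
  an unstopped parent of twice its side, which gives the factor \<open>2 ^ DIM('a)\<close> in the
  upper bound.\<close>

lemma Calderon_Zygmund:
  fixes \<phi> :: "'a::euclidean_space \<Rightarrow> ennreal"
  assumes [measurable]: "\<phi> \<in> borel_measurable lebesgue" and fin: "(\<integral>\<^sup>+x. \<phi> x \<partial>lebesgue) < \<infinity>"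
  obtains T where "countable T" "\<And>c l. (c, l) \<in> T \<Longrightarrow> 0 < l"
    "disjoint_family_on (\<lambda>(c, l). hcube c l) T"
    "\<And>c l. (c, l) \<in> T \<Longrightarrow> ennreal (l ^ DIM('a)) \<le> (\<integral>\<^sup>+x. \<phi> x * indicator (hcube c l) x \<partial>lebesgue)"
    "\<And>c l. (c, l) \<in> T \<Longrightarrow> (\<integral>\<^sup>+x. \<phi> x * indicator (hcube c l) x \<partial>lebesgue) \<le> ennreal (2 ^ DIM('a) * l ^ DIM('a))"
    "AE x in lebesgue. x \<notin> (\<Union>(c, l)\<in>T. hcube c l) \<longrightarrow> \<phi> x \<le> 1"
proof -
  \<comment> \<open>With this side no cell of generation 0 is stopped, so every stopped cell has a
    parent. Adding 1 ensures \<open>L \<ge> 1\<close>, and then \<open>L\<close> is at most its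
    power \<open>L ^ DIM('a)\<close>, the volume of the cell.\<close>
  define L where "L = enn2real (\<integral>\<^sup>+x. \<phi> x \<partial>lebesgue) + 1"
  have L: "1 \<le> L" "0 < L" by (auto simp: L_def add_nonneg_pos)
  have "(\<integral>\<^sup>+x. \<phi> x \<partial>lebesgue) \<le> ennreal L"
    using fin by (cases "\<integral>\<^sup>+x. \<phi> x \<partial>lebesgue") (auto simp: L_def intro: ennreal_leI)
  also have "\<dots> \<le> ennreal (L ^ DIM('a))"
    using L by (intro ennreal_leI self_le_power) auto
  finally have tot: "(\<integral>\<^sup>+x. \<phi> x \<partial>lebesgue) \<le> ennreal (L ^ DIM('a))" .
  define I where "I A = (\<integral>\<^sup>+x. \<phi> x * indicator A x \<partial>lebesgue)" for A
  have I_mono: "I A \<le> I B" if "A \<subseteq> B" for A B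
    using that unfolding I_def by (intro nn_integral_mono mult_left_mono) (auto simp: indicator_def)
  define Pr where "Pr k x \<longleftrightarrow> ennreal ((L / 2 ^ k) ^ DIM('a)) < I (cell L k x)" for k x
  have Pr0: "\<not> Pr 0 x" for x
  proof -
    have "I (cell L 0 x) \<le> (\<integral>\<^sup>+x. \<phi> x \<partial>lebesgue)"
      unfolding I_def by (intro nn_integral_mono) (auto simp: indicator_def)
    then show ?thesis using tot by (simp add: Pr_def)
  qed
  have PrSuc: "I (cell L (Suc k) x) \<le> ennreal (2 ^ DIM('a) * (L / 2 ^ Suc k) ^ DIM('a))" if "\<not> Pr k x" for k x
  proof -
    have "I (cell L (Suc k) x) \<le> I (cell L k x)" by (intro I_mono cell_Suc_subset)
    also have "\<dots> \<le> ennreal ((L / 2 ^ k) ^ DIM('a))" using that by (simp add: Pr_def)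
    also have "(L / 2 ^ k) ^ DIM('a) = 2 ^ DIM('a) * (L / 2 ^ Suc k) ^ DIM('a)"
      by (simp add: power_mult_distrib[symmetric])
    finally show ?thesis .
  qed
  have Pr_cong: "\<forall>k x y. y \<in> cell L k x \<longrightarrow> Pr k x \<longrightarrow> Pr k y"
    using cell_eq by (metis Pr_def)
  obtain T where T: "countable T" "disjoint_family_on (\<lambda>(c, l). hcube c l) T"
    "{x. \<exists>k. Pr k x} = (\<Union>(c, l)\<in>T. hcube c l)"
    "\<forall>c l. (c, l) \<in> T \<longrightarrow> (\<exists>k x. Pr k x \<and> (\<forall>j<k. \<not> Pr j x) \<and> c = corner L k x \<and> l = L / 2 ^ k)"
    using stopping_cells[of L Pr, OF L(2) Pr_cong] by (elim exE conjE) (rule that)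
  have T': "0 < l \<and> ennreal (l ^ DIM('a)) \<le> I (hcube c l) \<and> I (hcube c l) \<le> ennreal (2 ^ DIM('a) * l ^ DIM('a))"
    if cl: "(c, l) \<in> T" for c l
  proof -
    obtain k x where k: "Pr k x" "\<forall>j<k. \<not> Pr j x" "c = corner L k x" "l = L / 2 ^ k"
      using T(4) cl by blast
    then obtain j where "k = Suc j" using Pr0 by (cases k) auto
    then have "I (cell L k x) \<le> ennreal (2 ^ DIM('a) * (L / 2 ^ k) ^ DIM('a))"
      using k PrSuc by blast
    then show ?thesis using k L by (simp add: Pr_def cell_eq_hcube less_imp_le)
  qed
  define \<Omega> where "\<Omega> = (\<Union>(c, l)\<in>T. hcube c l)"
  have [measurable]: "\<Omega> \<in> sets lebesgue"
    unfolding \<Omega>_def using T(1) by (intro sets.countable_UN') auto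
  define A where "A = {x \<in> space lebesgue. x \<notin> \<Omega> \<and> 1 < \<phi> x}"
  have [measurable]: "A \<in> sets lebesgue" unfolding A_def by measurable
  \<comment> \<open>Small cells around points of \<open>A\<close> are not stopped, so the mean of \<open>\<phi>\<close> on them is at most 1. Tiling an
    open neighbourhood of \<open>A\<close> with them replaces the differentiation theorem.\<close>
  have IV: "I A \<le> emeasure lebesgue V" if V: "open V" "A \<subseteq> V" for V
  proof -
    define Pr' where "Pr' k x \<longleftrightarrow> cell L k x \<subseteq> V \<and> (\<exists>a\<in>A. a \<in> cell L k x)" for k x
    have Pr'_cong: "\<forall>k x y. y \<in> cell L k x \<longrightarrow> Pr' k x \<longrightarrow> Pr' k y"
      using cell_eq by (metis Pr'_def)
    obtain T' where T': "countable T'" "disjoint_family_on (\<lambda>(c, l). hcube c l) T'"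
      "{x. \<exists>k. Pr' k x} = (\<Union>(c, l)\<in>T'. hcube c l)"
      "\<forall>c l. (c, l) \<in> T' \<longrightarrow> (\<exists>k x. Pr' k x \<and> (\<forall>j<k. \<not> Pr' j x) \<and> c = corner L k x \<and> l = L / 2 ^ k)"
      using stopping_cells[of L Pr', OF L(2) Pr'_cong] by (elim exE conjE) (rule that)
    let ?U = "\<Union>p\<in>T'. (case p of (c, l) \<Rightarrow> hcube c l)"
    have "A \<subseteq> ?U"
      using small_cell_subset[OF L(2) V(1)] V(2) cell_refl unfolding T'(3)[symmetric] Pr'_def by blast
    then have "I A \<le> I ?U" by (rule I_mono)
    also have "\<dots> \<le> (\<integral>\<^sup>+x. 1 * indicator ?U x \<partial>lebesgue)"
      unfolding I_def
    proof (rule nn_integral_UN_mono[OF T'(1,2)])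
      fix p assume p: "p \<in> T'"
      obtain c l where cl: "p = (c, l)" by fastforce
      then obtain k x where k: "Pr' k x" "c = corner L k x" "l = L / 2 ^ k"
        using T'(4) p by blast
      then obtain a where a: "a \<in> A" "a \<in> cell L k x" by (auto simp: Pr'_def)
      have "a \<notin> \<Omega>" using a by (simp add: A_def)
      then have "\<not> Pr k a" unfolding \<Omega>_def T(3)[symmetric] by blast
      then have "I (cell L k x) \<le> ennreal ((L / 2 ^ k) ^ DIM('a))"
        using cell_eq[OF a(2)] by (simp add: Pr_def)
      also have "\<dots> = emeasure lebesgue (hcube c l)"
        using k L emeasure_hcube[of l c] by simp
      finally show "(\<integral>\<^sup>+x. \<phi> x * indicator (case p of (c, l) \<Rightarrow> hcube c l) x \<partial>lebesgue)
        \<le> (\<integral>\<^sup>+x. 1 * indicator (case p of (c, l) \<Rightarrow> hcube c l) x \<partial>lebesgue)"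
        using k cl L by (simp add: I_def cell_eq_hcube)
    qed (auto split: prod.splits)
    also have "\<dots> \<le> (\<integral>\<^sup>+x. indicator V x \<partial>lebesgue)"
    proof (rule nn_integral_mono)
      have "?U \<subseteq> V" unfolding T'(3)[symmetric] Pr'_def using cell_refl by blast
      then show "1 * indicator ?U x \<le> (indicator V x :: ennreal)" for x by (auto simp: indicator_def)
    qed
    also have "\<dots> = emeasure lebesgue V" using V by (intro nn_integral_indicator) auto
    finally show ?thesis .
  qed
  have IA: "I A \<le> emeasure lebesgue A"
  proof (rule ennreal_le_epsilon)
    fix e :: real assume "0 < e"
    then obtain V where V: "open V" "A \<subseteq> V" "V - A \<in> lmeasurable" "emeasure lebesgue (V - A) < ennreal e"
      using sets_lebesgue_outer_open[of A e] by auto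
    have "emeasure lebesgue V = emeasure lebesgue (A \<union> (V - A))" using V by (intro arg_cong2[of _ _ _ _ emeasure]) auto
    also have "\<dots> \<le> emeasure lebesgue A + emeasure lebesgue (V - A)"
      using V by (intro emeasure_subadditive) (auto simp: fmeasurableD)
    finally have "emeasure lebesgue V \<le> emeasure lebesgue A + emeasure lebesgue (V - A)" .
    also have "\<dots> \<le> emeasure lebesgue A + ennreal e" using V by (intro add_left_mono) auto
    finally show "I A \<le> emeasure lebesgue A + ennreal e" using IV[OF V(1,2)] by (rule order_trans[rotated])
  qed
  have "I A \<le> (\<integral>\<^sup>+x. \<phi> x \<partial>lebesgue)"
    unfolding I_def by (intro nn_integral_mono) (auto simp: indicator_def)
  then have IAfin: "I A < \<infinity>" using fin by (simp add: order_le_less_trans)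
  have "(\<integral>\<^sup>+x. indicator A x \<partial>lebesgue) \<le> I A"
    unfolding I_def by (intro nn_integral_mono) (auto simp: indicator_def A_def less_imp_le)
  then have Afin: "emeasure lebesgue A \<noteq> \<infinity>"
    using IAfin by (metis \<open>A \<in> sets lebesgue\<close> infinity_ennreal_def leD nn_integral_indicator)
  \<comment> \<open>On \<open>A\<close> the function exceeds 1, so the truncated subtraction is
    exact. As \<open>I A\<close> is at most the measure of \<open>A\<close>, and that measure is
    finite and can be cancelled, the excess over 1 has integral 0; hence \<open>A\<close> is
    null.\<close>
  have "I A = (\<integral>\<^sup>+x. (\<phi> x - 1) * indicator A x + indicator A x \<partial>lebesgue)"
    unfolding I_def by (intro nn_integral_cong) (auto simp: indicator_def A_def diff_add_cancel_ennreal)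
  also have "\<dots> = (\<integral>\<^sup>+x. (\<phi> x - 1) * indicator A x \<partial>lebesgue) + emeasure lebesgue A"
    by (subst nn_integral_add) auto
  finally have "(\<integral>\<^sup>+x. (\<phi> x - 1) * indicator A x \<partial>lebesgue) + emeasure lebesgue A \<le> 0 + emeasure lebesgue A"
    using IA by simp
  then have "(\<integral>\<^sup>+x. (\<phi> x - 1) * indicator A x \<partial>lebesgue) = 0"
    using Afin by (metis ennreal_add_left_cancel_le add.commute le_zero_eq)
  then have "AE x in lebesgue. (\<phi> x - 1) * indicator A x = 0"
    by (subst (asm) nn_integral_0_iff_AE) auto
  then have ae: "AE x in lebesgue. x \<notin> \<Omega> \<longrightarrow> \<phi> x \<le> 1"
  proof eventually_elim
    case (elim x)
    show ?case
    proof (rule ccontr)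
      assume "\<not> ?case"
      then have "x \<in> A" by (auto simp: A_def)
      then show False using elim \<open>\<not> ?case\<close> by (auto simp: diff_eq_0_iff_ennreal)
    qed
  qed
  show ?thesis
    using that[OF T(1) _ T(2)] T' ae unfolding I_def \<Omega>_def by blast
qed

section \<open>Orlicz averages\<close>

definition Phi :: "nat \<Rightarrow> real \<Rightarrow> real" where
  "Phi \<beta> x = x * ln (exp 1 + x) ^ \<beta>"

lemma ln_exp_1_add_ge_1: "0 \<le> x \<Longrightarrow> 1 \<le> ln (exp 1 + x)"
  for x :: real
  by (subst ln_ge_iff) (auto simp: add_pos_nonneg)

lemma Phi_ge: "0 \<le> x \<Longrightarrow> x \<le> Phi \<beta> x"
  unfolding Phi_def by (rule mult_right_mono[of 1 _ x, simplified mult.commute[of _ x] mult_1_right])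
    (simp_all add: one_le_power ln_exp_1_add_ge_1)

lemma Phi_nonneg: "0 \<le> x \<Longrightarrow> 0 \<le> Phi \<beta> x"
  using Phi_ge order_trans by blast

lemma Phi_mono:
  assumes "0 \<le> x" "x \<le> y"
  shows "Phi \<beta> x \<le> Phi \<beta> y"
proof -
  have "ln (exp 1 + x) \<le> ln (exp 1 + y)"
    using assms by (subst ln_le_cancel_iff) (auto simp: add_pos_nonneg)
  then show ?thesis unfolding Phi_def
    using assms ln_exp_1_add_ge_1[OF assms(1)] by (intro mult_mono power_mono) auto
qed

text \<open>From \<open>e + a * b \<le> (e + a) * (e + b)\<close> and
  \<open>A + B \<le> 2 * A * B\<close> for \<open>A, B \<ge> 1\<close>. It separates the values of
  \<open>f\<close> from the Luxemburg parameter on stopped cubes.\<close>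

lemma Phi_mult:
  assumes "0 \<le> a" "0 \<le> b"
  shows "Phi \<beta> (a * b) \<le> 2 ^ \<beta> * (Phi \<beta> a * Phi \<beta> b)"
proof -
  let ?A = "ln (exp 1 + a)" and ?B = "ln (exp 1 + b)"
  have AB: "1 \<le> ?A" "1 \<le> ?B" using assms ln_exp_1_add_ge_1 by auto
  have pos: "0 < exp 1 + a" "0 < exp 1 + b" "0 < exp 1 + a * b"
    using assms by (auto intro!: add_pos_nonneg)
  have "exp 1 + a * b \<le> exp 1 * exp 1 + a * b" by simp
  also have "\<dots> \<le> (exp 1 + a) * (exp 1 + b)" using assms by (simp add: algebra_simps)
  finally have "ln (exp 1 + a * b) \<le> ln ((exp 1 + a) * (exp 1 + b))"
    using pos by (subst ln_le_cancel_iff) auto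
  also have "\<dots> = ?A + ?B" using pos by (simp add: ln_mult)
  also have "\<dots> \<le> ?A * ?B + ?A * ?B"
    using AB by (intro add_mono) (auto intro: mult_left_mono[of 1 _ ?A, simplified] mult_right_mono[of 1 _ ?B, simplified])
  finally have "ln (exp 1 + a * b) ^ \<beta> \<le> (2 * (?A * ?B)) ^ \<beta>"
    using ln_exp_1_add_ge_1[of "a * b"] assms by (intro power_mono) auto
  then have "a * b * ln (exp 1 + a * b) ^ \<beta> \<le> a * b * (2 * (?A * ?B)) ^ \<beta>"
    using assms by (intro mult_left_mono) auto
  then show ?thesis by (simp add: Phi_def power_mult_distrib mult_ac)
qed

text \<open>Division scales the linear factor exactly and only lowers the logarithm. So enlarging a
  Luxemburg parameter \<open>L\<close> times lowers the modular at least \<open>L\<close>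
  times.\<close>

lemma Phi_divide_le:
  assumes "0 \<le> y" "1 \<le> L"
  shows "Phi \<beta> (y / L) \<le> Phi \<beta> y / L"
proof -
  have yL: "y / L \<le> y" using assms divide_left_mono[of 1 L y] by simp
  have "ln (exp 1 + y / L) \<le> ln (exp 1 + y)"
    using assms yL by (subst ln_le_cancel_iff) (auto simp: add_pos_nonneg)
  then have "ln (exp 1 + y / L) ^ \<beta> \<le> ln (exp 1 + y) ^ \<beta>"
    using ln_exp_1_add_ge_1[of "y / L"] assms by (intro power_mono) auto
  then show ?thesis unfolding Phi_def
    using assms by (simp add: mult_left_mono divide_right_mono)
qed

text \<open>The logarithm is bounded by \<open>ln z \<le> z powr a / a\<close> with
  \<open>a = (s - 1) / \<beta>\<close>, raised to the power \<open>\<beta>\<close>; this is the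
  source of the power \<open>\<beta>\<close> of the conjugate exponent. For
  \<open>\<beta> = 0\<close> that \<open>a\<close> is meaningless, and the factor is
  \<open>0 ^ 0 = 1\<close>. The number 36 is \<open>6 ^ 2\<close>, a bound for
  \<open>(2 * exp 1) powr s\<close>.\<close>

lemma Phi_le_powr:
  assumes s: "1 < s" "s \<le> 2" and y: "0 \<le> y"
  shows "Phi \<beta> y \<le> 36 * (\<beta> / (s - 1)) ^ \<beta> * (1 + y powr s)"
proof -
  let ?z = "exp 1 + y"
  have z: "1 \<le> ?z" "0 < ?z" "y \<le> ?z" using y by (auto intro: add_pos_nonneg add_increasing2)
  have 1: "ln ?z ^ \<beta> \<le> (\<beta> / (s - 1)) ^ \<beta> * ?z powr (s - 1)"
  proof (cases "\<beta> = 0")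
    case True
    then show ?thesis using z s by (simp add: ge_one_powr_ge_zero)
  next
    case False
    let ?a = "(s - 1) / \<beta>"
    have a: "0 < ?a" using False s by simp
    have "ln ?z = ln (?z powr ?a) / ?a"
    proof -
      have "ln (?z powr ?a) = ?a * ln ?z" using z by (simp add: ln_powr)
      then show ?thesis using False s by simp
    qed
    also have "\<dots> \<le> ?z powr ?a / ?a"
      using a z ln_le_minus_one[of "?z powr ?a"] by (intro divide_right_mono) auto
    finally have "ln ?z ^ \<beta> \<le> (?z powr ?a / ?a) ^ \<beta>"
      using ln_exp_1_add_ge_1[OF y] by (intro power_mono) auto
    also have "\<dots> = (\<beta> / (s - 1)) ^ \<beta> * ?z powr (s - 1)"
    proof -
      have "(?z powr ?a) ^ \<beta> = ?z powr (\<beta> * ?a)"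
        using z by (intro powr_power) auto
      also have "\<beta> * ?a = s - 1" using False by simp
      finally have *: "(?z powr ?a) ^ \<beta> = ?z powr (s - 1)" .
      have "?z powr ?a / ?a = \<beta> / (s - 1) * ?z powr ?a" by simp
      then show ?thesis by (simp only: power_mult_distrib *)
    qed
    finally show ?thesis .
  qed
  have "?z powr s \<le> (2 * max (exp 1) y) powr s"
    using z s by (intro powr_mono2) auto
  also have "\<dots> \<le> 36 * (1 + y powr s)"
  proof (cases "y \<le> exp 1")
    case True
    have "(2 * exp 1) powr s \<le> 6 powr s"
      using s exp_le by (intro powr_mono2) auto
    also have "\<dots> \<le> 6 powr 2" using s by (intro powr_mono) auto
    also have "(6::real) powr 2 = 36" by simp
    finally show ?thesis using True by (simp add: max_def algebra_simps) (use powr_ge_zero[of y s] in linarith)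
  next
    case False
    have "(2 * y) powr s \<le> 4 * y powr s"
      using s powr_mono[of s 2 "2::real"] by (simp add: powr_mult mult_right_mono)
    then show ?thesis using False powr_ge_zero[of y s] by (simp add: max_def) (use powr_ge_zero[of y s] in linarith)
  qed
  finally have 2: "?z powr s \<le> 36 * (1 + y powr s)" .
  have "Phi \<beta> y \<le> ?z * ((\<beta> / (s - 1)) ^ \<beta> * ?z powr (s - 1))"
    unfolding Phi_def using 1 z y by (intro mult_mono) auto
  also have "\<dots> = (\<beta> / (s - 1)) ^ \<beta> * ?z powr s"
    using z by (simp add: powr_mult_base)
  also have "\<dots> \<le> (\<beta> / (s - 1)) ^ \<beta> * (36 * (1 + y powr s))"
    using 2 s by (intro mult_left_mono) auto
  finally show ?thesis by (simp only: mult_ac)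
qed

lemma measurable_Phi [measurable]: "Phi \<beta> \<in> borel_measurable borel"
  unfolding Phi_def by measurable

lemma bdd_nonneg_Phi:
  assumes "bdd_nonneg h"
  shows "bdd_nonneg (\<lambda>x. Phi \<beta> (h x))"
proof -
  note [measurable] = bdd_nonneg_measurable[OF assms]
  obtain B where B: "\<And>x. h x \<le> B" using assms by (auto simp: bdd_nonneg_def)
  have "Phi \<beta> (h x) \<le> Phi \<beta> B" for x
    using B bdd_nonneg_ge0[OF assms] by (intro Phi_mono)
  then show ?thesis using Phi_nonneg bdd_nonneg_ge0[OF assms] by (auto simp: bdd_nonneg_def)
qed

lemma nn_integral_ocube:
  fixes c :: "'a::euclidean_space"
  assumes "bdd_nonneg g" "0 < l"
  shows "(\<integral>\<^sup>+x. ennreal (g x) * indicator (ocube c l) x \<partial>lebesgue) = ennreal (avg g c l * l ^ DIM('a))"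
proof -
  have "(\<integral>\<^sup>+x. ennreal (g x) * indicator (ocube c l) x \<partial>lebesgue)
      = (\<integral>\<^sup>+x. ennreal (g x * indicator (ocube c l) x) \<partial>lebesgue)"
    by (intro nn_integral_cong) (auto simp: indicator_def)
  also have "\<dots> = ennreal (\<integral>x. g x * indicator (ocube c l) x \<partial>lebesgue)"
    using assms by (intro nn_integral_eq_integral integrable_on_ocube) (auto simp: bdd_nonneg_def)
  finally show ?thesis using assms by (simp add: avg_def)
qed

lemma LlogL_norm_le:
  assumes "0 < m" "(\<integral>\<^sup>+ x. ennreal (Phi \<beta> (\<bar>f x\<bar> / m)) * indicator Q x \<partial>lebesgue) \<le> ennreal (measure lebesgue Q)"
  shows "LlogL_norm \<beta> f Q \<le> m"
  unfolding LlogL_norm_def using assms by (intro cInf_lower bdd_belowI[of _ 0]) (auto simp: Phi_def)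

text \<open>If \<open>m\<close> exceeds the \<open>L^s\<close> average of \<open>h\<close>, then
  \<open>1 + (h / m) powr s\<close> has average at most 2 over the triple. The parameter
  \<open>L * m\<close> brings the modular of \<open>f\<close> over the cube down to its volume: in
  \<open>L\<close>, the factor \<open>K\<close> pays for replacing \<open>f\<close> by
  \<open>h\<close>, the power of 3 for tripling, and \<open>72 = 36 * 2\<close> with the power of
  \<open>\<beta> / (s - 1)\<close> for \<open>Phi_le_powr\<close>. The comparison \<open>dom\<close>
  is between modulars because \<open>f\<close> is not dominated by \<open>h\<close>
  pointwise.\<close>

lemma LlogL_norm_le_avg:
  fixes c :: "'a::euclidean_space"
  assumes l: "0 < l" and s: "1 < s" "s \<le> 2" and h: "bdd_nonneg h" and K: "1 \<le> K"
    and dom: "\<And>m. 0 < m \<Longrightarrow>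
      (\<integral>\<^sup>+ x. ennreal (Phi \<beta> (\<bar>f x\<bar> / m)) * indicator (cbox c (c + l *\<^sub>R One)) x \<partial>lebesgue)
      \<le> ennreal K * (\<integral>\<^sup>+ x. ennreal (Phi \<beta> (h x / m)) * indicator (ocube (c - l *\<^sub>R One) (3 * l)) x \<partial>lebesgue)"
  shows "LlogL_norm \<beta> f (cbox c (c + l *\<^sub>R One))
    \<le> K * 3 ^ DIM('a) * 72 * (\<beta> / (s - 1)) ^ \<beta> * avg (\<lambda>x. h x powr s) (c - l *\<^sub>R One) (3 * l) powr (1 / s)"
proof -
  define c' where "c' = c - l *\<^sub>R One"
  define b where "b = (\<beta> / (s - 1)) ^ \<beta>"
  define L where "L = K * 3 ^ DIM('a) * 72 * b"
  define Lam where "Lam = avg (\<lambda>x. h x powr s) c' (3 * l) powr (1 / s)"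
  have b: "1 \<le> b"
  proof (cases "\<beta> = 0")
    case False
    then have "1 \<le> \<beta> / (s - 1)" using s by (simp add: field_simps)
    then show ?thesis unfolding b_def by (rule one_le_power)
  qed (simp add: b_def)
  have L1: "1 \<le> L"
  proof -
    have "1 * 1 * 1 * 1 \<le> K * 3 ^ DIM('a) * 72 * b"
      using K b by (intro mult_mono) (auto intro: one_le_power)
    then show ?thesis by (simp add: L_def)
  qed
  have hs: "bdd_nonneg (\<lambda>x. h x powr s)" using h s by (intro bdd_nonneg_powr) auto
  \<comment> \<open>\<open>Lam\<close> may be 0, so it is not an admissible parameter itself.\<close>
  have *: "LlogL_norm \<beta> f (cbox c (c + l *\<^sub>R One)) \<le> L * (Lam + e)" if e: "0 < e" for e
  proof -
    define m where "m = Lam + e"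
    have m: "0 < m" using e unfolding m_def Lam_def by (intro add_nonneg_pos) auto
    have "avg (\<lambda>x. h x powr s) c' (3 * l) = Lam powr s"
      using s l avg_nonneg[OF hs, of "3 * l" c'] by (simp add: Lam_def powr_powr)
    also have "\<dots> \<le> m powr s"
      using s e by (intro powr_mono2) (auto simp: m_def Lam_def)
    finally have avm: "avg (\<lambda>x. h x powr s) c' (3 * l) \<le> m powr s" .
    have Phi_le: "Phi \<beta> (h x / (L * m)) \<le> (36 * b / L) * (1 + (1 / m powr s) * h x powr s)" for x
    proof -
      have h0: "0 \<le> h x" using h by (simp add: bdd_nonneg_def)
      have "Phi \<beta> (h x / m / L) \<le> Phi \<beta> (h x / m) / L"
        using m h0 L1 by (intro Phi_divide_le) auto
      also have "\<dots> \<le> (36 * b * (1 + (h x / m) powr s)) / L"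
        using Phi_le_powr[OF s, of "h x / m" \<beta>] m h0 L1 unfolding b_def
        by (intro divide_right_mono) auto
      finally show ?thesis by (simp add: powr_divide mult.commute)
    qed
    have hm: "bdd_nonneg (\<lambda>x. h x / (L * m))"
      using bdd_nonneg_cmult[OF h, of "1 / (L * m)"] m L1 by simp
    have c1: "bdd_nonneg (\<lambda>x::'a. 1)" by (auto simp: bdd_nonneg_def)
    have hs': "bdd_nonneg (\<lambda>x. (1 / m powr s) * h x powr s)"
      by (intro bdd_nonneg_cmult hs) auto
    have "avg (\<lambda>x. Phi \<beta> (h x / (L * m))) c' (3 * l)
      \<le> avg (\<lambda>x. (36 * b / L) * (1 + (1 / m powr s) * h x powr s)) c' (3 * l)"
      using Phi_le l b L1 by (intro avg_mono bdd_nonneg_Phi hm bdd_nonneg_cmult bdd_nonneg_add c1 hs) auto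
    also have "\<dots> = (36 * b / L) * (1 + (1 / m powr s) * avg (\<lambda>x. h x powr s) c' (3 * l))"
      using l by (simp only: avg_cmult avg_add[OF c1 hs'] avg_const mult_pos_pos zero_less_numeral)
    also have "\<dots> \<le> (36 * b / L) * 2"
      using avm m b L1 by (intro mult_left_mono) (auto simp: field_simps)
    also have "\<dots> = 1 / (K * 3 ^ DIM('a))"
      using b K by (simp add: L_def)
    finally have av: "avg (\<lambda>x. Phi \<beta> (h x / (L * m))) c' (3 * l) \<le> 1 / (K * 3 ^ DIM('a))" .
    have "(\<integral>\<^sup>+ x. ennreal (Phi \<beta> (\<bar>f x\<bar> / (L * m))) * indicator (cbox c (c + l *\<^sub>R One)) x \<partial>lebesgue)
      \<le> ennreal K * ennreal (avg (\<lambda>x. Phi \<beta> (h x / (L * m))) c' (3 * l) * (3 * l) ^ DIM('a))"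
      using dom[of "L * m"] m L1 nn_integral_ocube[OF bdd_nonneg_Phi[OF hm], of "3 * l" \<beta> c'] l
      by (simp add: c'_def)
    also have "\<dots> \<le> ennreal K * ennreal (1 / (K * 3 ^ DIM('a)) * (3 * l) ^ DIM('a))"
      using av l by (intro mult_left_mono ennreal_leI mult_right_mono) auto
    also have "\<dots> = ennreal (K * (1 / (K * 3 ^ DIM('a)) * (3 * l) ^ DIM('a)))"
      using K l by (intro ennreal_mult[symmetric]) auto
    also have "K * (1 / (K * 3 ^ DIM('a)) * (3 * l) ^ DIM('a)) = measure lebesgue (cbox c (c + l *\<^sub>R One))"
      using K measure_cube[of l c] l by (simp add: power_mult_distrib)
    finally show ?thesis
      using m L1 unfolding m_def[symmetric] by (intro LlogL_norm_le) auto
  qed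
  have "LlogL_norm \<beta> f (cbox c (c + l *\<^sub>R One)) \<le> L * Lam"
  proof (rule field_le_epsilon)
    fix e :: real assume "0 < e"
    then show "LlogL_norm \<beta> f (cbox c (c + l *\<^sub>R One)) \<le> L * Lam + e"
      using *[of "e / L"] L1 by (simp add: distrib_left)
  qed
  then show ?thesis by (simp add: L_def Lam_def b_def c'_def)
qed

lemma avg_r_eq:
  fixes c :: "'a::euclidean_space"
  assumes l: "0 < l" and w: "bdd_nonneg (\<lambda>x. \<bar>g x\<bar>)" and "0 \<le> r"
  shows "avg_r r g (cbox c (c + l *\<^sub>R One)) = avg (\<lambda>x. \<bar>g x\<bar> powr r) c l powr (1 / r)"
proof -
  have ae: "AE x in lebesgue. x \<notin> cbox c (c + l *\<^sub>R One) - ocube c l"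
    by (rule AE_not_in[OF cube_diff_ocube_null])
  have "AE x in lebesgue. ennreal (\<bar>g x\<bar> powr r) * indicator (cbox c (c + l *\<^sub>R One)) x
     = ennreal (\<bar>g x\<bar> powr r) * indicator (ocube c l) x"
    using ae
  proof eventually_elim
    case (elim x)
    then show ?case
      using box_subset_cbox[of c "c + l *\<^sub>R One"] by (auto simp: indicator_def ocube_def)
  qed
  then have "(\<integral>\<^sup>+x. ennreal (\<bar>g x\<bar> powr r) * indicator (cbox c (c + l *\<^sub>R One)) x \<partial>lebesgue)
    = (\<integral>\<^sup>+x. ennreal (\<bar>g x\<bar> powr r) * indicator (ocube c l) x \<partial>lebesgue)"
    by (rule nn_integral_cong_AE)
  also have "\<dots> = ennreal (avg (\<lambda>x. \<bar>g x\<bar> powr r) c l * l ^ DIM('a))"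
    using l by (intro nn_integral_ocube bdd_nonneg_powr assms)
  finally show ?thesis
    using l avg_nonneg[OF bdd_nonneg_powr[OF w \<open>0 \<le> r\<close>] l, of c] measure_cube[of l c]
    by (simp add: avg_r_def)
qed

section \<open>Sparse forms\<close>

lemma avg_triple_le:
  fixes c :: "'a::euclidean_space"
  assumes "bdd_nonneg g" "0 < l"
  shows "avg g c l \<le> 3 ^ DIM('a) * avg g (c - l *\<^sub>R One) (3 * l)"
  using assms ocube_subset_triple by (intro avg_le_dilate)

text \<open>Hoelder for \<open>w^r = (w^t)^\<theta> (w^\<kappa>)^(1-\<theta>)\<close> with
  \<open>\<theta> = r * a / t\<close>. The relation \<open>e2\<close> gives
  \<open>1 - \<theta> = r * b / \<kappa>\<close>, and \<open>e1\<close> makes the exponents of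
  \<open>w\<close> add up to \<open>r\<close>.\<close>

lemma avg_interpolation:
  assumes w: "bdd_nonneg w" and l: "0 < l" and pos: "0 < r" "0 < t" "0 < \<kappa>" "0 < a" "0 < b"
    and e1: "a + b = 1" and e2: "1 / r = a / t + b / \<kappa>"
  shows "avg (\<lambda>x. w x powr r) c l powr (1 / r)
    \<le> avg (\<lambda>x. w x powr t) c l powr (a / t) * avg (\<lambda>x. w x powr \<kappa>) c l powr (b / \<kappa>)"
proof -
  define \<theta> where "\<theta> = r * a / t"
  have th: "0 < \<theta>" "1 - \<theta> = r * b / \<kappa>"
  proof -
    show "0 < \<theta>" using pos by (simp add: \<theta>_def)
    have "r * (1 / r) = r * (a / t + b / \<kappa>)" by (simp only: e2)
    then show "1 - \<theta> = r * b / \<kappa>" using pos by (simp add: \<theta>_def distrib_left)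
  qed
  have "0 < 1 - \<theta>" unfolding th(2) using pos by simp
  then have th1: "\<theta> < 1" by simp
  have "w x powr r = (w x powr t) powr \<theta> * (w x powr \<kappa>) powr (1 - \<theta>)" for x
  proof -
    have "t * \<theta> + \<kappa> * (1 - \<theta>) = r * (a + b)"
      unfolding th(2) using pos by (simp add: \<theta>_def distrib_left)
    then show ?thesis using e1 by (simp add: powr_powr powr_add[symmetric])
  qed
  then have "avg (\<lambda>x. w x powr r) c l = avg (\<lambda>x. (w x powr t) powr \<theta> * (w x powr \<kappa>) powr (1 - \<theta>)) c l"
    by simp
  also have "\<dots> \<le> avg (\<lambda>x. w x powr t) c l powr \<theta> * avg (\<lambda>x. w x powr \<kappa>) c l powr (1 - \<theta>)"
    using pos by (intro avg_Holder bdd_nonneg_powr w l th th1) auto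
  finally have "avg (\<lambda>x. w x powr r) c l powr (1 / r)
    \<le> (avg (\<lambda>x. w x powr t) c l powr \<theta> * avg (\<lambda>x. w x powr \<kappa>) c l powr (1 - \<theta>)) powr (1 / r)"
    using pos avg_nonneg[OF bdd_nonneg_powr[OF w] l] by (intro powr_mono2) auto
  also have "\<dots> = avg (\<lambda>x. w x powr t) c l powr (\<theta> * (1 / r)) * avg (\<lambda>x. w x powr \<kappa>) c l powr ((1 - \<theta>) * (1 / r))"
    by (simp add: powr_mult powr_powr)
  also have "\<theta> * (1 / r) = a / t" using pos by (simp add: \<theta>_def)
  also have "(1 - \<theta>) * (1 / r) = b / \<kappa>" unfolding th(2) using pos by simp
  finally show ?thesis .
qed

text \<open>The bound holds at every point of the tripled cube, so it can be integrated over the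
  part of the cube that sparseness provides. The power of 3 is lost when the average of
  \<open>w powr r\<close> passes to the triple; the outer exponent \<open>1 / r \<le> 1\<close> does
  not increase it.\<close>

lemma sparse_cube_estimate:
  fixes c :: "'a::euclidean_space"
  assumes l: "0 < l" and h: "bdd_nonneg h" and w: "bdd_nonneg w"
    and pos: "1 \<le> r" "0 < t" "0 < \<kappa>" "0 < a" "0 < b" "0 < s"
    and e1: "a + b = 1" and e2: "1 / r = a / t + b / \<kappa>"
    and x: "x \<in> ocube (c - l *\<^sub>R One) (3 * l)"
  defines "v \<equiv> \<lambda>x. mx (\<lambda>y. w y powr t) x powr (1 / t)"
  shows "avg (\<lambda>x. h x powr s) (c - l *\<^sub>R One) (3 * l) powr (1 / s) * avg (\<lambda>x. w x powr r) c l powr (1 / r)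
    \<le> 3 ^ DIM('a) * (mx (\<lambda>y. (h y * v y powr a) powr s) x powr (1 / s) * mx (\<lambda>y. w y powr \<kappa>) x powr (b / \<kappa>))"
proof -
  define c' l' where "c' = c - l *\<^sub>R One" and "l' = 3 * l"
  have l': "0 < l'" using l by (simp add: l'_def)
  note bp = bdd_nonneg_powr[OF w]
  have bt: "bdd_nonneg (\<lambda>x. w x powr t)" and bk: "bdd_nonneg (\<lambda>x. w x powr \<kappa>)" and br: "bdd_nonneg (\<lambda>x. w x powr r)"
    using pos by (auto intro: bp)
  have v: "bdd_nonneg v" unfolding v_def using pos by (intro bdd_nonneg_powr bdd_nonneg_mx bt) auto
  define T where "T = avg (\<lambda>x. w x powr t) c' l'"
  have T0: "0 \<le> T" unfolding T_def using bt l' by (rule avg_nonneg)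
  have hs: "bdd_nonneg (\<lambda>x. h x powr s)" and Fs: "bdd_nonneg (\<lambda>y. (h y * v y powr a) powr s)"
    using pos by (auto intro!: bdd_nonneg_powr bdd_nonneg_mult h v)
  have "avg (\<lambda>x. w x powr r) c l powr (1 / r) \<le> (3 ^ DIM('a) * avg (\<lambda>x. w x powr r) c' l') powr (1 / r)"
    using avg_triple_le[OF br l, of c] pos avg_nonneg[OF br l] unfolding c'_def l'_def by (intro powr_mono2) auto
  also have "\<dots> = (3 ^ DIM('a)) powr (1 / r) * avg (\<lambda>x. w x powr r) c' l' powr (1 / r)"
    by (simp add: powr_mult)
  also have "\<dots> \<le> 3 ^ DIM('a) * (T powr (a / t) * avg (\<lambda>x. w x powr \<kappa>) c' l' powr (b / \<kappa>))"
  proof (rule mult_mono)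
    have "(3 ^ DIM('a)) powr (1 / r) \<le> (3 ^ DIM('a) :: real) powr 1"
      using pos by (intro powr_mono) auto
    then show "(3 ^ DIM('a)) powr (1 / r) \<le> (3 ^ DIM('a) :: real)" by simp
    show "avg (\<lambda>x. w x powr r) c' l' powr (1 / r) \<le> T powr (a / t) * avg (\<lambda>x. w x powr \<kappa>) c' l' powr (b / \<kappa>)"
      unfolding T_def using pos by (intro avg_interpolation w l' e1 e2) auto
  qed auto
  finally have 1: "avg (\<lambda>x. w x powr r) c l powr (1 / r)
    \<le> 3 ^ DIM('a) * (T powr (a / t) * avg (\<lambda>x. w x powr \<kappa>) c' l' powr (b / \<kappa>))" .
  \<comment> \<open>This moves the average of \<open>w\<^sup>t\<close> into the average of \<open>h\<^sup>s\<close>.\<close>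
  have Tv: "T powr (a / t) \<le> v y powr a" if "y \<in> ocube c' l'" for y
  proof -
    have "T powr (1 / t) \<le> v y"
      unfolding v_def T_def using pos bt l' that
      by (intro powr_mono2 avg_le_mx avg_nonneg) auto
    then have "(T powr (1 / t)) powr a \<le> v y powr a" using pos by (intro powr_mono2) auto
    then show ?thesis by (simp add: powr_powr)
  qed
  have "avg (\<lambda>x. h x powr s) c' l' powr (1 / s) * T powr (a / t)
     = (T powr (a / t * s) * avg (\<lambda>x. h x powr s) c' l') powr (1 / s)"
    using pos by (simp add: powr_mult powr_powr)
  also have "\<dots> = avg (\<lambda>x. T powr (a / t * s) * h x powr s) c' l' powr (1 / s)"
    by (simp only: avg_cmult)
  also have "\<dots> \<le> avg (\<lambda>y. (h y * v y powr a) powr s) c' l' powr (1 / s)"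
  proof (rule powr_mono2)
    have Th: "bdd_nonneg (\<lambda>x. T powr (a / t * s) * h x powr s)" by (intro bdd_nonneg_cmult hs) auto
    then show "0 \<le> avg (\<lambda>x. T powr (a / t * s) * h x powr s) c' l'" using l' by (rule avg_nonneg)
    show "avg (\<lambda>x. T powr (a / t * s) * h x powr s) c' l' \<le> avg (\<lambda>y. (h y * v y powr a) powr s) c' l'"
    proof (rule avg_mono[OF Th Fs l'])
      fix y assume "y \<in> ocube c' l'"
      then have "(T powr (a / t) * h y) powr s \<le> (h y * v y powr a) powr s"
        using pos h Tv[of y] by (intro powr_mono2) (auto simp: bdd_nonneg_def mult.commute intro!: mult_left_mono)
      then show "T powr (a / t * s) * h y powr s \<le> (h y * v y powr a) powr s"
        by (simp add: powr_mult powr_powr)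
    qed
  qed (use pos in auto)
  also have "\<dots> \<le> mx (\<lambda>y. (h y * v y powr a) powr s) x powr (1 / s)"
    using pos x l' avg_nonneg[OF Fs l'] avg_le_mx[OF Fs l'] unfolding c'_def l'_def by (intro powr_mono2) auto
  finally have 2: "avg (\<lambda>x. h x powr s) c' l' powr (1 / s) * T powr (a / t)
    \<le> mx (\<lambda>y. (h y * v y powr a) powr s) x powr (1 / s)" .
  have 3: "avg (\<lambda>x. w x powr \<kappa>) c' l' powr (b / \<kappa>) \<le> mx (\<lambda>y. w y powr \<kappa>) x powr (b / \<kappa>)"
    using pos x l' avg_nonneg[OF bk l'] avg_le_mx[OF bk l'] unfolding c'_def l'_def by (intro powr_mono2) auto
  have "avg (\<lambda>x. h x powr s) c' l' powr (1 / s) * avg (\<lambda>x. w x powr r) c l powr (1 / r)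
    \<le> avg (\<lambda>x. h x powr s) c' l' powr (1 / s) * (3 ^ DIM('a) * (T powr (a / t) * avg (\<lambda>x. w x powr \<kappa>) c' l' powr (b / \<kappa>)))"
    using 1 by (intro mult_left_mono) auto
  also have "\<dots> = 3 ^ DIM('a) * ((avg (\<lambda>x. h x powr s) c' l' powr (1 / s) * T powr (a / t)) * avg (\<lambda>x. w x powr \<kappa>) c' l' powr (b / \<kappa>))"
    by (simp add: mult_ac)
  also have "\<dots> \<le> 3 ^ DIM('a) * (mx (\<lambda>y. (h y * v y powr a) powr s) x powr (1 / s) * mx (\<lambda>y. w y powr \<kappa>) x powr (b / \<kappa>))"
    using 2 3 by (intro mult_left_mono mult_mono) auto
  finally show ?thesis by (simp add: c'_def l'_def)
qed

text \<open>The volume of \<open>Q\<close> is traded for that of \<open>E Q\<close>, on which the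
  bound for the cube holds pointwise; disjointness then merges the sum into one integral. The norm
  bound is asked only of cubes where \<open>g\<close> has nonzero average, since it fails to be
  available for cubes inside the exceptional set, whose terms vanish.\<close>

lemma sparse_form_le:
  fixes S :: "'a::euclidean_space set set"
  assumes sp: "sparse \<eta> S" and eta: "0 < \<eta>" and h: "bdd_nonneg h" and w: "bdd_nonneg (\<lambda>x. \<bar>g x\<bar>)"
    and pos: "1 \<le> r" "0 < t" "0 < \<kappa>" "0 < a" "0 < b" "0 < s" "0 \<le> N"
    and e1: "a + b = 1" and e2: "1 / r = a / t + b / \<kappa>"
    and norm: "\<And>c l. cbox c (c + l *\<^sub>R One) \<in> S \<Longrightarrow> 0 < l \<Longrightarrow> avg_r r g (cbox c (c + l *\<^sub>R One)) \<noteq> 0 \<Longrightarrow>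
      LlogL_norm \<beta> f (cbox c (c + l *\<^sub>R One)) \<le> N * avg (\<lambda>x. h x powr s) (c - l *\<^sub>R One) (3 * l) powr (1 / s)"
  defines "v \<equiv> \<lambda>x. mx (\<lambda>y. \<bar>g y\<bar> powr t) x powr (1 / t)"
  defines "A \<equiv> \<lambda>x. mx (\<lambda>y. (h y * v y powr a) powr s) x powr (1 / s)"
  defines "B \<equiv> \<lambda>x. mx (\<lambda>y. \<bar>g y\<bar> powr \<kappa>) x powr (b / \<kappa>)"
  shows "sparse_form S \<beta> r f g \<le> ennreal (N * 3 ^ DIM('a) / \<eta>) * (\<integral>\<^sup>+x. ennreal (A x * B x) \<partial>lebesgue)"
proof -
  have bt: "bdd_nonneg (\<lambda>y. \<bar>g y\<bar> powr t)" using pos by (intro bdd_nonneg_powr w) auto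
  have v: "bdd_nonneg v" unfolding v_def using pos by (intro bdd_nonneg_powr bdd_nonneg_mx bt) auto
  have "bdd_nonneg A" "bdd_nonneg B"
    unfolding A_def B_def using pos by (auto intro!: bdd_nonneg_powr bdd_nonneg_mx bdd_nonneg_mult h v w)
  then have [measurable]: "A \<in> borel_measurable lebesgue" "B \<in> borel_measurable lebesgue"
    by (auto simp: bdd_nonneg_measurable)
  obtain E where E: "\<And>Q. Q \<in> S \<Longrightarrow> E Q \<in> sets lebesgue" "\<And>Q. Q \<in> S \<Longrightarrow> E Q \<subseteq> Q"
    "\<And>Q. Q \<in> S \<Longrightarrow> measure lebesgue (E Q) \<ge> \<eta> * measure lebesgue Q" "disjoint_family_on E S"
    using sp unfolding sparse_def by blast
  let ?K = "N * 3 ^ DIM('a) / \<eta>"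
  have K0: "0 \<le> ?K" using pos eta by simp
  have cube: "ennreal (measure lebesgue Q * LlogL_norm \<beta> f Q * avg_r r g Q)
      \<le> ennreal ?K * (\<integral>\<^sup>+x. ennreal (A x * B x) * indicator (E Q) x \<partial>lebesgue)" if Q: "Q \<in> S" for Q
  proof -
    obtain c l where cl: "0 < l" "Q = cbox c (c + l *\<^sub>R One)"
      using sp Q unfolding sparse_def is_cube_def by blast
    show ?thesis
    proof (cases "avg_r r g Q = 0")
      case False
      define X where "X = avg (\<lambda>x. h x powr s) (c - l *\<^sub>R One) (3 * l) powr (1 / s) * avg (\<lambda>x. \<bar>g x\<bar> powr r) c l powr (1 / r)"
      have X0: "0 \<le> X" by (simp add: X_def)
      have "measure lebesgue Q * LlogL_norm \<beta> f Q * avg_r r g Q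
        \<le> measure lebesgue Q * (N * avg (\<lambda>x. h x powr s) (c - l *\<^sub>R One) (3 * l) powr (1 / s)) * avg_r r g Q"
        using norm[of c l] cl Q False by (intro mult_right_mono mult_left_mono) (auto simp: avg_r_def)
      also have "\<dots> = measure lebesgue Q * (N * X)"
        using cl pos w by (simp add: X_def avg_r_eq mult_ac)
      also have "\<dots> \<le> (measure lebesgue (E Q) / \<eta>) * (N * X)"
        using E(3)[OF Q] eta pos X0 by (intro mult_right_mono) (auto simp: field_simps)
      also have "\<dots> = (N / \<eta> * X) * measure lebesgue (E Q)" by simp
      finally have "ennreal (measure lebesgue Q * LlogL_norm \<beta> f Q * avg_r r g Q)
        \<le> ennreal ((N / \<eta> * X) * measure lebesgue (E Q))" by (rule ennreal_leI)
      also have "\<dots> = ennreal (N / \<eta> * X) * emeasure lebesgue (E Q)"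
      proof -
        have "emeasure lebesgue (E Q) \<le> emeasure lebesgue Q"
          using E(2)[OF Q] cl by (intro emeasure_mono) auto
        also have "\<dots> < \<infinity>" using emeasure_cube[of l c] cl by (simp del: emeasure_completion)
        finally have "emeasure lebesgue (E Q) = ennreal (measure lebesgue (E Q))"
          by (intro emeasure_eq_ennreal_measure) auto
        moreover have "ennreal (N / \<eta> * X * measure lebesgue (E Q)) = ennreal (N / \<eta> * X) * ennreal (measure lebesgue (E Q))"
          using pos eta X0 by (intro ennreal_mult) auto
        ultimately show ?thesis by metis
      qed
      also have "\<dots> = (\<integral>\<^sup>+x. ennreal (N / \<eta> * X) * indicator (E Q) x \<partial>lebesgue)"
        using E(1)[OF Q] by (rule nn_integral_cmult_indicator[symmetric])
      also have "\<dots> \<le> (\<integral>\<^sup>+x. ennreal ?K * (ennreal (A x * B x) * indicator (E Q) x) \<partial>lebesgue)"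
      proof (rule nn_integral_mono)
        fix x
        show "ennreal (N / \<eta> * X) * indicator (E Q) x \<le> ennreal ?K * (ennreal (A x * B x) * indicator (E Q) x)"
        proof (cases "x \<in> E Q")
          case True
          then have "x \<in> ocube (c - l *\<^sub>R One) (3 * l)"
            using E(2)[OF Q] cl cube_subset_triple by blast
          then have "X \<le> 3 ^ DIM('a) * (A x * B x)"
            unfolding X_def A_def B_def v_def
            by (intro sparse_cube_estimate cl h w pos e1 e2)
          then have "N / \<eta> * X \<le> N / \<eta> * (3 ^ DIM('a) * (A x * B x))"
            using pos eta by (intro mult_left_mono) auto
          then have "ennreal (N / \<eta> * X) \<le> ennreal (?K * (A x * B x))"
            by (intro ennreal_leI) simp
          also have "\<dots> = ennreal ?K * ennreal (A x * B x)" using K0 by (rule ennreal_mult')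
          finally show ?thesis using True by simp
        qed auto
      qed
      also have "\<dots> = ennreal ?K * (\<integral>\<^sup>+x. ennreal (A x * B x) * indicator (E Q) x \<partial>lebesgue)"
        using E(1)[OF Q] by (intro nn_integral_cmult) auto
      finally show ?thesis .
    qed auto
  qed
  \<comment> \<open>An unordered sum of nonnegative terms is the supremum of its finite partial
    sums, so disjointness is used for finite subfamilies only.\<close>
  have "sparse_form S \<beta> r f g
    = (SUP F\<in>{F. finite F \<and> F \<subseteq> S}. \<Sum>Q\<in>F. ennreal (measure lebesgue Q * LlogL_norm \<beta> f Q * avg_r r g Q))"
    unfolding sparse_form_def by (rule nonneg_infsum_complete[THEN trans]) auto
  also have "\<dots> \<le> ennreal ?K * (\<integral>\<^sup>+x. ennreal (A x * B x) \<partial>lebesgue)"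
  proof (rule SUP_least)
    fix F assume F: "F \<in> {F. finite F \<and> F \<subseteq> S}"
    then have dF: "disjoint_family_on E F" using E(4) by (auto simp: disjoint_family_on_def)
    have "(\<Sum>Q\<in>F. ennreal (measure lebesgue Q * LlogL_norm \<beta> f Q * avg_r r g Q))
      \<le> (\<Sum>Q\<in>F. ennreal ?K * (\<integral>\<^sup>+x. ennreal (A x * B x) * indicator (E Q) x \<partial>lebesgue))"
      using F by (intro sum_mono cube) auto
    also have "\<dots> = ennreal ?K * (\<integral>\<^sup>+x. (\<Sum>Q\<in>F. ennreal (A x * B x) * indicator (E Q) x) \<partial>lebesgue)"
      using F E(1) by (subst nn_integral_sum) (auto simp: sum_distrib_left)
    also have "\<dots> \<le> ennreal ?K * (\<integral>\<^sup>+x. ennreal (A x * B x) \<partial>lebesgue)"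
    proof (intro mult_left_mono nn_integral_mono)
      fix x
      have "(\<Sum>Q\<in>F. indicator (E Q) x :: ennreal) = indicator (\<Union>Q\<in>F. E Q) x"
        using F by (intro indicator_UN_disjoint[symmetric] dF) auto
      then have "(\<Sum>Q\<in>F. ennreal (A x * B x) * indicator (E Q) x) = ennreal (A x * B x) * indicator (\<Union>Q\<in>F. E Q) x"
        by (simp add: sum_distrib_left[symmetric])
      also have "\<dots> \<le> ennreal (A x * B x)" by (auto simp: indicator_def)
      finally show "(\<Sum>Q\<in>F. ennreal (A x * B x) * indicator (E Q) x) \<le> ennreal (A x * B x)" .
    qed auto
    finally show "(\<Sum>Q\<in>F. ennreal (measure lebesgue Q * LlogL_norm \<beta> f Q * avg_r r g Q))
      \<le> ennreal ?K * (\<integral>\<^sup>+x. ennreal (A x * B x) \<partial>lebesgue)" .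
  qed
  finally show ?thesis .
qed

section \<open>Replacing f by a bounded function\<close>

lemma ennreal_3_power_mult: "ennreal (3 ^ n * x) = 3 ^ n * ennreal x"
proof -
  have "ennreal (3 ^ n) = 3 ^ n" by (metis ennreal_numeral ennreal_power zero_le_numeral)
  then show ?thesis by (simp add: ennreal_mult')
qed

text \<open>A cube through \<open>x\<close> of side below \<open>l\<close> stays inside the tripled
  cube, where \<open>w\<close> vanishes, so its average is 0. A cube of side at least
  \<open>l\<close> contains \<open>y\<close> after tripling.\<close>

lemma mx_comparable:
  fixes c :: "'a::euclidean_space"
  assumes w: "bdd_nonneg w" and zero: "\<And>z. z \<in> ocube (c - l *\<^sub>R One) (3 * l) \<Longrightarrow> w z = 0"
    and x: "x \<in> hcube c l" and y: "y \<in> hcube c l"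
  shows "mx w x \<le> 3 ^ DIM('a) * mx w y"
proof (rule mx_le)
  fix c' l' assume l': "0 < l'" and xc: "x \<in> ocube c' l'"
  show "avg w c' l' \<le> 3 ^ DIM('a) * mx w y"
  proof (cases "l \<le> l'")
    case True
    have "y \<in> ocube (c' - l' *\<^sub>R One) (3 * l')"
      using x y xc True by (fastforce simp: mem_ocube hcube_def inner_simps)
    then have "avg w (c' - l' *\<^sub>R One) (3 * l') \<le> mx w y"
      using w l' by (intro avg_le_mx) auto
    then show ?thesis using avg_triple_le[OF w l', of c'] by (simp add: order_trans)
  next
    case False
    have "ocube c' l' \<subseteq> ocube (c - l *\<^sub>R One) (3 * l)"
      using x xc False by (fastforce simp: mem_ocube hcube_def inner_simps)
    then have "(\<lambda>z. w z * indicator (ocube c' l') z) = (\<lambda>z. 0)"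
      using zero by (fastforce simp: indicator_def fun_eq_iff)
    then have "avg w c' l' = 0" by (simp add: avg_def)
    then show ?thesis using mx_nonneg[OF w] by simp
  qed
qed

text \<open>This is how the mass of a stopped cube becomes an integral of
  \<open>Phi \<beta> \<bar>f\<bar>\<close>: as \<open>\<phi>\<close> has mean at least 1 on
  \<open>Q\<close>, a bound valid at every point of \<open>Q\<close> may be averaged against
  \<open>\<phi>\<close>. Here \<open>V\<close> stands for the volume of \<open>Q\<close>.\<close>

lemma le_nn_integral_of_mean:
  assumes [measurable]: "\<phi> \<in> borel_measurable M" "Q \<in> sets M"
    and V: "0 < V" "ennreal V \<le> (\<integral>\<^sup>+y. \<phi> y * indicator Q y \<partial>M)"
    and le: "\<And>y. y \<in> Q \<Longrightarrow> a \<le> ennreal V * g y"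
  shows "a \<le> (\<integral>\<^sup>+y. \<phi> y * g y * indicator Q y \<partial>M)"
proof -
  have V': "ennreal V \<noteq> 0" using V by simp
  have "a / ennreal V \<le> g y" if "y \<in> Q" for y
  proof -
    have "a / ennreal V \<le> (g y * ennreal V) / ennreal V"
      using le[OF that] by (intro divide_right_mono_ennreal) (simp add: mult.commute)
    then show ?thesis using V' by (simp add: ennreal_mult_divide_eq)
  qed
  then have *: "(a / ennreal V) * (\<phi> y * indicator Q y) \<le> \<phi> y * g y * indicator Q y" for y
    by (cases "y \<in> Q") (auto simp: mult.commute intro: mult_left_mono)
  have "a = (a * ennreal V) / ennreal V" using V' by (simp add: ennreal_mult_divide_eq)
  also have "\<dots> = (a / ennreal V) * ennreal V" by (simp add: ennreal_times_divide mult.commute)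
  also have "\<dots> \<le> (a / ennreal V) * (\<integral>\<^sup>+y. \<phi> y * indicator Q y \<partial>M)"
    using V by (intro mult_left_mono) auto
  also have "\<dots> = (\<integral>\<^sup>+y. (a / ennreal V) * (\<phi> y * indicator Q y) \<partial>M)"
    by (rule nn_integral_cmult[symmetric]) measurable
  also have "\<dots> \<le> (\<integral>\<^sup>+y. \<phi> y * g y * indicator Q y \<partial>M)"
    using * by (intro nn_integral_mono)
  finally show ?thesis .
qed

section \<open>Estimates on stopped cubes and their triples\<close>

locale stopped_cubes =
  fixes f :: "'a::euclidean_space \<Rightarrow> real" and \<beta> :: nat and T :: "('a \<times> real) set"
  assumes f: "bdd_nonneg (\<lambda>x. \<bar>f x\<bar>)" and countable_T: "countable T"
    and side_pos: "(c, l) \<in> T \<Longrightarrow> 0 < l"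
    and disjoint_T: "disjoint_family_on (\<lambda>(c, l). hcube c l) T"
    and lower: "(c, l) \<in> T \<Longrightarrow>
      ennreal (l ^ DIM('a)) \<le> (\<integral>\<^sup>+x. ennreal (Phi \<beta> \<bar>f x\<bar>) * indicator (hcube c l) x \<partial>lebesgue)"
    and upper: "(c, l) \<in> T \<Longrightarrow>
      (\<integral>\<^sup>+x. ennreal (Phi \<beta> \<bar>f x\<bar>) * indicator (hcube c l) x \<partial>lebesgue) \<le> ennreal (2 ^ DIM('a) * l ^ DIM('a))"
    and outside: "AE x in lebesgue. x \<notin> (\<Union>(c, l)\<in>T. hcube c l) \<longrightarrow> ennreal (Phi \<beta> \<bar>f x\<bar>) \<le> 1"
begin

definition Om :: "'a set" where "Om = (\<Union>(c, l)\<in>T. hcube c l)"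
definition Om3 :: "'a set" where "Om3 = (\<Union>(c, l)\<in>T. ocube (c - l *\<^sub>R One) (3 * l))"
text \<open>Outside \<open>Om\<close> the minimum changes \<open>\<bar>f x\<bar>\<close> only on a
  null set, because \<open>Phi \<beta> \<bar>f x\<bar> \<le> 1\<close> almost everywhere there; it
  makes \<open>h \<le> 1\<close> true everywhere.\<close>

definition h :: "'a \<Rightarrow> real" where "h x = (if x \<in> Om then 1 else min 1 \<bar>f x\<bar>)"

lemma measurable_f [measurable]: "(\<lambda>x. \<bar>f x\<bar>) \<in> borel_measurable lebesgue"
  using f by (rule bdd_nonneg_measurable)

lemma measurable_Phi_f [measurable]: "(\<lambda>x. Phi \<beta> \<bar>f x\<bar>) \<in> borel_measurable lebesgue"
  using bdd_nonneg_Phi[OF f] by (rule bdd_nonneg_measurable)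

lemma sets_case_hcube [measurable]: "(case p of (c, l) \<Rightarrow> hcube c l) \<in> sets lebesgue"
  by (cases p) simp

lemma sets_Om [measurable]: "Om \<in> sets lebesgue"
  unfolding Om_def using countable_T by (intro sets.countable_UN') auto

lemma sets_Om3 [measurable]: "Om3 \<in> sets lebesgue"
  unfolding Om3_def using countable_T by (intro sets.countable_UN') auto

lemma bdd_nonneg_h: "bdd_nonneg h"
proof -
  have "h = (\<lambda>x. indicator Om x + (1 - indicator Om x) * min 1 \<bar>f x\<bar>)"
    by (auto simp: h_def fun_eq_iff indicator_def)
  moreover have "(\<lambda>x. indicator Om x + (1 - indicator Om x) * min 1 \<bar>f x\<bar>) \<in> borel_measurable lebesgue"
    by measurable
  ultimately have "h \<in> borel_measurable lebesgue" by simp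
  moreover have "\<forall>x. 0 \<le> h x" "\<forall>x. h x \<le> 1" by (auto simp: h_def)
  ultimately show ?thesis unfolding bdd_nonneg_def by blast
qed

lemma hcube_subset_Om: "(c, l) \<in> T \<Longrightarrow> hcube c l \<subseteq> Om"
  by (auto simp: Om_def)

lemma AE_h_outside: "AE x in lebesgue. x \<notin> Om \<longrightarrow> h x = \<bar>f x\<bar>"
  using outside
proof eventually_elim
  case (elim x)
  show ?case
  proof
    assume "x \<notin> Om"
    then have "Phi \<beta> \<bar>f x\<bar> \<le> 1" using elim by (simp add: Om_def)
    then have "\<bar>f x\<bar> \<le> 1" using Phi_ge[of "\<bar>f x\<bar>" \<beta>] by simp
    then show "h x = \<bar>f x\<bar>" using \<open>x \<notin> Om\<close> by (simp add: h_def)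
  qed
qed

text \<open>\<open>Phi_mult\<close> splits off \<open>Phi \<beta> (1 / m)\<close>, which is exactly
  the value of the right-hand integrand's \<open>Phi\<close> factor since \<open>h = 1\<close> here.
  What remains is the mean of \<open>Phi \<beta> \<bar>f\<bar>\<close>, at most
  \<open>2 ^ DIM('a)\<close> by stopping.\<close>

lemma modular_cell:
  assumes cl: "(c, l) \<in> T" and m: "0 < m"
  shows "(\<integral>\<^sup>+x. ennreal (Phi \<beta> (\<bar>f x\<bar> / m)) * indicator (hcube c l) x \<partial>lebesgue)
    \<le> (\<integral>\<^sup>+x. (ennreal (2 ^ (\<beta> + DIM('a))) * ennreal (Phi \<beta> (h x / m))) * indicator (hcube c l) x \<partial>lebesgue)"
proof -
  let ?k = "2 ^ \<beta> * Phi \<beta> (1 / m)"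
  have k: "0 \<le> ?k" using m by (simp add: Phi_nonneg)
  have l: "0 < l" using side_pos cl .
  have "(\<integral>\<^sup>+x. ennreal (Phi \<beta> (\<bar>f x\<bar> / m)) * indicator (hcube c l) x \<partial>lebesgue)
    \<le> (\<integral>\<^sup>+x. ennreal ?k * (ennreal (Phi \<beta> \<bar>f x\<bar>) * indicator (hcube c l) x) \<partial>lebesgue)"
  proof (rule nn_integral_mono)
    fix x
    have "Phi \<beta> (\<bar>f x\<bar> * (1 / m)) \<le> 2 ^ \<beta> * (Phi \<beta> \<bar>f x\<bar> * Phi \<beta> (1 / m))"
      using m by (intro Phi_mult) auto
    then have "ennreal (Phi \<beta> (\<bar>f x\<bar> / m)) \<le> ennreal (?k * Phi \<beta> \<bar>f x\<bar>)"
      by (intro ennreal_leI) (simp add: mult_ac)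
    then show "ennreal (Phi \<beta> (\<bar>f x\<bar> / m)) * indicator (hcube c l) x
        \<le> ennreal ?k * (ennreal (Phi \<beta> \<bar>f x\<bar>) * indicator (hcube c l) x)"
      using k by (cases "x \<in> hcube c l") (auto simp: ennreal_mult')
  qed
  also have "\<dots> = ennreal ?k * (\<integral>\<^sup>+x. ennreal (Phi \<beta> \<bar>f x\<bar>) * indicator (hcube c l) x \<partial>lebesgue)"
    by (rule nn_integral_cmult) measurable
  also have "\<dots> \<le> ennreal ?k * ennreal (2 ^ DIM('a) * l ^ DIM('a))"
    using upper[OF cl] by (intro mult_left_mono) auto
  also have "\<dots> = ennreal (?k * (2 ^ DIM('a) * l ^ DIM('a)))"
    using k l by (intro ennreal_mult[symmetric]) auto
  also have "?k * (2 ^ DIM('a) * l ^ DIM('a)) = 2 ^ (\<beta> + DIM('a)) * Phi \<beta> (1 / m) * l ^ DIM('a)"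
    by (simp add: power_add)
  also have "ennreal \<dots> = ennreal (2 ^ (\<beta> + DIM('a)) * Phi \<beta> (1 / m)) * ennreal (l ^ DIM('a))"
    using m l by (intro ennreal_mult) (auto simp: Phi_nonneg)
  also have "\<dots> = ennreal (2 ^ (\<beta> + DIM('a)) * Phi \<beta> (1 / m)) * emeasure lebesgue (hcube c l)"
    using emeasure_hcube[of l c] l by (metis less_imp_le)
  also have "\<dots> = (\<integral>\<^sup>+x. ennreal (2 ^ (\<beta> + DIM('a)) * Phi \<beta> (1 / m)) * indicator (hcube c l) x \<partial>lebesgue)"
    by (rule nn_integral_cmult_indicator[symmetric]) (rule sets_hcube)
  also have "\<dots> = (\<integral>\<^sup>+x. (ennreal (2 ^ (\<beta> + DIM('a))) * ennreal (Phi \<beta> (h x / m))) * indicator (hcube c l) x \<partial>lebesgue)"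
    using hcube_subset_Om[OF cl]
    by (intro nn_integral_cong) (auto simp: indicator_def h_def ennreal_mult'[symmetric] simp del: ennreal_power)
  finally show ?thesis .
qed

text \<open>A longer stopped cube that meets the given cube would contain it in its triple, hence in
  \<open>Om3\<close>; so the stopped cubes it meets are no longer than it. On a stopped cube
  \<open>f\<close> and \<open>h\<close> are comparable only through integrals over the whole cube,
  never over a part of it. This is why the set \<open>U\<close> consists of entire stopped cubes and
  the right-hand side lives on the triple.\<close>

lemma modular_cube:
  assumes l0: "0 < l0" and Q: "\<not> cbox c0 (c0 + l0 *\<^sub>R One) \<subseteq> Om3" and m: "0 < m"
  shows "(\<integral>\<^sup>+x. ennreal (Phi \<beta> (\<bar>f x\<bar> / m)) * indicator (cbox c0 (c0 + l0 *\<^sub>R One)) x \<partial>lebesgue)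
    \<le> ennreal (2 ^ (\<beta> + DIM('a))) *
      (\<integral>\<^sup>+x. ennreal (Phi \<beta> (h x / m)) * indicator (ocube (c0 - l0 *\<^sub>R One) (3 * l0)) x \<partial>lebesgue)"
proof -
  let ?Q = "cbox c0 (c0 + l0 *\<^sub>R One)" and ?Q3 = "ocube (c0 - l0 *\<^sub>R One) (3 * l0)"
  let ?K = "ennreal (2 ^ (\<beta> + DIM('a)))"
  note [measurable] = bdd_nonneg_measurable[OF bdd_nonneg_h]
  define T0 where "T0 = {(c, l) \<in> T. hcube c l \<inter> ?Q \<noteq> {}}"
  define U where "U = (\<Union>p\<in>T0. case p of (c, l) \<Rightarrow> hcube c l)"
  have T0: "T0 \<subseteq> T" by (auto simp: T0_def)
  have cT0: "countable T0" using T0 countable_T countable_subset by blast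
  have dT0: "disjoint_family_on (\<lambda>(c, l). hcube c l) T0"
    using disjoint_family_on_mono[OF T0 disjoint_T] .
  have [measurable]: "U \<in> sets lebesgue"
    unfolding U_def using cT0 by (intro sets.countable_UN') auto
  have in_Q3: "hcube c l \<subseteq> ?Q3" if cl: "(c, l) \<in> T0" for c l
  proof -
    obtain y where y: "y \<in> hcube c l" "y \<in> ?Q" using cl by (auto simp: T0_def)
    have "l \<le> l0"
    proof (rule ccontr)
      assume "\<not> l \<le> l0"
      then have "?Q \<subseteq> ocube (c - l *\<^sub>R One) (3 * l)"
        using y by (fastforce simp: mem_ocube mem_box hcube_def inner_simps)
      then have "?Q \<subseteq> Om3" using that T0 by (auto simp: Om3_def)
      then show False using Q by simp
    qed
    then show ?thesis using y by (fastforce simp: mem_ocube mem_box hcube_def inner_simps)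
  qed
  have U: "U \<subseteq> ?Q3" "U \<subseteq> Om" "?Q \<inter> Om \<subseteq> U"
  proof -
    show "U \<subseteq> ?Q3" using in_Q3 by (fastforce simp: U_def)
    show "U \<subseteq> Om" using T0 by (auto simp: U_def Om_def)
    show "?Q \<inter> Om \<subseteq> U" by (fastforce simp: U_def Om_def T0_def)
  qed
  have QQ3: "?Q \<subseteq> ?Q3" using cube_subset_triple[OF l0] .
  have K1: "1 \<le> ?K"
    using ennreal_leI[of 1 "2 ^ (\<beta> + DIM('a))"] by (simp add: one_le_power del: ennreal_power)
  have "(\<integral>\<^sup>+x. ennreal (Phi \<beta> (\<bar>f x\<bar> / m)) * indicator ?Q x \<partial>lebesgue)
    \<le> (\<integral>\<^sup>+x. ennreal (Phi \<beta> (\<bar>f x\<bar> / m)) * indicator (?Q3 - Om) x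
        + ennreal (Phi \<beta> (\<bar>f x\<bar> / m)) * indicator U x \<partial>lebesgue)"
    using U QQ3 by (intro nn_integral_mono) (auto simp: indicator_def)
  also have "\<dots> = (\<integral>\<^sup>+x. ennreal (Phi \<beta> (\<bar>f x\<bar> / m)) * indicator (?Q3 - Om) x \<partial>lebesgue)
        + (\<integral>\<^sup>+x. ennreal (Phi \<beta> (\<bar>f x\<bar> / m)) * indicator U x \<partial>lebesgue)"
    by (rule nn_integral_add) measurable
  also have "\<dots> \<le> (\<integral>\<^sup>+x. (?K * ennreal (Phi \<beta> (h x / m))) * indicator (?Q3 - Om) x \<partial>lebesgue)
        + (\<integral>\<^sup>+x. (?K * ennreal (Phi \<beta> (h x / m))) * indicator U x \<partial>lebesgue)"
  proof (rule add_mono)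
    show "(\<integral>\<^sup>+x. ennreal (Phi \<beta> (\<bar>f x\<bar> / m)) * indicator (?Q3 - Om) x \<partial>lebesgue)
      \<le> (\<integral>\<^sup>+x. (?K * ennreal (Phi \<beta> (h x / m))) * indicator (?Q3 - Om) x \<partial>lebesgue)"
    proof (rule nn_integral_mono_AE)
      show "AE x in lebesgue. ennreal (Phi \<beta> (\<bar>f x\<bar> / m)) * indicator (?Q3 - Om) x
        \<le> (?K * ennreal (Phi \<beta> (h x / m))) * indicator (?Q3 - Om) x"
        using AE_h_outside
      proof eventually_elim
        case (elim x)
        show ?case
        proof (cases "x \<in> ?Q3 - Om")
          case True
          then have "h x = \<bar>f x\<bar>" using elim by simp
          then show ?thesis
            using True mult_right_mono[OF K1, of "ennreal (Phi \<beta> (h x / m))"] by (simp del: ennreal_power)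
        qed auto
      qed
    qed
    show "(\<integral>\<^sup>+x. ennreal (Phi \<beta> (\<bar>f x\<bar> / m)) * indicator U x \<partial>lebesgue)
      \<le> (\<integral>\<^sup>+x. (?K * ennreal (Phi \<beta> (h x / m))) * indicator U x \<partial>lebesgue)"
      unfolding U_def
    proof (rule nn_integral_UN_mono[OF cT0 dT0])
      fix p assume "p \<in> T0"
      then show "(\<integral>\<^sup>+x. ennreal (Phi \<beta> (\<bar>f x\<bar> / m)) * indicator (case p of (c, l) \<Rightarrow> hcube c l) x \<partial>lebesgue)
        \<le> (\<integral>\<^sup>+x. (?K * ennreal (Phi \<beta> (h x / m))) * indicator (case p of (c, l) \<Rightarrow> hcube c l) x \<partial>lebesgue)"
        using modular_cell[of "fst p" "snd p" m] T0 m by (cases p) auto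
    qed auto
  qed
  also have "\<dots> = (\<integral>\<^sup>+x. (?K * ennreal (Phi \<beta> (h x / m))) * indicator (?Q3 - Om) x
        + (?K * ennreal (Phi \<beta> (h x / m))) * indicator U x \<partial>lebesgue)"
    by (rule nn_integral_add[symmetric]) measurable
  also have "\<dots> \<le> (\<integral>\<^sup>+x. ?K * (ennreal (Phi \<beta> (h x / m)) * indicator ?Q3 x) \<partial>lebesgue)"
    using U by (intro nn_integral_mono) (auto simp: indicator_def simp del: ennreal_power)
  also have "\<dots> = ?K * (\<integral>\<^sup>+x. ennreal (Phi \<beta> (h x / m)) * indicator ?Q3 x \<partial>lebesgue)"
    by (rule nn_integral_cmult) measurable
  finally show ?thesis .
qed

text \<open>By Jensen, the average of \<open>w\<close> over a tripled cube is at most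
  \<open>v\<close> at every point of the triple, in particular throughout the stopped cube.
  Averaging this against \<open>Phi \<beta> \<bar>f\<bar>\<close> moves the mass to the stopped cube
  itself. Overlaps of the triples are harmless, since the resulting integrals are over disjoint
  sets.\<close>

lemma nn_integral_Om3_le:
  assumes w: "bdd_nonneg w" and t: "1 \<le> t"
  defines "v \<equiv> \<lambda>x. mx (\<lambda>y. w y powr t) x powr (1 / t)"
  shows "(\<integral>\<^sup>+x. ennreal (w x) * indicator Om3 x \<partial>lebesgue)
    \<le> 3 ^ DIM('a) * (\<integral>\<^sup>+x. ennreal (Phi \<beta> \<bar>f x\<bar>) * ennreal (v x) \<partial>lebesgue)"
proof -
  note [measurable] = bdd_nonneg_measurable[OF w]
  have wt: "bdd_nonneg (\<lambda>y. w y powr t)" using t by (intro bdd_nonneg_powr w) auto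
  have v: "bdd_nonneg v" unfolding v_def using t by (intro bdd_nonneg_powr bdd_nonneg_mx wt) auto
  note [measurable] = bdd_nonneg_measurable[OF v]
  let ?g = "\<lambda>p x. case p of (c, l) \<Rightarrow> ennreal (w x) * indicator (ocube (c - l *\<^sub>R One) (3 * l)) x"
  have meas: "?g p \<in> borel_measurable lebesgue" for p
    by (cases p) simp
  have "(\<integral>\<^sup>+x. ennreal (w x) * indicator Om3 x \<partial>lebesgue) \<le> (\<integral>\<^sup>+x. \<integral>\<^sup>+p. ?g p x \<partial>count_space T \<partial>lebesgue)"
  proof (rule nn_integral_mono)
    fix x
    show "ennreal (w x) * indicator Om3 x \<le> (\<integral>\<^sup>+p. ?g p x \<partial>count_space T)"
    proof (cases "x \<in> Om3")
      case True
      then obtain c l where cl: "(c, l) \<in> T" "x \<in> ocube (c - l *\<^sub>R One) (3 * l)" by (auto simp: Om3_def)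
      have "ennreal (w x) * indicator Om3 x = ?g (c, l) x" using True cl by simp
      also have "\<dots> \<le> (\<integral>\<^sup>+p. ?g p x \<partial>count_space T)"
        using cl(1) by (rule nn_integral_ge_point)
      finally show ?thesis .
    qed auto
  qed
  also have "\<dots> = (\<integral>\<^sup>+p. \<integral>\<^sup>+x. ?g p x \<partial>lebesgue \<partial>count_space T)"
    using countable_T meas by (rule nn_integral_count_space_nn_integral)
  also have "\<dots> \<le> (\<integral>\<^sup>+p. (\<integral>\<^sup>+x. (3 ^ DIM('a) * (ennreal (Phi \<beta> \<bar>f x\<bar>) * ennreal (v x))) * indicator (case p of (c, l) \<Rightarrow> hcube c l) x \<partial>lebesgue) \<partial>count_space T)"
  proof (rule nn_integral_mono)
    fix p assume "p \<in> space (count_space T)"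
    then obtain c l where p: "p = (c, l)" "(c, l) \<in> T" by (cases p) auto
    then have l: "0 < l" using side_pos by blast
    have "(\<integral>\<^sup>+x. ?g p x \<partial>lebesgue) = ennreal (avg w (c - l *\<^sub>R One) (3 * l) * (3 * l) ^ DIM('a))"
      using p l nn_integral_ocube[OF w, of "3 * l" "c - l *\<^sub>R One"] by simp
    also have "\<dots> \<le> (\<integral>\<^sup>+x. ennreal (Phi \<beta> \<bar>f x\<bar>) * ennreal (3 ^ DIM('a) * v x) * indicator (hcube c l) x \<partial>lebesgue)"
    proof (rule le_nn_integral_of_mean[of _ _ _ "l ^ DIM('a)"])
      fix y assume "y \<in> hcube c l"
      then have y: "y \<in> ocube (c - l *\<^sub>R One) (3 * l)" using hcube_subset_triple[OF l] by blast
      have "avg w (c - l *\<^sub>R One) (3 * l) \<le> avg (\<lambda>y. w y powr t) (c - l *\<^sub>R One) (3 * l) powr (1 / t)"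
        using l t by (intro avg_Jensen w) auto
      also have "\<dots> \<le> v y"
        unfolding v_def using l t y wt by (intro powr_mono2 avg_le_mx avg_nonneg) auto
      finally have "avg w (c - l *\<^sub>R One) (3 * l) * (3 * l) ^ DIM('a) \<le> v y * (3 * l) ^ DIM('a)"
        using l by (intro mult_right_mono) auto
      then have "ennreal (avg w (c - l *\<^sub>R One) (3 * l) * (3 * l) ^ DIM('a)) \<le> ennreal (l ^ DIM('a) * (3 ^ DIM('a) * v y))"
        by (intro ennreal_leI) (simp add: power_mult_distrib mult_ac)
      then show "ennreal (avg w (c - l *\<^sub>R One) (3 * l) * (3 * l) ^ DIM('a)) \<le> ennreal (l ^ DIM('a)) * ennreal (3 ^ DIM('a) * v y)"
        using l bdd_nonneg_ge0[OF v] by (subst ennreal_mult[symmetric]) auto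
    qed (use l lower[OF p(2)] in auto)
    also have "\<dots> = (\<integral>\<^sup>+x. (3 ^ DIM('a) * (ennreal (Phi \<beta> \<bar>f x\<bar>) * ennreal (v x))) * indicator (hcube c l) x \<partial>lebesgue)"
      by (intro nn_integral_cong) (simp only: ennreal_3_power_mult, simp only: mult_ac)
    finally show "(\<integral>\<^sup>+x. ?g p x \<partial>lebesgue) \<le> (\<integral>\<^sup>+x. (3 ^ DIM('a) * (ennreal (Phi \<beta> \<bar>f x\<bar>) * ennreal (v x))) * indicator (case p of (c, l) \<Rightarrow> hcube c l) x \<partial>lebesgue)"
      using p by simp
  qed
  also have "\<dots> = (\<integral>\<^sup>+x. (3 ^ DIM('a) * (ennreal (Phi \<beta> \<bar>f x\<bar>) * ennreal (v x))) * indicator (\<Union>p\<in>T. case p of (c, l) \<Rightarrow> hcube c l) x \<partial>lebesgue)"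
    using countable_T disjoint_T by (intro nn_integral_UN_countable[symmetric]) auto
  also have "\<dots> \<le> (\<integral>\<^sup>+x. 3 ^ DIM('a) * (ennreal (Phi \<beta> \<bar>f x\<bar>) * ennreal (v x)) \<partial>lebesgue)"
    by (intro nn_integral_mono) (auto simp: indicator_def)
  also have "\<dots> = 3 ^ DIM('a) * (\<integral>\<^sup>+x. ennreal (Phi \<beta> \<bar>f x\<bar>) * ennreal (v x) \<partial>lebesgue)"
    by (rule nn_integral_cmult) measurable
  finally show ?thesis .
qed

text \<open>On a stopped cube \<open>h = 1\<close> and, as \<open>w\<close> vanishes on its triple,
  \<open>mx_comparable\<close> lets \<open>v x\<close> be replaced by \<open>v y\<close> for any
  other point \<open>y\<close> of it; averaging in \<open>y\<close> brings in
  \<open>Phi \<beta> \<bar>f\<bar>\<close>. Elsewhere \<open>h \<le> 1\<close> gives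
  \<open>h powr p \<le> h \<le> Phi \<beta> \<bar>f\<bar>\<close>.\<close>

lemma nn_integral_h_le:
  assumes w: "bdd_nonneg w" and t: "1 \<le> t" and p: "1 \<le> p" and zero: "\<And>x. x \<in> Om3 \<Longrightarrow> w x = 0"
  defines "v \<equiv> \<lambda>x. mx (\<lambda>y. w y powr t) x powr (1 / t)"
  shows "(\<integral>\<^sup>+x. ennreal (h x powr p * v x) \<partial>lebesgue)
    \<le> 3 ^ DIM('a) * (\<integral>\<^sup>+x. ennreal (Phi \<beta> \<bar>f x\<bar>) * ennreal (v x) \<partial>lebesgue)"
proof -
  have wt: "bdd_nonneg (\<lambda>y. w y powr t)" using t by (intro bdd_nonneg_powr w) auto
  have v: "bdd_nonneg v" unfolding v_def using t by (intro bdd_nonneg_powr bdd_nonneg_mx wt) auto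
  note [measurable] = bdd_nonneg_measurable[OF v] bdd_nonneg_measurable[OF bdd_nonneg_h]
  let ?R = "\<lambda>x. 3 ^ DIM('a) * (ennreal (Phi \<beta> \<bar>f x\<bar>) * ennreal (v x))"
  have v0: "0 \<le> v x" for x using v by (simp add: bdd_nonneg_def)
  have "(\<integral>\<^sup>+x. ennreal (h x powr p * v x) \<partial>lebesgue)
    = (\<integral>\<^sup>+x. ennreal (h x powr p * v x) * indicator Om x + ennreal (h x powr p * v x) * indicator (- Om) x \<partial>lebesgue)"
    by (intro nn_integral_cong) (auto simp: indicator_def)
  also have "\<dots> = (\<integral>\<^sup>+x. ennreal (h x powr p * v x) * indicator Om x \<partial>lebesgue)
      + (\<integral>\<^sup>+x. ennreal (h x powr p * v x) * indicator (- Om) x \<partial>lebesgue)"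
    by (rule nn_integral_add) (auto simp: Compl_in_sets_lebesgue)
  also have "\<dots> \<le> (\<integral>\<^sup>+x. ?R x * indicator Om x \<partial>lebesgue) + (\<integral>\<^sup>+x. ?R x * indicator (- Om) x \<partial>lebesgue)"
  proof (rule add_mono)
    show "(\<integral>\<^sup>+x. ennreal (h x powr p * v x) * indicator Om x \<partial>lebesgue) \<le> (\<integral>\<^sup>+x. ?R x * indicator Om x \<partial>lebesgue)"
      unfolding Om_def
    proof (rule nn_integral_UN_mono[OF countable_T disjoint_T])
      fix q assume "q \<in> T"
      then obtain c l where q: "q = (c, l)" "(c, l) \<in> T" by (cases q) auto
      have l: "0 < l" using side_pos q by blast
      let ?I = "\<integral>\<^sup>+x. ennreal (h x powr p * v x) * indicator (hcube c l) x \<partial>lebesgue"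
      have "?I \<le> (\<integral>\<^sup>+x. ennreal (Phi \<beta> \<bar>f x\<bar>) * ennreal (3 ^ DIM('a) * v x) * indicator (hcube c l) x \<partial>lebesgue)"
      proof (rule le_nn_integral_of_mean[of _ _ _ "l ^ DIM('a)"])
        fix y assume y: "y \<in> hcube c l"
        have "?I \<le> (\<integral>\<^sup>+x. ennreal (3 ^ DIM('a) * v y) * indicator (hcube c l) x \<partial>lebesgue)"
        proof (rule nn_integral_mono)
          fix x
          show "ennreal (h x powr p * v x) * indicator (hcube c l) x \<le> ennreal (3 ^ DIM('a) * v y) * indicator (hcube c l) x"
          proof (cases "x \<in> hcube c l")
            case True
            have "mx (\<lambda>y. w y powr t) x \<le> 3 ^ DIM('a) * mx (\<lambda>y. w y powr t) y"
              using wt _ True y by (rule mx_comparable) (use zero q in \<open>auto simp: Om3_def\<close>)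
            then have "v x \<le> (3 ^ DIM('a) * mx (\<lambda>y. w y powr t) y) powr (1 / t)"
              unfolding v_def using t mx_nonneg[OF wt] by (intro powr_mono2) auto
            also have "\<dots> = (3 ^ DIM('a)) powr (1 / t) * v y" by (simp add: powr_mult v_def)
            also have "\<dots> \<le> 3 ^ DIM('a) * v y"
            proof (rule mult_right_mono)
              have "(3 ^ DIM('a)) powr (1 / t) \<le> (3 ^ DIM('a) :: real) powr 1"
                using t by (intro powr_mono) auto
              then show "(3 ^ DIM('a)) powr (1 / t) \<le> (3 ^ DIM('a) :: real)" by simp
            qed (rule v0)
            finally have "v x \<le> 3 ^ DIM('a) * v y" .
            moreover have "h x = 1" using True hcube_subset_Om[OF q(2)] by (auto simp: h_def)
            ultimately show ?thesis using True by (simp add: ennreal_leI)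
          qed auto
        qed
        also have "\<dots> = ennreal (3 ^ DIM('a) * v y) * emeasure lebesgue (hcube c l)"
          by (rule nn_integral_cmult_indicator) (rule sets_hcube)
        also have "\<dots> = ennreal (l ^ DIM('a)) * ennreal (3 ^ DIM('a) * v y)"
          using l emeasure_hcube[of l c] by (metis less_imp_le mult.commute)
        finally show "?I \<le> ennreal (l ^ DIM('a)) * ennreal (3 ^ DIM('a) * v y)" .
      qed (use l lower[OF q(2)] in auto)
      also have "\<dots> = (\<integral>\<^sup>+x. ?R x * indicator (hcube c l) x \<partial>lebesgue)"
        by (intro nn_integral_cong) (simp only: ennreal_3_power_mult, simp only: mult_ac)
      finally show "(\<integral>\<^sup>+x. ennreal (h x powr p * v x) * indicator (case q of (c, l) \<Rightarrow> hcube c l) x \<partial>lebesgue)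
        \<le> (\<integral>\<^sup>+x. ?R x * indicator (case q of (c, l) \<Rightarrow> hcube c l) x \<partial>lebesgue)"
        using q by simp
    qed auto
    show "(\<integral>\<^sup>+x. ennreal (h x powr p * v x) * indicator (- Om) x \<partial>lebesgue) \<le> (\<integral>\<^sup>+x. ?R x * indicator (- Om) x \<partial>lebesgue)"
    proof (rule nn_integral_mono)
      fix x
      show "ennreal (h x powr p * v x) * indicator (- Om) x \<le> ?R x * indicator (- Om) x"
      proof (cases "x \<in> Om")
        case False
        have hx: "0 \<le> h x" "h x \<le> 1" "h x \<le> \<bar>f x\<bar>" using False by (auto simp: h_def)
        have "h x powr p \<le> h x powr 1" using hx p by (intro powr_mono') auto
        also have "\<dots> \<le> Phi \<beta> \<bar>f x\<bar>" using hx Phi_ge[of "\<bar>f x\<bar>" \<beta>] by simp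
        finally have "h x powr p * v x \<le> Phi \<beta> \<bar>f x\<bar> * v x" using v0 by (intro mult_right_mono)
        also have "\<dots> \<le> 3 ^ DIM('a) * (Phi \<beta> \<bar>f x\<bar> * v x)"
          using v0[of x] Phi_nonneg[of "\<bar>f x\<bar>" \<beta>] mult_right_mono[of 1 "3 ^ DIM('a)" "Phi \<beta> \<bar>f x\<bar> * v x"]
          by simp
        finally have "ennreal (h x powr p * v x) \<le> ennreal (3 ^ DIM('a) * (Phi \<beta> \<bar>f x\<bar> * v x))"
          by (rule ennreal_leI)
        also have "\<dots> = ?R x"
          unfolding ennreal_3_power_mult using v0 by (simp only: ennreal_mult'')
        finally show ?thesis using False by simp
      qed auto
    qed
  qed
  also have "\<dots> = (\<integral>\<^sup>+x. ?R x * indicator Om x + ?R x * indicator (- Om) x \<partial>lebesgue)"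
    by (rule nn_integral_add[symmetric]) (auto simp: Compl_in_sets_lebesgue)
  also have "\<dots> = (\<integral>\<^sup>+x. ?R x \<partial>lebesgue)"
    by (intro nn_integral_cong) (auto simp: indicator_def)
  also have "\<dots> = 3 ^ DIM('a) * (\<integral>\<^sup>+x. ennreal (Phi \<beta> \<bar>f x\<bar>) * ennreal (v x) \<partial>lebesgue)"
    by (rule nn_integral_cmult) measurable
  finally show ?thesis .
qed

end

section \<open>The weak type estimate\<close>

lemma exponent_identities:
  fixes p r t :: real
  assumes p: "1 < p" and r: "1 \<le> r" and t: "1 \<le> t" and qr: "r < conj_exp p"
    and tau: "1 < t * (conj_exp p / r - 1) / (conj_exp p - 1)"
  defines "k \<equiv> conj_exp p * (1 / r - 1 / (p * t))"
  shows "1 < k" "k \<le> conj_exp p"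
    "conj_exp k \<le> conj_exp (conj_exp p / r) * conj_exp (t * (conj_exp p / r - 1) / (conj_exp p - 1))"
proof -
  define P where "P = conj_exp p"
  define q where "q = P / r"
  define \<tau> where "\<tau> = t * (q - 1) / (P - 1)"
  have P: "P = p / (p - 1)" "1 < P" using p by (auto simp: P_def conj_exp_def)
  have q: "1 < q" "q \<le> P"
  proof -
    show "1 < q" using qr r by (simp add: q_def P_def[symmetric])
    show "q \<le> P" using r P divide_left_mono[of 1 r P] by (simp add: q_def)
  qed
  have tau': "1 < \<tau>" using tau by (simp add: \<tau>_def q_def P_def)
  have "P / p = P - 1" using p P(1) by (simp add: field_simps)
  then have "P / (p * t) = (P - 1) / t" by (metis divide_divide_eq_left)
  then have "k = q - (P - 1) / t"
    unfolding k_def P_def[symmetric] by (simp add: q_def right_diff_distrib)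
  also have "(P - 1) / t = (q - 1) / \<tau>" using q t P(2) by (simp add: \<tau>_def)
  finally have k: "k = q - (q - 1) / \<tau>" .
  \<comment> \<open>With \<open>q = P / r\<close>, this factorisation shows that the hypothesis
    \<open>\<tau> > 1\<close> amounts to \<open>k > 1\<close>. It also yields the product of
    conjugate exponents, once the numerator \<open>k\<close> of \<open>conj_exp k\<close> is bounded
    by \<open>q\<close>.\<close>
  have k1: "k - 1 = (q - 1) * (\<tau> - 1) / \<tau>" using tau' by (simp add: k field_simps)
  have pos: "0 < (q - 1) * (\<tau> - 1) / \<tau>" using q tau' by simp
  then show k0: "1 < k" using k1 by linarith
  have "k \<le> q" unfolding k using q tau' by simp
  then show "k \<le> conj_exp p" using q by (simp add: P_def)
  have "conj_exp k = k / ((q - 1) * (\<tau> - 1) / \<tau>)" by (simp add: conj_exp_def k1)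
  also have "\<dots> \<le> q / ((q - 1) * (\<tau> - 1) / \<tau>)"
    using pos \<open>k \<le> q\<close> by (intro divide_right_mono) auto
  also have "\<dots> = conj_exp q * conj_exp \<tau>" by (simp add: conj_exp_def)
  finally show "conj_exp k \<le> conj_exp (conj_exp p / r) * conj_exp (t * (conj_exp p / r - 1) / (conj_exp p - 1))"
    by (simp add: q_def \<tau>_def P_def)
qed

text \<open>The scale \<open>\<alpha> = y powr (1 / P)\<close> with \<open>y = 2 * M * c2\<close>
  turns the last term into \<open>W / 2\<close>, which can be subtracted because \<open>W\<close> is
  a real number. Then \<open>\<alpha> powr p = y powr (p - 1)\<close>, as
  \<open>p / P = p - 1\<close>. The case \<open>M = 0\<close> is separate since \<open>y\<close>
  must be positive.\<close>

lemma absorb: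
  fixes p P M c1 c2 J W :: real
  assumes p: "1 < p" and P: "P = conj_exp p" and "0 \<le> M" "0 \<le> c1" "0 < c2" "0 \<le> J" "0 \<le> W"
    and le: "\<And>\<alpha>. 0 < \<alpha> \<Longrightarrow> W \<le> M * (\<alpha> powr p * (c1 * J) + \<alpha> powr (- P) * (c2 * W))"
  shows "W \<le> (2 * M) * (2 * M * c2) powr (p - 1) * (c1 * J)"
proof (cases "M = 0")
  case True
  then show ?thesis using le[of 1] by simp
next
  case False
  then have M: "0 < M" using assms by simp
  define y where "y = 2 * M * c2"
  have y: "0 < y" using M assms by (simp add: y_def)
  have P1: "P = p / (p - 1)" "P \<noteq> 0" using p by (auto simp: P conj_exp_def)
  have e: "1 / P * p = p - 1" using p by (simp add: P1(1))
  have "W \<le> M * ((y powr (1 / P)) powr p * (c1 * J) + (y powr (1 / P)) powr (- P) * (c2 * W))"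
    using y by (intro le) auto
  also have "(y powr (1 / P)) powr (- P) = 1 / y" using y P1 by (simp add: powr_powr powr_minus_divide)
  also have "(y powr (1 / P)) powr p = y powr (p - 1)" by (simp only: powr_powr e)
  also have "M * (y powr (p - 1) * (c1 * J) + 1 / y * (c2 * W)) = M * y powr (p - 1) * (c1 * J) + W / 2"
    using M assms by (simp add: y_def field_simps)
  finally show ?thesis by (simp add: y_def)
qed

text \<open>\<open>p \<le> 2\<close> makes the \<open>p\<close>-th powers of the fixed constants
  harmless. The factor \<open>2 powr P\<close>, unbounded as \<open>p\<close> tends to 1, becomes
  \<open>2 powr p \<le> 4\<close>; with the 8 in the bound for \<open>c1\<close> this gives 32.
  \<open>R powr (p - 1)\<close> is exactly the \<open>p\<close>-th power of
  \<open>R powr (1 / P)\<close>, whereas \<open>Q\<close> and the single \<open>P\<close> from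
  \<open>c1\<close> are raised to the power \<open>p\<close> because they are at least 1.\<close>

lemma constant_bound:
  fixes p P M D C3 c1 c2 Q R :: real and n \<beta> :: nat
  assumes p: "1 < p" "p \<le> 2" and P: "P = conj_exp p" and D: "0 \<le> D" and C3: "1 \<le> C3"
    and M: "0 \<le> M" "M \<le> D * C3 * P ^ \<beta>"
    and c2: "0 \<le> c2" "c2 \<le> 3 ^ n * 2 powr P * (Q * R)" and c1: "0 \<le> c1" "c1 \<le> 8 * 3 ^ n * P"
    and Q: "1 \<le> Q" and R: "1 \<le> R"
  shows "(2 * M) * (2 * M * c2) powr (p - 1) * c1
    \<le> (2 * C3)\<^sup>2 * 9 ^ n * 32 * (D * P ^ (1 + \<beta>) * Q * R powr (1 / P)) powr p"
proof -
  have P1: "P = p / (p - 1)" "1 < P" using p by (auto simp: P conj_exp_def)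
  have e: "P * (p - 1) = p" "1 / P * p = p - 1" using p by (auto simp: P1(1))
  define N where "N = 2 * D * C3 * P ^ \<beta>"
  have N0: "0 \<le> N" using D C3 P1 by (simp add: N_def)
  have "(2 * M) * (2 * M * c2) powr (p - 1) * c1
    \<le> N * (N * (3 ^ n * 2 powr P * (Q * R))) powr (p - 1) * (8 * 3 ^ n * P)"
    using assms N0 P1 by (intro mult_mono powr_mono2) (auto simp: N_def)
  also have "\<dots> = (N * N powr (p - 1)) * ((3 ^ n) powr (p - 1) * (2 powr P) powr (p - 1) * (Q powr (p - 1) * R powr (p - 1)) * (8 * 3 ^ n * P))"
    by (simp only: powr_mult mult_ac)
  also have "N * N powr (p - 1) = N powr p" using N0 by (simp add: powr_mult_base)
  also have "(2 powr P) powr (p - 1) = 2 powr p" by (simp only: powr_powr e)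
  also have "R powr (p - 1) = (R powr (1 / P)) powr p" by (simp only: powr_powr e)
  also have "N powr p = (2 * C3) powr p * (D * P ^ \<beta>) powr p"
    by (simp add: N_def powr_mult)
  also have "(2 * C3) powr p * (D * P ^ \<beta>) powr p * ((3 ^ n) powr (p - 1) * 2 powr p * (Q powr (p - 1) * (R powr (1 / P)) powr p) * (8 * 3 ^ n * P))
    \<le> (2 * C3)\<^sup>2 * (D * P ^ \<beta>) powr p * (3 ^ n * 4 * (Q powr p * (R powr (1 / P)) powr p) * (8 * 3 ^ n * P powr p))"
  proof -
    have "(2 * C3) powr p \<le> (2 * C3) powr 2" using C3 p by (intro powr_mono) auto
    then have 1: "(2 * C3) powr p \<le> (2 * C3)\<^sup>2" using C3 by simp
    have "(3 ^ n) powr (p - 1) \<le> (3 ^ n :: real) powr 1" using p by (intro powr_mono) auto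
    then have 2: "(3 ^ n) powr (p - 1) \<le> (3 ^ n :: real)" by simp
    have "2 powr p \<le> (2::real) powr 2" using p by (intro powr_mono) auto
    then have 3: "2 powr p \<le> (4::real)" by simp
    have 4: "Q powr (p - 1) \<le> Q powr p" using Q by (intro powr_mono) auto
    have "P powr 1 \<le> P powr p" using P1 p by (intro powr_mono) auto
    then have 5: "P \<le> P powr p" using P1(2) by simp
    show ?thesis using P1(2) C3 by (intro mult_mono 1 2 3 4 5 order_refl) auto
  qed
  also have "\<dots> = (2 * C3)\<^sup>2 * 9 ^ n * 32 * (D * P ^ (1 + \<beta>) * Q * R powr (1 / P)) powr p"
  proof -
    have "(D * P ^ (1 + \<beta>) * Q * R powr (1 / P)) powr p
      = (D * P ^ \<beta>) powr p * P powr p * Q powr p * (R powr (1 / P)) powr p"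
      by (simp add: powr_mult)
    moreover have "(9::real) ^ n = 3 ^ n * 3 ^ n" by (simp add: power_mult_distrib[symmetric])
    ultimately show ?thesis by simp
  qed
  finally show ?thesis .
qed

text \<open>The scale \<open>\<alpha>\<close> is left free for \<open>absorb\<close> to
  choose.\<close>

lemma Young_nn_integral:
  assumes [measurable]: "A \<in> borel_measurable M" "B \<in> borel_measurable M"
    and nn: "\<And>x. 0 \<le> A x" "\<And>x. 0 \<le> B x" and p: "1 < p" and a: "0 < \<alpha>"
  shows "(\<integral>\<^sup>+x. ennreal (A x * B x) \<partial>M) \<le> ennreal (\<alpha> powr p) * (\<integral>\<^sup>+x. ennreal (A x powr p) \<partial>M)
    + ennreal (\<alpha> powr (- conj_exp p)) * (\<integral>\<^sup>+x. ennreal (B x powr conj_exp p) \<partial>M)"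
proof -
  define P where "P = conj_exp p"
  have P: "1 < P" "1 / p + 1 / P = 1" using p by (auto simp: P_def conj_exp_def field_simps)
  have "(\<integral>\<^sup>+x. ennreal (A x * B x) \<partial>M)
    \<le> (\<integral>\<^sup>+x. ennreal (\<alpha> powr p) * ennreal (A x powr p) + ennreal (\<alpha> powr (- P)) * ennreal (B x powr P) \<partial>M)"
  proof (rule nn_integral_mono)
    fix x
    have "A x * B x = (\<alpha> * A x) * (B x / \<alpha>)" using a by simp
    also have "\<dots> \<le> (\<alpha> * A x) powr p / p + (B x / \<alpha>) powr P / P"
      using p P a nn by (intro Youngs_inequality) auto
    also have "\<dots> \<le> (\<alpha> * A x) powr p + (B x / \<alpha>) powr P"
      using p P divide_left_mono[of 1 p "(\<alpha> * A x) powr p"] divide_left_mono[of 1 P "(B x / \<alpha>) powr P"]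
      by (intro add_mono) auto
    also have "\<dots> = \<alpha> powr p * A x powr p + \<alpha> powr (- P) * B x powr P"
      by (simp add: powr_mult powr_divide powr_minus_divide)
    finally have "ennreal (A x * B x) \<le> ennreal (\<alpha> powr p * A x powr p + \<alpha> powr (- P) * B x powr P)"
      by (rule ennreal_leI)
    then show "ennreal (A x * B x) \<le> ennreal (\<alpha> powr p) * ennreal (A x powr p) + ennreal (\<alpha> powr (- P)) * ennreal (B x powr P)"
      by (simp add: ennreal_mult'[symmetric])
  qed
  also have "\<dots> = ennreal (\<alpha> powr p) * (\<integral>\<^sup>+x. ennreal (A x powr p) \<partial>M) + ennreal (\<alpha> powr (- P)) * (\<integral>\<^sup>+x. ennreal (B x powr P) \<partial>M)"
    by (subst nn_integral_add) (auto simp: nn_integral_cmult)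
  finally show ?thesis by (simp add: P_def)
qed

section \<open>Comparison with \<open>maxop\<close>, and integrability\<close>

lemma mx_le_maxop:
  assumes g: "bdd_nonneg g" and le: "\<And>y. g y \<le> \<bar>G y\<bar>"
  shows "ennreal (mx g x) \<le> maxop G (x::'a::euclidean_space)"
proof (cases "maxop G x")
  case (real m)
  have "mx g x \<le> m"
  proof (rule mx_le)
    fix c l assume l: "0 < l" and x: "x \<in> ocube c l"
    let ?Q = "cbox c (c + l *\<^sub>R One)"
    have sub: "ocube c l \<subseteq> ?Q" unfolding ocube_def by (rule box_subset_cbox)
    have "ennreal (avg g c l * l ^ DIM('a)) = (\<integral>\<^sup>+y. ennreal (g y) * indicator (ocube c l) y \<partial>lebesgue)"
      using nn_integral_ocube[OF g l] by simp
    also have "\<dots> \<le> (\<integral>\<^sup>+y. ennreal \<bar>G y\<bar> * indicator ?Q y \<partial>lebesgue)"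
      using sub le by (intro nn_integral_mono mult_mono ennreal_leI) (auto simp: indicator_def)
    finally have "ennreal (avg g c l * l ^ DIM('a)) / ennreal (l ^ DIM('a))
      \<le> (\<integral>\<^sup>+y. ennreal \<bar>G y\<bar> * indicator ?Q y \<partial>lebesgue) / ennreal (l ^ DIM('a))"
      by (rule divide_right_mono_ennreal)
    also have "\<dots> = (\<integral>\<^sup>+y. ennreal \<bar>G y\<bar> * indicator ?Q y \<partial>lebesgue) / ennreal (measure lebesgue ?Q)"
      using measure_cube[of l c] l by simp
    also have "\<dots> \<le> maxop G x"
      unfolding maxop_def using x sub l by (intro SUP_upper) (auto simp: is_cube_def)
    finally have "ennreal (avg g c l) \<le> ennreal m"
      using l avg_nonneg[OF g l, of c] real by (simp add: divide_ennreal)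
    then show "avg g c l \<le> m" using real by simp
  qed
  then show ?thesis using real by (simp add: ennreal_leI)
qed auto

lemma mx_powr_le_maxop_t:
  assumes w: "bdd_nonneg w" and le: "\<And>y. w y \<le> u y" and t: "1 \<le> t"
  shows "ennreal (mx (\<lambda>y. w y powr t) x powr (1 / t)) \<le> maxop_t t u (x::'a::euclidean_space)"
proof -
  have wt: "bdd_nonneg (\<lambda>y. w y powr t)" using t by (intro bdd_nonneg_powr w) auto
  have "w y powr t \<le> \<bar>\<bar>u y\<bar> powr t\<bar>" for y
  proof -
    have "w y powr t \<le> \<bar>u y\<bar> powr t"
      using le[of y] bdd_nonneg_ge0[OF w, of y] t by (intro powr_mono2) auto
    then show ?thesis by simp
  qed
  then have *: "ennreal (mx (\<lambda>y. w y powr t) x) \<le> maxop (\<lambda>y. \<bar>u y\<bar> powr t) x"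
    by (intro mx_le_maxop wt)
  show ?thesis
  proof (cases "maxop (\<lambda>y. \<bar>u y\<bar> powr t) x")
    case (real m)
    then have "mx (\<lambda>y. w y powr t) x \<le> m" using * by simp
    then have "mx (\<lambda>y. w y powr t) x powr (1 / t) \<le> m powr (1 / t)"
      using t mx_nonneg[OF wt] by (intro powr_mono2) auto
    then show ?thesis using real by (simp add: maxop_t_def Let_def ennreal_leI)
  qed (simp add: maxop_t_def Let_def)
qed

lemma bdd_nonneg_nn_integral_finite:
  assumes "bdd_nonneg g" "A \<in> sets lebesgue" "emeasure lebesgue A < \<infinity>"
  shows "(\<integral>\<^sup>+x. ennreal (g x) * indicator A x \<partial>lebesgue) < \<infinity>"
proof -
  have "(\<integral>\<^sup>+x. ennreal (g x) * indicator A x \<partial>lebesgue) = (\<integral>\<^sup>+x. ennreal (g x * indicator A x) \<partial>lebesgue)"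
    by (intro nn_integral_cong) (auto simp: indicator_def)
  also have "\<dots> < \<infinity>"
    using integrable_on_fmeasurable[OF assms] assms(1)
    by (subst nn_integral_eq_integral) (auto simp: bdd_nonneg_def)
  finally show ?thesis .
qed

lemma emeasure_compact_finite: "compact K \<Longrightarrow> emeasure lebesgue K < \<infinity>"
  using fmeasurableD2[OF lmeasurable_compact, of K] by (simp add: less_top)

text \<open>Places \<open>f\<close> in the domain on which \<open>sublinear_op\<close> makes
  \<open>U f\<close> measurable.\<close>

lemma in_Lp_of_bdd_cpt_supp:
  assumes "bdd_cpt_supp f"
  shows "in_Lp 1 f"
proof -
  obtain K where K: "compact K" "\<And>x. x \<notin> K \<Longrightarrow> f x = 0" using assms by (auto simp: bdd_cpt_supp_def)
  have [measurable]: "f \<in> borel_measurable lebesgue" using assms by (simp add: bdd_cpt_supp_def)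
  obtain B where "\<And>x. \<bar>f x\<bar> \<le> B" using assms by (auto simp: bdd_cpt_supp_def bounded_iff)
  then have f: "bdd_nonneg (\<lambda>x. \<bar>f x\<bar>)" by (auto simp: bdd_nonneg_def)
  have "(\<integral>\<^sup>+x. ennreal (\<bar>f x\<bar> powr 1) \<partial>lebesgue) = (\<integral>\<^sup>+x. ennreal \<bar>f x\<bar> * indicator K x \<partial>lebesgue)"
    using K by (intro nn_integral_cong) (auto simp: indicator_def)
  also have "\<dots> < \<infinity>"
    using K by (intro bdd_nonneg_nn_integral_finite f emeasure_compact_finite lmeasurable_compact fmeasurableD)
  finally show ?thesis by (simp add: in_Lp_def)
qed

lemma ex_stopped_cubes:
  assumes f: "bdd_cpt_supp f"
  shows "\<exists>T. stopped_cubes f \<beta> T"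
proof -
  obtain K where K: "compact K" "\<And>x. x \<notin> K \<Longrightarrow> f x = 0" using f by (auto simp: bdd_cpt_supp_def)
  have [measurable]: "f \<in> borel_measurable lebesgue" using f by (simp add: bdd_cpt_supp_def)
  obtain B where "\<And>x. \<bar>f x\<bar> \<le> B" using f by (auto simp: bdd_cpt_supp_def bounded_iff)
  then have bf: "bdd_nonneg (\<lambda>x. \<bar>f x\<bar>)" by (auto simp: bdd_nonneg_def)
  note Phi_f = bdd_nonneg_Phi[OF bf, of \<beta>]
  note [measurable] = bdd_nonneg_measurable[OF Phi_f]
  have "(\<integral>\<^sup>+x. ennreal (Phi \<beta> \<bar>f x\<bar>) \<partial>lebesgue) = (\<integral>\<^sup>+x. ennreal (Phi \<beta> \<bar>f x\<bar>) * indicator K x \<partial>lebesgue)"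
    using K by (intro nn_integral_cong) (auto simp: indicator_def Phi_def)
  also have "\<dots> < \<infinity>"
    using K by (intro bdd_nonneg_nn_integral_finite Phi_f emeasure_compact_finite lmeasurable_compact fmeasurableD)
  finally have fin: "(\<integral>\<^sup>+x. ennreal (Phi \<beta> \<bar>f x\<bar>) \<partial>lebesgue) < \<infinity>" .
  have "(\<lambda>x. ennreal (Phi \<beta> \<bar>f x\<bar>)) \<in> borel_measurable lebesgue" by measurable
  from Calderon_Zygmund[OF this fin] obtain T where "countable T" "\<And>c l. (c, l) \<in> T \<Longrightarrow> 0 < l"
    "disjoint_family_on (\<lambda>(c, l). hcube c l) T"
    "\<And>c l. (c, l) \<in> T \<Longrightarrow> ennreal (l ^ DIM('a)) \<le> (\<integral>\<^sup>+x. ennreal (Phi \<beta> \<bar>f x\<bar>) * indicator (hcube c l) x \<partial>lebesgue)"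
    "\<And>c l. (c, l) \<in> T \<Longrightarrow> (\<integral>\<^sup>+x. ennreal (Phi \<beta> \<bar>f x\<bar>) * indicator (hcube c l) x \<partial>lebesgue) \<le> ennreal (2 ^ DIM('a) * l ^ DIM('a))"
    "AE x in lebesgue. x \<notin> (\<Union>(c, l)\<in>T. hcube c l) \<longrightarrow> ennreal (Phi \<beta> \<bar>f x\<bar>) \<le> 1"
    by blast
  then have "stopped_cubes f \<beta> T" unfolding stopped_cubes_def using bf by blast
  then show ?thesis ..
qed

lemma conj_exp_ge_1: "1 < y \<Longrightarrow> 1 \<le> conj_exp y"
  by (simp add: conj_exp_def le_divide_eq)

text \<open>The factor in front of the integral in \<open>sparse_form_le\<close>, freed of its power
  of the conjugate exponent: the power of 2 is from \<open>modular_cube\<close>, the first power of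
  3 with 72 and \<open>(2 * \<beta>) ^ \<beta>\<close> from \<open>LlogL_norm_le_avg\<close>, and
  the second power of 3 over \<open>\<eta>\<close> from sparseness. Adding 1 makes it at least 1, as
  \<open>constant_bound\<close> wants.\<close>

definition weak_const :: "real \<Rightarrow> nat \<Rightarrow> nat \<Rightarrow> real" where
  "weak_const \<eta> \<beta> n = 2 ^ (\<beta> + n) * 3 ^ n * 72 * (2 * \<beta>) ^ \<beta> * 3 ^ n / \<eta> + 1"

section \<open>Testing the sparse domination outside the tripled cubes\<close>

context stopped_cubes
begin

lemma weak_estimate_outside:
  fixes g :: "'a \<Rightarrow> real"
  assumes eta: "0 < \<eta>" and t: "1 \<le> t" and r: "1 \<le> r" and p: "1 < p" "p \<le> 2" and qr: "r < conj_exp p"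
    and tau: "1 < t * (conj_exp p / r - 1) / (conj_exp p - 1)"
    and D: "0 \<le> D" and sp: "sparse \<eta> S" and w: "bdd_nonneg (\<lambda>x. \<bar>g x\<bar>)"
    and zero: "\<And>x. x \<in> Om3 \<Longrightarrow> g x = 0"
    and fin: "(\<integral>\<^sup>+x. ennreal \<bar>g x\<bar> \<partial>lebesgue) = ennreal W" "0 \<le> W"
    and dom: "sparse_form S \<beta> r f g < \<infinity> \<Longrightarrow> W \<le> D * enn2real (sparse_form S \<beta> r f g)"
    and J: "(\<integral>\<^sup>+x. ennreal (h x powr p * mx (\<lambda>y. \<bar>g y\<bar> powr t) x powr (1 / t)) \<partial>lebesgue) = ennreal J" "0 \<le> J"
  shows "W \<le> (2 * weak_const \<eta> \<beta> DIM('a))\<^sup>2 * 9 ^ DIM('a) * 32 *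
    (D * conj_exp p ^ (1 + \<beta>) * conj_exp (conj_exp p / r) *
      conj_exp (t * (conj_exp p / r - 1) / (conj_exp p - 1)) powr (1 / conj_exp p)) powr p * J"
proof -
  let ?n = "DIM('a)"
  define P where "P = conj_exp p"
  define Q where "Q = conj_exp (P / r)"
  define R where "R = conj_exp (t * (P / r - 1) / (P - 1))"
  define k where "k = P * (1 / r - 1 / (p * t))"
  \<comment> \<open>At the midpoint both \<open>s - 1\<close> and \<open>p - s\<close> equal
    \<open>(p - 1) / 2\<close>, so the Orlicz comparison and the maximal theorem at
    \<open>p / s\<close> each lose only multiples of \<open>P\<close>.\<close>
  define s where "s = (1 + p) / 2"
  have P1: "P = p / (p - 1)" "1 < P" using p by (auto simp: P_def conj_exp_def)
  have k: "1 < k" "k \<le> P" "conj_exp k \<le> Q * R"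
    using exponent_identities[OF p(1) r t qr tau] unfolding k_def Q_def R_def P_def by auto
  have "1 < P / r" using qr r by (simp add: P_def)
  then have Q1: "1 \<le> Q" unfolding Q_def by (rule conj_exp_ge_1)
  have R1: "1 \<le> R" using tau unfolding R_def P_def by (rule conj_exp_ge_1)
  have s: "1 < s" "s \<le> 2" "s < p" using p by (auto simp: s_def)
  \<comment> \<open>The exponents are forced: Young pairs \<open>p\<close> with \<open>P\<close>, so
    \<open>a = 1 / p\<close> leaves one power of \<open>v\<close> in \<open>A powr p\<close>, and
    \<open>e1\<close> gives \<open>b = 1 / P\<close>. The choice of \<open>k\<close> is the solution
    of \<open>e2\<close>, and \<open>\<kappa> * k = 1\<close> returns \<open>\<bar>g\<bar>\<close>
    from the maximal theorem in \<open>L^k\<close>.\<close>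
  define \<kappa> where "\<kappa> = 1 / k"
  define a where "a = 1 / p"
  define b where "b = 1 / P"
  have ab: "0 < \<kappa>" "0 < a" "0 < b" using k p P1 by (auto simp: \<kappa>_def a_def b_def)
  have "b = (p - 1) / p" using p by (simp add: b_def P1(1))
  then have e1: "a + b = 1" using p by (simp add: a_def add_divide_distrib[symmetric])
  have bk: "b / \<kappa> = k / P" by (simp add: b_def \<kappa>_def)
  have e2: "1 / r = a / t + b / \<kappa>"
    unfolding bk using P1(2) by (simp add: a_def k_def)
  define N where "N = 2 ^ (\<beta> + ?n) * 3 ^ ?n * 72 * (\<beta> / (s - 1)) ^ \<beta>"
  have N0: "0 \<le> N" using s by (simp add: N_def)
  have wt: "bdd_nonneg (\<lambda>y. \<bar>g y\<bar> powr t)" and wk: "bdd_nonneg (\<lambda>y. \<bar>g y\<bar> powr \<kappa>)"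
    using t ab by (auto intro!: bdd_nonneg_powr w)
  define v where "v x = mx (\<lambda>y. \<bar>g y\<bar> powr t) x powr (1 / t)" for x
  define A where "A x = mx (\<lambda>y. (h y * v y powr a) powr s) x powr (1 / s)" for x
  define B where "B x = mx (\<lambda>y. \<bar>g y\<bar> powr \<kappa>) x powr (b / \<kappa>)" for x
  have v: "bdd_nonneg v" unfolding v_def using t by (intro bdd_nonneg_powr bdd_nonneg_mx wt) auto
  have Fs: "bdd_nonneg (\<lambda>y. (h y * v y powr a) powr s)"
    using s ab by (intro bdd_nonneg_powr bdd_nonneg_mult bdd_nonneg_h v) auto
  have AB: "bdd_nonneg A" "bdd_nonneg B"
    unfolding A_def B_def using s ab by (auto intro!: bdd_nonneg_powr bdd_nonneg_mx Fs wk)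
  note [measurable] = AB[THEN bdd_nonneg_measurable]
  have form: "sparse_form S \<beta> r f g \<le> ennreal (N * 3 ^ ?n / \<eta>) * (\<integral>\<^sup>+x. ennreal (A x * B x) \<partial>lebesgue)"
    unfolding A_def B_def v_def
  proof (rule sparse_form_le[OF sp eta bdd_nonneg_h w r _ ab _ N0 e1 e2])
    fix c :: 'a and l :: real
    let ?Q = "cbox c (c + l *\<^sub>R One)"
    assume l: "0 < l" and ne: "avg_r r g ?Q \<noteq> 0"
    \<comment> \<open>A cube inside \<open>Om3\<close> does not see \<open>g\<close>, so the nonzero
      average excludes it and \<open>modular_cube\<close> applies.\<close>
    have "\<not> ?Q \<subseteq> Om3"
    proof
      assume "?Q \<subseteq> Om3"
      then have "(\<lambda>x. ennreal (\<bar>g x\<bar> powr r) * indicator ?Q x) = (\<lambda>x. 0)"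
        using zero by (fastforce simp: indicator_def fun_eq_iff)
      then have "avg_r r g ?Q = 0" by (simp add: avg_r_def)
      then show False using ne by simp
    qed
    then show "LlogL_norm \<beta> f ?Q \<le> N * avg (\<lambda>x. h x powr s) (c - l *\<^sub>R One) (3 * l) powr (1 / s)"
      unfolding N_def using l s by (intro LlogL_norm_le_avg bdd_nonneg_h modular_cube) auto
  qed (use t s in auto)
  define c1 where "c1 = 3 ^ ?n * 2 powr (p / s) * conj_exp (p / s)"
  define c2 where "c2 = 3 ^ ?n * 2 powr k * conj_exp k"
  have ps: "1 < p / s" "p / s \<le> 2" using s p by (auto simp: s_def field_simps)
  have cps: "conj_exp (p / s) = 2 * P"
  proof -
    have "p / s - 1 = (p - s) / s" using s by (simp add: diff_divide_distrib)
    then have "conj_exp (p / s) = p / (p - s)" using s by (simp add: conj_exp_def)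
    also have "p - s = (p - 1) / 2" by (simp add: s_def field_simps)
    finally show ?thesis by (simp add: P1(1))
  qed
  have IA: "(\<integral>\<^sup>+x. ennreal (A x powr p) \<partial>lebesgue) \<le> ennreal (c1 * J)"
  proof -
    have "(\<integral>\<^sup>+x. ennreal (A x powr p) \<partial>lebesgue) = (\<integral>\<^sup>+x. ennreal (mx (\<lambda>y. (h y * v y powr a) powr s) x powr (p / s)) \<partial>lebesgue)"
      by (simp add: A_def powr_powr)
    also have "\<dots> \<le> ennreal c1 * (\<integral>\<^sup>+x. ennreal (((h x * v x powr a) powr s) powr (p / s)) \<partial>lebesgue)"
      unfolding c1_def by (rule strong_type_mx[OF Fs ps(1)])
    also have "(\<lambda>x. ((h x * v x powr a) powr s) powr (p / s)) = (\<lambda>x. h x powr p * v x)"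
      using s p bdd_nonneg_ge0[OF v] by (simp add: fun_eq_iff powr_powr powr_mult a_def)
    also have "ennreal c1 * (\<integral>\<^sup>+x. ennreal (h x powr p * v x) \<partial>lebesgue) = ennreal (c1 * J)"
      using J P1 by (simp add: v_def ennreal_mult'' )
    finally show ?thesis .
  qed
  have IB: "(\<integral>\<^sup>+x. ennreal (B x powr P) \<partial>lebesgue) \<le> ennreal (c2 * W)"
  proof -
    have "(\<integral>\<^sup>+x. ennreal (B x powr P) \<partial>lebesgue) = (\<integral>\<^sup>+x. ennreal (mx (\<lambda>y. \<bar>g y\<bar> powr \<kappa>) x powr k) \<partial>lebesgue)"
      using P1(2) unfolding B_def bk by (simp add: powr_powr)
    also have "\<dots> \<le> ennreal c2 * (\<integral>\<^sup>+x. ennreal ((\<bar>g x\<bar> powr \<kappa>) powr k) \<partial>lebesgue)"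
      unfolding c2_def by (rule strong_type_mx[OF wk k(1)])
    also have "(\<lambda>x. (\<bar>g x\<bar> powr \<kappa>) powr k) = (\<lambda>x. \<bar>g x\<bar>)"
      using k by (simp add: fun_eq_iff powr_powr \<kappa>_def)
    also have "ennreal c2 * (\<integral>\<^sup>+x. ennreal \<bar>g x\<bar> \<partial>lebesgue) = ennreal (c2 * W)"
      using fin by (simp add: ennreal_mult'')
    finally show ?thesis .
  qed
  define K where "K = N * 3 ^ ?n / \<eta>"
  have K0: "0 \<le> K" using N0 eta by (simp add: K_def)
  have c10: "0 \<le> c1" and c20: "0 < c2"
    using P1(2) k(1) unfolding c1_def cps by (simp_all add: c2_def conj_exp_def)
  have main: "W \<le> D * K * (\<alpha> powr p * (c1 * J) + \<alpha> powr (- P) * (c2 * W))" if \<alpha>: "0 < \<alpha>" for \<alpha>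
  proof -
    let ?Y = "\<alpha> powr p * (c1 * J) + \<alpha> powr (- P) * (c2 * W)"
    have Y0: "0 \<le> ?Y" using c10 c20 J(2) fin(2) by simp
    have "(\<integral>\<^sup>+x. ennreal (A x * B x) \<partial>lebesgue)
      \<le> ennreal (\<alpha> powr p) * (\<integral>\<^sup>+x. ennreal (A x powr p) \<partial>lebesgue) + ennreal (\<alpha> powr (- P)) * (\<integral>\<^sup>+x. ennreal (B x powr P) \<partial>lebesgue)"
      unfolding P_def using AB p \<alpha> by (intro Young_nn_integral) (auto simp: bdd_nonneg_def)
    also have "\<dots> \<le> ennreal (\<alpha> powr p) * ennreal (c1 * J) + ennreal (\<alpha> powr (- P)) * ennreal (c2 * W)"
      by (intro add_mono mult_left_mono IA IB) auto
    also have "\<dots> = ennreal ?Y"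
      using c10 c20 J(2) fin(2) by (simp add: ennreal_mult'[symmetric])
    finally have "ennreal K * (\<integral>\<^sup>+x. ennreal (A x * B x) \<partial>lebesgue) \<le> ennreal K * ennreal ?Y"
      by (rule mult_left_mono) simp
    then have "sparse_form S \<beta> r f g \<le> ennreal K * ennreal ?Y"
      using form unfolding K_def by (rule order_trans[rotated])
    also have "\<dots> = ennreal (K * ?Y)" using K0 by (rule ennreal_mult'[symmetric])
    finally have sf: "sparse_form S \<beta> r f g \<le> ennreal (K * ?Y)" .
    \<comment> \<open>The bound just proved makes the sparse form finite, which is the condition
      under which the domination speaks.\<close>
    have "W \<le> D * enn2real (sparse_form S \<beta> r f g)"
      using sf by (intro dom) (simp add: order_le_less_trans)
    also have "\<dots> \<le> D * (K * ?Y)"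
      using sf K0 Y0 by (intro mult_left_mono D enn2real_leI) auto
    finally show ?thesis by (simp add: mult.assoc)
  qed
  have "W \<le> (2 * (D * K)) * (2 * (D * K) * c2) powr (p - 1) * (c1 * J)"
    using p D K0 c10 c20 J(2) fin(2) main by (intro absorb[OF p(1) P_def]) auto
  also have "\<dots> = (2 * (D * K)) * (2 * (D * K) * c2) powr (p - 1) * c1 * J" by simp
  also have "\<dots> \<le> (2 * weak_const \<eta> \<beta> ?n)\<^sup>2 * 9 ^ ?n * 32 * (D * P ^ (1 + \<beta>) * Q * R powr (1 / P)) powr p * J"
  proof (intro mult_right_mono J(2) constant_bound[OF p P_def D])
    show "1 \<le> weak_const \<eta> \<beta> ?n" using eta by (simp add: weak_const_def)
    show "0 \<le> D * K" using D K0 by simp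
    have "(\<beta> / (s - 1)) ^ \<beta> \<le> (2 * \<beta> * P) ^ \<beta>"
    proof (rule power_mono)
      have "1 / (s - 1) = 2 * (1 / (p - 1))" using p by (simp add: s_def field_simps)
      also have "\<dots> \<le> 2 * P" using p P1(1) by (simp add: divide_right_mono)
      finally have "\<beta> * (1 / (s - 1)) \<le> \<beta> * (2 * P)" by (rule mult_left_mono) simp
      then show "\<beta> / (s - 1) \<le> 2 * \<beta> * P" by (simp add: mult_ac)
    qed (use s in auto)
    then have "2 ^ (\<beta> + ?n) * 3 ^ ?n * 72 * (\<beta> / (s - 1)) ^ \<beta> * 3 ^ ?n / \<eta>
       \<le> 2 ^ (\<beta> + ?n) * 3 ^ ?n * 72 * (2 * \<beta> * P) ^ \<beta> * 3 ^ ?n / \<eta>"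
      using eta by (intro divide_right_mono mult_right_mono mult_left_mono) auto
    also have "\<dots> = (weak_const \<eta> \<beta> ?n - 1) * P ^ \<beta>"
      by (simp add: weak_const_def power_mult_distrib mult_ac)
    also have "\<dots> \<le> weak_const \<eta> \<beta> ?n * P ^ \<beta>"
      using P1(2) by (intro mult_right_mono) auto
    finally have "D * K \<le> D * (weak_const \<eta> \<beta> ?n * P ^ \<beta>)"
      using D by (intro mult_left_mono) (simp_all add: K_def N_def)
    then show "D * K \<le> D * weak_const \<eta> \<beta> ?n * P ^ \<beta>" by (simp add: mult_ac)
    show "0 \<le> c2" using c20 by simp
    have "3 ^ ?n * 2 powr k * conj_exp k \<le> 3 ^ ?n * 2 powr P * (Q * R)"
      using k by (intro mult_mono powr_mono) (auto simp: conj_exp_def)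
    then show "c2 \<le> 3 ^ ?n * 2 powr P * (Q * R)" by (simp add: c2_def)
    show "0 \<le> c1" by (rule c10)
    have "2 powr (p / s) \<le> (2::real) powr 2" using ps by (intro powr_mono) auto
    then have "3 ^ ?n * 2 powr (p / s) * (2 * P) \<le> 3 ^ ?n * 4 * (2 * P)"
      using P1(2) by (intro mult_right_mono mult_left_mono) auto
    then show "c1 \<le> 8 * 3 ^ ?n * P" by (simp add: c1_def cps)
  qed (fact Q1 R1)+
  finally show ?thesis by (simp only: P_def Q_def R_def)
qed

lemma weak_estimate:
  assumes eta: "0 < \<eta>" and t: "1 \<le> t" and r: "1 \<le> r" and p: "1 < p" "p \<le> 2" and qr: "r < conj_exp p"
    and tau: "1 < t * (conj_exp p / r - 1) / (conj_exp p - 1)"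
    and D: "0 \<le> D" and sp: "sparse \<eta> S"
    and dom: "\<And>g. in_Lp_loc r g \<Longrightarrow> sparse_form S \<beta> r f g < \<infinity> \<Longrightarrow>
      integrable lebesgue (\<lambda>x. g x * Uf x) \<and> \<bar>\<integral>x. g x * Uf x \<partial>lebesgue\<bar> \<le> D * enn2real (sparse_form S \<beta> r f g)"
    and Uf [measurable]: "Uf \<in> borel_measurable lebesgue"
    and w: "bdd_nonneg w" and fin: "(\<integral>\<^sup>+x. ennreal (w x) \<partial>lebesgue) < \<infinity>"
  defines "v \<equiv> \<lambda>x. mx (\<lambda>y. w y powr t) x powr (1 / t)"
  shows "(\<integral>\<^sup>+x. ennreal (w x) * indicator {x. 1 < \<bar>Uf x\<bar>} x \<partial>lebesgue)
    \<le> ennreal (3 ^ DIM('a) * (1 + (2 * weak_const \<eta> \<beta> DIM('a))\<^sup>2 * 9 ^ DIM('a) * 32) *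
      (1 + (D * conj_exp p ^ (1 + \<beta>) * conj_exp (conj_exp p / r) *
        conj_exp (t * (conj_exp p / r - 1) / (conj_exp p - 1)) powr (1 / conj_exp p)) powr p))
      * (\<integral>\<^sup>+x. ennreal (Phi \<beta> \<bar>f x\<bar>) * ennreal (v x) \<partial>lebesgue)"
proof -
  let ?n = "DIM('a)"
  define X where "X = (D * conj_exp p ^ (1 + \<beta>) * conj_exp (conj_exp p / r) *
        conj_exp (t * (conj_exp p / r - 1) / (conj_exp p - 1)) powr (1 / conj_exp p)) powr p"
  define C where "C = (2 * weak_const \<eta> \<beta> ?n)\<^sup>2 * 9 ^ ?n * 32"
  define I where "I = (\<integral>\<^sup>+x. ennreal (Phi \<beta> \<bar>f x\<bar>) * ennreal (v x) \<partial>lebesgue)"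
  have C0: "0 \<le> C" and X0: "0 \<le> X" by (auto simp: C_def X_def)
  note [measurable] = bdd_nonneg_measurable[OF w]
  have "{x \<in> space lebesgue. 1 < \<bar>Uf x\<bar>} \<in> sets lebesgue" by measurable
  then have sE: "{x. 1 < \<bar>Uf x\<bar>} \<in> sets lebesgue" by simp
  define E where "E = {x. 1 < \<bar>Uf x\<bar>} - Om3"
  have [measurable]: "E \<in> sets lebesgue" unfolding E_def using sE by auto
  define w1 where "w1 x = w x * indicator E x" for x
  have w1: "bdd_nonneg w1" unfolding w1_def by (intro bdd_nonneg_mult w bdd_nonneg_indicator) measurable
  note [measurable] = bdd_nonneg_measurable[OF w1]
  have w1w: "w1 x \<le> w x" for x using w by (auto simp: w1_def indicator_def bdd_nonneg_def)
  define g where "g x = sgn (Uf x) * w1 x" for x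
  \<comment> \<open>On \<open>E\<close> the sign is never 0, because
    \<open>\<bar>Uf x\<bar> > 1\<close> there; off \<open>E\<close> both sides vanish.\<close>
  have abs_g: "\<bar>g x\<bar> = w1 x" for x
    using bdd_nonneg_ge0[OF w, of x] by (auto simp: g_def abs_mult w1_def E_def indicator_def sgn_if)
  have g_Uf: "w1 x \<le> g x * Uf x" for x
  proof -
    have "g x * Uf x = w1 x * \<bar>Uf x\<bar>" by (simp add: g_def abs_sgn mult_ac)
    moreover have "w1 x * 1 \<le> w1 x * \<bar>Uf x\<bar>"
    proof (cases "x \<in> E")
      case True
      then show ?thesis using bdd_nonneg_ge0[OF w1] by (intro mult_left_mono) (auto simp: E_def)
    qed (simp add: w1_def)
    ultimately show ?thesis by simp
  qed
  have gm [measurable]: "g \<in> borel_measurable lebesgue" unfolding g_def by measurable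
  have absg: "bdd_nonneg (\<lambda>x. \<bar>g x\<bar>)" using w1 by (simp add: abs_g)
  have "(\<integral>\<^sup>+x. ennreal \<bar>g x\<bar> \<partial>lebesgue) \<le> (\<integral>\<^sup>+x. ennreal (w x) \<partial>lebesgue)"
    using w1w by (intro nn_integral_mono ennreal_leI) (simp add: abs_g)
  then have finW: "(\<integral>\<^sup>+x. ennreal \<bar>g x\<bar> \<partial>lebesgue) < \<infinity>" using fin by (rule order_le_less_trans)
  define W where "W = enn2real (\<integral>\<^sup>+x. ennreal \<bar>g x\<bar> \<partial>lebesgue)"
  have W: "(\<integral>\<^sup>+x. ennreal \<bar>g x\<bar> \<partial>lebesgue) = ennreal W" "0 \<le> W"
    using finW by (auto simp: W_def)
  have gr: "bdd_nonneg (\<lambda>x. \<bar>g x\<bar> powr r)" using r by (intro bdd_nonneg_powr absg) auto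
  have Lr: "in_Lp_loc r g"
    unfolding in_Lp_loc_def
  proof (intro conjI allI impI gm)
    fix K :: "'a set" assume K: "compact K"
    show "(\<integral>\<^sup>+x. ennreal (\<bar>g x\<bar> powr r) * indicator K x \<partial>lebesgue) < \<infinity>"
      using gr fmeasurableD[OF lmeasurable_compact[OF K]] emeasure_compact_finite[OF K]
      by (rule bdd_nonneg_nn_integral_finite)
  qed
  have intW: "integrable lebesgue w1" "(\<integral>x. w1 x \<partial>lebesgue) = W"
  proof -
    have nn: "(\<integral>\<^sup>+x. ennreal (w1 x) \<partial>lebesgue) = ennreal W" using W by (simp add: abs_g)
    show "integrable lebesgue w1"
      by (rule integrableI_nonneg) (use nn bdd_nonneg_ge0[OF w1] in auto)
    show "(\<integral>x. w1 x \<partial>lebesgue) = W"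
      using nn bdd_nonneg_ge0[OF w1] W(2) by (subst integral_eq_nn_integral) auto
  qed
  have domW: "W \<le> D * enn2real (sparse_form S \<beta> r f g)" if "sparse_form S \<beta> r f g < \<infinity>"
  proof -
    have "(\<integral>x. w1 x \<partial>lebesgue) \<le> (\<integral>x. g x * Uf x \<partial>lebesgue)"
      using dom[OF Lr that] by (intro integral_mono intW(1) g_Uf) auto
    then show ?thesis using dom[OF Lr that] intW(2) by linarith
  qed
  have zero: "g x = 0" if "x \<in> Om3" for x using that by (simp add: g_def w1_def E_def)
  \<comment> \<open>Two maximal functions are needed: \<open>v1\<close> is built from
    \<open>g\<close>, which vanishes on \<open>Om3\<close> as \<open>nn_integral_h_le\<close>
    demands, and is then dominated by \<open>v\<close>, built from all of \<open>w\<close>.\<close>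
  define v1 where "v1 x = mx (\<lambda>y. \<bar>g y\<bar> powr t) x powr (1 / t)" for x
  have wt: "bdd_nonneg (\<lambda>y. w y powr t)" "bdd_nonneg (\<lambda>y. \<bar>g y\<bar> powr t)"
    using t by (auto intro!: bdd_nonneg_powr w absg)
  have v1v: "v1 x \<le> v x" for x
    unfolding v_def v1_def
  proof (rule powr_mono2)
    show "mx (\<lambda>y. \<bar>g y\<bar> powr t) x \<le> mx (\<lambda>y. w y powr t) x"
    proof (rule mx_le)
      fix c l assume cl: "0 < l" "x \<in> ocube c l"
      have "avg (\<lambda>y. \<bar>g y\<bar> powr t) c l \<le> avg (\<lambda>y. w y powr t) c l"
        using t w1w cl bdd_nonneg_ge0[OF w1] by (intro avg_mono wt powr_mono2) (auto simp: abs_g)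
      also have "\<dots> \<le> mx (\<lambda>y. w y powr t) x" by (intro avg_le_mx wt cl)
      finally show "avg (\<lambda>y. \<bar>g y\<bar> powr t) c l \<le> mx (\<lambda>y. w y powr t) x" .
    qed
  qed (use t mx_nonneg[OF wt(2)] in auto)
  have hJ: "(\<integral>\<^sup>+x. ennreal (h x powr p * v1 x) \<partial>lebesgue) \<le> 3 ^ ?n * I"
  proof -
    have "(\<integral>\<^sup>+x. ennreal (h x powr p * v1 x) \<partial>lebesgue)
      \<le> 3 ^ ?n * (\<integral>\<^sup>+x. ennreal (Phi \<beta> \<bar>f x\<bar>) * ennreal (v1 x) \<partial>lebesgue)"
      unfolding v1_def using t p zero by (intro nn_integral_h_le absg) auto
    also have "\<dots> \<le> 3 ^ ?n * I"
      unfolding I_def using v1v by (intro mult_left_mono nn_integral_mono ennreal_leI) auto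
    finally show ?thesis .
  qed
  have WI: "ennreal W \<le> ennreal (C * X) * (3 ^ ?n * I)" if I: "I < \<infinity>"
  proof -
    have "3 ^ ?n * I < \<infinity>" using I by (simp add: ennreal_mult_less_top power_less_top_ennreal)
    then have J1: "(\<integral>\<^sup>+x. ennreal (h x powr p * v1 x) \<partial>lebesgue) < \<infinity>"
      using hJ by (rule order_le_less_trans[rotated])
    define J where "J = enn2real (\<integral>\<^sup>+x. ennreal (h x powr p * v1 x) \<partial>lebesgue)"
    have J: "(\<integral>\<^sup>+x. ennreal (h x powr p * v1 x) \<partial>lebesgue) = ennreal J" "0 \<le> J"
      using J1 by (auto simp: J_def)
    have "W \<le> C * X * J"
      unfolding C_def X_def
      using weak_estimate_outside[OF eta t r p qr tau D sp absg zero W domW J[unfolded v1_def]] .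
    then have "ennreal W \<le> ennreal (C * X * J)" by (rule ennreal_leI)
    also have "\<dots> = ennreal (C * X) * ennreal J" using C0 X0 by (intro ennreal_mult') auto
    also have "\<dots> \<le> ennreal (C * X) * (3 ^ ?n * I)"
      using hJ J(1) by (intro mult_left_mono) auto
    finally show ?thesis .
  qed
  have split: "(\<integral>\<^sup>+x. ennreal (w x) * indicator {x. 1 < \<bar>Uf x\<bar>} x \<partial>lebesgue)
    \<le> (\<integral>\<^sup>+x. ennreal (w x) * indicator Om3 x \<partial>lebesgue) + ennreal W"
  proof -
    have "(\<integral>\<^sup>+x. ennreal (w x) * indicator {x. 1 < \<bar>Uf x\<bar>} x \<partial>lebesgue)
      \<le> (\<integral>\<^sup>+x. ennreal (w x) * indicator Om3 x + ennreal \<bar>g x\<bar> \<partial>lebesgue)"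
      by (intro nn_integral_mono) (auto simp: indicator_def abs_g w1_def E_def)
    also have "\<dots> = (\<integral>\<^sup>+x. ennreal (w x) * indicator Om3 x \<partial>lebesgue) + ennreal W"
      by (subst nn_integral_add) (auto simp: W(1))
    finally show ?thesis .
  qed
  show ?thesis
  proof (cases "I < \<infinity>")
    case True
    have "(\<integral>\<^sup>+x. ennreal (w x) * indicator Om3 x \<partial>lebesgue) \<le> 3 ^ ?n * I"
      unfolding I_def v_def using w t by (rule nn_integral_Om3_le)
    with split WI[OF True] have "(\<integral>\<^sup>+x. ennreal (w x) * indicator {x. 1 < \<bar>Uf x\<bar>} x \<partial>lebesgue)
      \<le> 3 ^ ?n * I + ennreal (C * X) * (3 ^ ?n * I)"
      by (meson add_mono order_trans)
    also have "\<dots> = (1 + ennreal (C * X)) * (3 ^ ?n * I)" by (simp add: distrib_right)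
    also have "1 + ennreal (C * X) = ennreal (1 + C * X)" using C0 X0 by simp
    also have "ennreal (1 + C * X) * (3 ^ ?n * I) = ennreal (3 ^ ?n * (1 + C * X)) * I"
      unfolding ennreal_3_power_mult by (simp only: mult_ac)
    also have "\<dots> \<le> ennreal (3 ^ ?n * (1 + C) * (1 + X)) * I"
      using C0 X0 by (intro mult_right_mono ennreal_leI) (auto simp: algebra_simps)
    finally show ?thesis by (simp only: C_def X_def I_def)
  next
    case False
    then have "I = \<infinity>" by (simp add: less_top[symmetric])
    \<comment> \<open>Since \<open>0 * \<infinity> = 0\<close> in \<open>ennreal\<close>, an
      infinite integral yields an infinite right-hand side only with a positive constant.\<close>
    moreover have "0 < 3 ^ ?n * (1 + C) * (1 + X)" using C0 X0 by (intro mult_pos_pos add_pos_nonneg) auto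
    then have "ennreal (3 ^ ?n * (1 + C) * (1 + X)) \<noteq> 0" by (simp only: ennreal_eq_0_iff not_le)
    ultimately have "ennreal (3 ^ ?n * (1 + C) * (1 + X)) * I = \<infinity>"
      by (simp only: ennreal_mult_top infinity_ennreal_def if_False)
    then show ?thesis by (simp only: C_def X_def I_def infinity_ennreal_def top_greatest)
  qed
qed

end

section \<open>Removing the truncation of the weight and lowering the exponent\<close>

lemma nn_integral_indicator_le_of_truncations:
  fixes u :: "'a::euclidean_space \<Rightarrow> real"
  assumes [measurable]: "u \<in> borel_measurable lebesgue" "A \<in> sets lebesgue"
    and le: "\<And>n::nat. (\<integral>\<^sup>+x. ennreal (min (u x) (real n) * indicator (ball 0 (real n)) x) * indicator A x \<partial>lebesgue) \<le> m"
  shows "(\<integral>\<^sup>+x. ennreal (u x) * indicator A x \<partial>lebesgue) \<le> m"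
proof -
  let ?w = "\<lambda>(n::nat) x. ennreal (min (u x) (real n) * indicator (ball 0 (real n)) x) * indicator A x"
  have [measurable]: "ball (0::'a) (real n) \<in> sets lebesgue" for n by simp
  have "(\<integral>\<^sup>+x. ennreal (u x) * indicator A x \<partial>lebesgue) \<le> (\<integral>\<^sup>+x. (SUP n. ?w n x) \<partial>lebesgue)"
  proof (rule nn_integral_mono)
    fix x
    obtain n :: nat where n: "max (u x) (norm x + 1) \<le> real n" using real_arch_simple by blast
    then have "ennreal (u x) * indicator A x = ?w n x" by simp
    also have "\<dots> \<le> (SUP n. ?w n x)" by (rule SUP_upper) simp
    finally show "ennreal (u x) * indicator A x \<le> (SUP n. ?w n x)" .
  qed
  also have "\<dots> = (SUP n. \<integral>\<^sup>+x. ?w n x \<partial>lebesgue)"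
  proof (rule nn_integral_monotone_convergence_SUP)
    show "incseq ?w"
    proof (intro incseq_SucI le_funI mult_right_mono)
      fix n x
      show "ennreal (min (u x) (real n) * indicator (ball 0 (real n)) x)
        \<le> ennreal (min (u x) (real (Suc n)) * indicator (ball 0 (real (Suc n))) x)"
        by (cases "0 \<le> u x") (auto simp: indicator_def ennreal_neg intro!: ennreal_leI)
    qed simp
    show "?w n \<in> borel_measurable lebesgue" for n by measurable
  qed
  also have "\<dots> \<le> m" using le by (intro SUP_least)
  finally show ?thesis .
qed

text \<open>Uses \<open>X\<^sup>2 \<le> 1 + X\<^sup>p\<close> for \<open>p \<ge> 2\<close>; all factors but \<open>conj_exp p ^ (1 + \<beta>)\<close> increase with \<open>p\<close>.\<close>

lemma constant_mono:
  fixes p r t :: real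
  assumes p: "2 < p" and r: "1 \<le> r" and t: "1 \<le> t" and qr: "r < conj_exp p"
    and tau: "1 < t * (conj_exp p / r - 1) / (conj_exp p - 1)" and D: "0 \<le> D"
  shows "r < conj_exp 2" "1 < t * (conj_exp 2 / r - 1) / (conj_exp 2 - 1)"
    "(D * conj_exp 2 ^ (1 + \<beta>) * conj_exp (conj_exp 2 / r) *
      conj_exp (t * (conj_exp 2 / r - 1) / (conj_exp 2 - 1)) powr (1 / conj_exp 2)) powr 2
     \<le> (2 ^ (1 + \<beta>))\<^sup>2 * (1 + (D * conj_exp p ^ (1 + \<beta>) * conj_exp (conj_exp p / r) *
      conj_exp (t * (conj_exp p / r - 1) / (conj_exp p - 1)) powr (1 / conj_exp p)) powr p)"
proof -
  define P where "P = conj_exp p"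
  have P: "P = p / (p - 1)" "1 < P" "P \<le> 2" using p by (auto simp: P_def conj_exp_def field_simps)
  have two: "conj_exp 2 = 2" by (simp add: conj_exp_def)
  show r2: "r < conj_exp 2" using qr P(3) unfolding two P_def by simp
  \<comment> \<open>In this form the quantity is visibly nonincreasing in \<open>s\<close>, so the
    hypothesis survives lowering \<open>p\<close> to 2.\<close>
  have tau_eq: "t * (conj_exp s / r - 1) / (conj_exp s - 1) = t * (1 - s * (1 - 1 / r))" if "1 < s" for s
  proof -
    have "conj_exp s - 1 = 1 / (s - 1)" using that by (simp add: conj_exp_def field_simps)
    moreover have "(conj_exp s / r - 1) * (s - 1) = 1 - s * (1 - 1 / r)"
      using that r by (simp add: conj_exp_def field_simps)
    ultimately show ?thesis by (metis divide_divide_eq_right div_by_1 mult.assoc)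
  qed
  define \<tau> where "\<tau> = t * (conj_exp p / r - 1) / (conj_exp p - 1)"
  define \<tau>2 where "\<tau>2 = t * (conj_exp 2 / r - 1) / (conj_exp 2 - 1)"
  have "2 * (1 - 1 / r) \<le> p * (1 - 1 / r)" using p r by (intro mult_right_mono) auto
  then have "\<tau> \<le> \<tau>2"
    using t p unfolding \<tau>_def \<tau>2_def by (subst (1 2) tau_eq) (auto intro!: mult_left_mono)
  moreover have "1 < \<tau>" using tau by (simp add: \<tau>_def)
  ultimately have taus: "1 < \<tau>" "1 < \<tau>2" "\<tau> \<le> \<tau>2" by auto
  then show "1 < t * (conj_exp 2 / r - 1) / (conj_exp 2 - 1)" by (simp add: \<tau>2_def)
  have anti: "conj_exp y \<le> conj_exp x" if "1 < x" "x \<le> y" for x y :: real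
    using that by (simp add: conj_exp_def field_simps)
  have "1 < P / r" using qr r by (simp add: P_def)
  moreover have "P / r \<le> 2 / r" using P(3) r by (intro divide_right_mono) auto
  ultimately have Q: "conj_exp (2 / r) \<le> conj_exp (P / r)" "1 \<le> conj_exp (2 / r)"
    by (auto intro!: anti conj_exp_ge_1)
  have "conj_exp \<tau>2 powr (1 / 2) \<le> conj_exp \<tau> powr (1 / 2)"
    using taus conj_exp_ge_1[of \<tau>2] by (intro powr_mono2 anti) auto
  also have "\<dots> \<le> conj_exp \<tau> powr (1 / P)"
    using taus P conj_exp_ge_1[of \<tau>] by (intro powr_mono frac_le) auto
  finally have R: "conj_exp \<tau>2 powr (1 / 2) \<le> conj_exp \<tau> powr (1 / P)" .
  define X where "X = D * P ^ (1 + \<beta>) * conj_exp (P / r) * conj_exp \<tau> powr (1 / P)"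
  define X2 where "X2 = D * 2 ^ (1 + \<beta>) * conj_exp (2 / r) * conj_exp \<tau>2 powr (1 / 2)"
  \<comment> \<open>The only factor that grows when \<open>p\<close> is lowered goes from at least 1
    to \<open>2 ^ (1 + \<beta>)\<close>, a loss that depends on \<open>\<beta>\<close>
    alone.\<close>
  have "1 \<le> P ^ (1 + \<beta>)" using P(2) by (intro one_le_power) simp
  then have PP: "2 ^ (1 + \<beta>) \<le> 2 ^ (1 + \<beta>) * P ^ (1 + \<beta>)" "0 \<le> P ^ (1 + \<beta>)" by simp_all
  have "D * 2 ^ (1 + \<beta>) * conj_exp (2 / r) * conj_exp \<tau>2 powr (1 / 2)
    \<le> D * (2 ^ (1 + \<beta>) * P ^ (1 + \<beta>)) * conj_exp (P / r) * conj_exp \<tau> powr (1 / P)"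
    using D PP Q R by (intro mult_mono mult_nonneg_nonneg) auto
  then have X2: "X2 \<le> 2 ^ (1 + \<beta>) * X" by (simp add: X_def X2_def mult_ac)
  have X20: "0 \<le> X2" using D Q by (simp add: X2_def)
  have X0: "0 \<le> X" unfolding X_def using D PP(2) Q by (intro mult_nonneg_nonneg) auto
  have "X\<^sup>2 \<le> 1 + X powr p"
  proof (cases "X \<le> 1")
    case True
    then have "X\<^sup>2 \<le> 1" using X0 by (simp add: power_le_one)
    then show ?thesis using powr_ge_zero[of X p] by linarith
  next
    case False
    then have "X powr 2 \<le> X powr p" using p by (intro powr_mono) auto
    then show ?thesis using False by simp
  qed
  then have "(2 ^ (1 + \<beta>))\<^sup>2 * X\<^sup>2 \<le> (2 ^ (1 + \<beta>))\<^sup>2 * (1 + X powr p)"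
    by (rule mult_left_mono) simp
  moreover have "X2\<^sup>2 \<le> (2 ^ (1 + \<beta>) * X)\<^sup>2" using X2 X20 by (rule power_mono)
  ultimately have "X2\<^sup>2 \<le> (2 ^ (1 + \<beta>))\<^sup>2 * (1 + X powr p)"
    unfolding power_mult_distrib[of _ X] by linarith
  then have "X2 powr 2 \<le> (2 ^ (1 + \<beta>))\<^sup>2 * (1 + X powr p)"
    using X20 by simp
  then show "(D * conj_exp 2 ^ (1 + \<beta>) * conj_exp (conj_exp 2 / r) *
      conj_exp (t * (conj_exp 2 / r - 1) / (conj_exp 2 - 1)) powr (1 / conj_exp 2)) powr 2
     \<le> (2 ^ (1 + \<beta>))\<^sup>2 * (1 + (D * conj_exp p ^ (1 + \<beta>) * conj_exp (conj_exp p / r) *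
      conj_exp (t * (conj_exp p / r - 1) / (conj_exp p - 1)) powr (1 / conj_exp p)) powr p)"
    unfolding X_def X2_def \<tau>_def \<tau>2_def P_def two .
qed

theorem theorem3p1:
  fixes \<beta> :: nat and \<eta> :: real
  assumes "0 < \<eta>" and "\<eta> < 1"
  shows "\<exists>C>0. \<forall>(t::real) (r::real) (p1::real) (D::real)
            (U :: ('a::euclidean_space \<Rightarrow> real) \<Rightarrow> ('a \<Rightarrow> real)) (u :: 'a \<Rightarrow> real) (f :: 'a \<Rightarrow> real).
      1 \<le> t \<longrightarrow> 1 \<le> r \<longrightarrow> 1 < p1 \<longrightarrow> (r = 1 \<or> p1 < conj_exp r) \<longrightarrow>
      t * (conj_exp p1 / r - 1) / (conj_exp p1 - 1) > 1 \<longrightarrow>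
      0 \<le> D \<longrightarrow> sublinear_op U \<longrightarrow> sparse_dom \<eta> \<beta> r D U \<longrightarrow>
      weight u \<longrightarrow> bdd_cpt_supp f \<longrightarrow>
      wmeasure u {x. \<bar>U f x\<bar> > 1}
        \<le> ennreal (C * (1 + (D * conj_exp p1 ^ (1 + \<beta>) * conj_exp (conj_exp p1 / r)
                      * conj_exp (t * (conj_exp p1 / r - 1) / (conj_exp p1 - 1)) powr (1 / conj_exp p1))
                      powr p1))
          * (\<integral>\<^sup>+ y. ennreal (\<bar>f y\<bar> * (ln (exp 1 + \<bar>f y\<bar>)) ^ \<beta>) * maxop_t t u y \<partial>lebesgue)"
proof -
  define C0 where "C0 = 3 ^ DIM('a) * (1 + (2 * weak_const \<eta> \<beta> DIM('a))\<^sup>2 * 9 ^ DIM('a) * 32)"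
  \<comment> \<open>\<open>C0\<close> serves exponents up to 2; the extra factor pays for replacing
    a larger \<open>p1\<close> by 2.\<close>
  define C where "C = C0 * (1 + (2 ^ (1 + \<beta>))\<^sup>2)"
  have C0: "0 < C0" unfolding C0_def by (intro mult_pos_pos add_pos_nonneg) auto
  have C: "0 < C" unfolding C_def using C0 by (intro mult_pos_pos add_pos_nonneg) auto
  show ?thesis
  proof (intro exI[of _ C] conjI C allI impI)
    fix t r p1 D :: real and U :: "('a \<Rightarrow> real) \<Rightarrow> ('a \<Rightarrow> real)" and u f :: "'a \<Rightarrow> real"
    assume t: "1 \<le> t" and r: "1 \<le> r" and p1: "1 < p1" and pr: "r = 1 \<or> p1 < conj_exp r"
      and tau: "t * (conj_exp p1 / r - 1) / (conj_exp p1 - 1) > 1"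
      and D: "0 \<le> D" and sub: "sublinear_op U" and sd: "sparse_dom \<eta> \<beta> r D U"
      and wu: "weight u" and f: "bdd_cpt_supp f"
    define Xp where "Xp p = (D * conj_exp p ^ (1 + \<beta>) * conj_exp (conj_exp p / r)
       * conj_exp (t * (conj_exp p / r - 1) / (conj_exp p - 1)) powr (1 / conj_exp p)) powr p" for p
    \<comment> \<open>The condition \<open>p1 < r'\<close>, read from the side of \<open>r\<close>.
      The case \<open>r = 1\<close> stands for \<open>r' = \<infinity>\<close>, whereas
      \<open>conj_exp 1\<close> evaluates to 0.\<close>
    have qr: "r < conj_exp p1"
    proof (cases "r = 1")
      case True
      then show ?thesis using p1 by (simp add: conj_exp_def)
    next
      case False
      then have "p1 < r / (r - 1)" using pr by (simp add: conj_exp_def)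
      then have "p1 * (r - 1) < r" using r False by (simp add: less_divide_eq)
      then have "r < p1 / (p1 - 1)" using p1 by (simp add: less_divide_eq algebra_simps)
      then show ?thesis by (simp add: conj_exp_def)
    qed
    have "\<exists>p. 1 < p \<and> p \<le> 2 \<and> r < conj_exp p \<and> 1 < t * (conj_exp p / r - 1) / (conj_exp p - 1)
        \<and> C0 * (1 + Xp p) \<le> C * (1 + Xp p1)"
    proof (cases "p1 \<le> 2")
      case True
      have "C0 * (1 + Xp p1) \<le> C * (1 + Xp p1)"
        using C0 unfolding C_def by (intro mult_right_mono) (auto simp: Xp_def mult_le_cancel_left1)
      then show ?thesis using True p1 qr tau by blast
    next
      case False
      then have p2: "2 < p1" by simp
      have "Xp 2 \<le> (2 ^ (1 + \<beta>))\<^sup>2 * (1 + Xp p1)"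
        using constant_mono(3)[OF p2 r t qr tau D, of \<beta>] by (simp only: Xp_def)
      moreover have "0 \<le> Xp p1" by (simp add: Xp_def)
      ultimately have "1 + Xp 2 \<le> (1 + (2 ^ (1 + \<beta>))\<^sup>2) * (1 + Xp p1)" by (simp add: algebra_simps)
      then have "C0 * (1 + Xp 2) \<le> C0 * ((1 + (2 ^ (1 + \<beta>))\<^sup>2) * (1 + Xp p1))"
        using C0 by (intro mult_left_mono) auto
      then show ?thesis using constant_mono(1,2)[OF p2 r t qr tau D] by (intro exI[of _ 2]) (simp add: C_def mult.assoc)
    qed
    then obtain p where p: "1 < p" "p \<le> 2" "r < conj_exp p"
      "1 < t * (conj_exp p / r - 1) / (conj_exp p - 1)" "C0 * (1 + Xp p) \<le> C * (1 + Xp p1)" by blast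
    obtain T where T: "stopped_cubes f \<beta> T" using ex_stopped_cubes[OF f] by blast
    obtain S where S: "sparse \<eta> S"
      "\<And>g. in_Lp_loc r g \<Longrightarrow> sparse_form S \<beta> r f g < \<infinity> \<Longrightarrow>
        integrable lebesgue (\<lambda>x. g x * U f x) \<and> \<bar>\<integral>x. g x * U f x \<partial>lebesgue\<bar> \<le> D * enn2real (sparse_form S \<beta> r f g)"
      using sd f unfolding sparse_dom_def by blast
    have "\<exists>q\<ge>1. in_Lp q f" using in_Lp_of_bdd_cpt_supp[OF f] by (intro exI[of _ 1]) simp
    then have Uf: "U f \<in> borel_measurable lebesgue"
      using sub unfolding sublinear_op_def by blast
    note [measurable] = Uf
    have "{x \<in> space lebesgue. \<bar>U f x\<bar> > 1} \<in> sets lebesgue" by measurable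
    then have sE: "{x. \<bar>U f x\<bar> > 1} \<in> sets lebesgue" by simp
    have um [measurable]: "u \<in> borel_measurable lebesgue" and u0: "\<And>x. 0 \<le> u x"
      using wu by (auto simp: weight_def)
    define J where "J = (\<integral>\<^sup>+ y. ennreal (\<bar>f y\<bar> * (ln (exp 1 + \<bar>f y\<bar>)) ^ \<beta>) * maxop_t t u y \<partial>lebesgue)"
    have "wmeasure u {x. \<bar>U f x\<bar> > 1} \<le> ennreal (C * (1 + Xp p1)) * J"
      unfolding wmeasure_def
    proof (rule nn_integral_indicator_le_of_truncations[OF um sE])
      fix n :: nat
      \<comment> \<open>Each truncation has a finite integral, while the final bound involves the
        maximal function of the full \<open>u\<close> and is therefore uniform in
        \<open>n\<close>.\<close>
      define w where "w x = min (u x) (real n) * indicator (ball 0 (real n)) x" for x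
      have [measurable]: "ball (0::'a) (real n) \<in> sets lebesgue" by simp
      have "bdd_nonneg (\<lambda>x. min (u x) (real n))"
        unfolding bdd_nonneg_def using u0 by (auto intro!: exI[of _ "real n"])
      then have w: "bdd_nonneg w"
        unfolding w_def by (intro bdd_nonneg_mult bdd_nonneg_indicator) auto
      have wu: "w x \<le> u x" for x using u0[of x] by (auto simp: w_def indicator_def)
      have "(\<integral>\<^sup>+x. ennreal (w x) \<partial>lebesgue) = (\<integral>\<^sup>+x. ennreal (w x) * indicator (ball 0 (real n)) x \<partial>lebesgue)"
        by (intro nn_integral_cong) (auto simp: w_def indicator_def)
      also have "\<dots> < \<infinity>"
        using emeasure_lborel_ball_finite[of "0::'a" "real n"]
        by (intro bdd_nonneg_nn_integral_finite w) auto
      finally have fin: "(\<integral>\<^sup>+x. ennreal (w x) \<partial>lebesgue) < \<infinity>" .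
      let ?v = "\<lambda>x. mx (\<lambda>y. w y powr t) x powr (1 / t)"
      have "(\<integral>\<^sup>+x. ennreal (w x) * indicator {x. 1 < \<bar>U f x\<bar>} x \<partial>lebesgue)
        \<le> ennreal (C0 * (1 + Xp p)) * (\<integral>\<^sup>+x. ennreal (Phi \<beta> \<bar>f x\<bar>) * ennreal (?v x) \<partial>lebesgue)"
        unfolding C0_def Xp_def
        using stopped_cubes.weak_estimate[OF T assms(1) t r p(1-4) D S Uf w fin] by simp
      also have "\<dots> \<le> ennreal (C * (1 + Xp p1)) * J"
      proof (rule mult_mono[OF ennreal_leI[OF p(5)]])
        show "(\<integral>\<^sup>+x. ennreal (Phi \<beta> \<bar>f x\<bar>) * ennreal (?v x) \<partial>lebesgue) \<le> J"
          unfolding J_def Phi_def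
          by (intro nn_integral_mono mult_left_mono mx_powr_le_maxop_t w wu t) auto
      qed auto
      finally show "(\<integral>\<^sup>+x. ennreal (min (u x) (real n) * indicator (ball 0 (real n)) x) * indicator {x. \<bar>U f x\<bar> > 1} x \<partial>lebesgue)
        \<le> ennreal (C * (1 + Xp p1)) * J" by (simp add: w_def)
    qed
    then show "wmeasure u {x. \<bar>U f x\<bar> > 1}
        \<le> ennreal (C * (1 + (D * conj_exp p1 ^ (1 + \<beta>) * conj_exp (conj_exp p1 / r)
                      * conj_exp (t * (conj_exp p1 / r - 1) / (conj_exp p1 - 1)) powr (1 / conj_exp p1))
                      powr p1))
          * (\<integral>\<^sup>+ y. ennreal (\<bar>f y\<bar> * (ln (exp 1 + \<bar>f y\<bar>)) ^ \<beta>) * maxop_t t u y \<partial>lebesgue)"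
      by (simp only: Xp_def J_def)
  qed
qed

end
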